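(* Let $p(x,y)$ be a hermitian $d\times d$ matrix-valued free polynomial in the freely noncommuting hermitian variables $x=(x_1,\dots,x_\mu)$, $y=(y_1,\dots,y_\mu)$. If $p$ is $xy$-convex, then there exist a hermitian $d\times d$ matrix-valued $xy$-pencil $\lambda$, a positive integer $N$ and an $N\times d$ matrix-valued $xy$-pencil $\Lambda$ such that $$p(x,y)=\lambda(x,y)+\Lambda(x,y)^*\Lambda(x,y).$$ In particular, $-p=-\lambda-\Lambda^*\Lambda$ is the Schur complement (with respect to the upper left block $I$) of the hermitian $xy$-pencil $$\begin{pmatrix} I & \Lambda(x,y)\\ \Lambda(x,y)^* & -\lambda(x,y)\end{pmatrix},$$ and the set $\mathcal D_{-p}=\{(X,Y): p(X,Y)\preceq 0\}$ is the feasible set of the bilinear matrix inequality $$\begin{pmatrix} I & \Lambda(x,y)\\ \Lambda(x,y)^* & -\lambda(x,y)\end{pmatrix}\succeq 0,$$ that is, for all $n$ and all $(X,Y)\in\mathbb S_n(\mathbb C^\mu)\times\mathbb S_n(\mathbb C^\mu)$, $p(X,Y)\preceq 0$ if and only if this block matrix evaluated at $(X,Y)$ is positive semidefinite. Conversely, if $p=\lambda+\Lambda^*\Lambda$ for some such $\lambda$ and $\Lambda$, then $p$ is $xy$-convex.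
   Context: $\mathbb S_n(\mathbb C^\mu)$ denotes the set of $\mu$-tuples of $n\times n$ complex hermitian matrices. For a hermitian matrix $T$, $T\succeq 0$ means $T$ is positive semidefinite, and $S\preceq T$ means $T-S\succeq 0$. An isometry $V:\mathbb C^m\to\mathbb C^n$ satisfies $V^*V=I_m$. Free polynomials: an $N\times d$ matrix-valued free polynomial is a finite sum $p=\sum_w p_w w$ over words $w$ (including the empty word) in the freely noncommuting variables $x_1,\dots,x_\mu,y_1,\dots,y_\mu$, with $p_w\in M_{N,d}(\mathbb C)$. It is evaluated at $(X,Y)\in\mathbb S_n(\mathbb C^\mu)\times\mathbb S_n(\mathbb C^\mu)$ by $p(X,Y)=\sum_w p_w\otimes w(X,Y)$, where $w(X,Y)$ is the product obtained by substituting $X_j$ for $x_j$ and $Y_k$ for $y_k$ (the empty word gives $I_n$). The involution is $p^*=\sum_w p_w^* w^*$, where $w^*$ is $w$ with the order of its letters reversed (the variables are hermitian: $x_j^*=x_j$, $y_k^*=y_k$). A $d\times d$ matrix-valued $p$ is hermitian if $p^*=p$. An $xy$-pencil is a free polynomial of the form $$L(x,y)=A_0-\sum_{j=1}^\mu A_jx_j-\sum_{k=1}^\mu B_ky_k-\sum_{p,q=1}^\mu C_{pq}x_py_q-\sum_{p,q=1}^\mu D_{qp}y_qx_p,$$ with coefficient matrices all of the same (possibly rectangular) size. It is hermitian if it is hermitian as a polynomial, i.e. the coefficients are square, $A_0,A_j,B_k$ are hermitian and $D_{qp}=C_{pq}^*$. An $xy$-pair is a tuple $((X,Y),V)$ where,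 for some positive integers $m,n$, $(X,Y)\in\mathbb S_n(\mathbb C^\mu)\times\mathbb S_n(\mathbb C^\mu)$ and $V:\mathbb C^m\to\mathbb C^n$ is an isometry such that $V^*(X_iY_j)V=(V^*X_iV)(V^*Y_jV)$ for all $1\le i,j\le\mu$. Write $V^*(X,Y)V$ for the tuple $(V^*X_1V,\dots,V^*X_\mu V,V^*Y_1V,\dots,V^*Y_\mu V)$. A hermitian $d\times d$ matrix-valued free polynomial $p(x,y)$ is $xy$-convex if $p(V^*(X,Y)V)\preceq (I_d\otimes V)^*p(X,Y)(I_d\otimes V)$ for all $xy$-pairs $((X,Y),V)$. *)

theory Defs
  imports "Jordan_Normal_Form.Schur_Decomposition"
begin

section \<open>Hermitian and positive semidefinite matrices\<close>

definition hermitian_mats :: "nat \<Rightarrow> complex mat set" where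
  "hermitian_mats n = {A \<in> carrier_mat n n. mat_adjoint A = A}"

text \<open>\<open>(T *\<^sub>v v) \<bullet>c v\<close> is \<open>v\<^sup>* T v\<close>, which is real for hermitian \<open>T\<close>.\<close>

definition psd :: "complex mat \<Rightarrow> bool" where
  "psd T \<longleftrightarrow> T \<in> hermitian_mats (dim_row T) \<and>
     (\<forall>v \<in> carrier_vec (dim_row T). 0 \<le> Re ((T *\<^sub>v v) \<bullet>c v))"

definition loewner_le :: "complex mat \<Rightarrow> complex mat \<Rightarrow> bool" where
  "loewner_le S T \<longleftrightarrow> psd (T - S)"

definition kron :: "complex mat \<Rightarrow> complex mat \<Rightarrow> complex mat" where
  "kron A B = mat (dim_row A * dim_row B) (dim_col A * dim_col B)
     (\<lambda>(i, j). A $$ (i div dim_row B, j div dim_col B) * B $$ (i mod dim_row B, j mod dim_col B))"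

definition compress :: "complex mat \<Rightarrow> complex mat \<Rightarrow> complex mat" where
  "compress V T = mat_adjoint V * T * V"

text \<open>A \<open>\<mu>\<close>-tuple of matrices is a function on \<open>nat\<close> of which only the values at indices
  \<open>j < \<mu>\<close> matter; indices start at 0.\<close>

definition hermitian_tuples :: "nat \<Rightarrow> nat \<Rightarrow> (nat \<Rightarrow> complex mat) set" where
  "hermitian_tuples \<mu> n = {X. \<forall>j<\<mu>. X j \<in> hermitian_mats n}"


section \<open>Matrix-valued free polynomials\<close>

datatype letter = VarX nat | VarY nat

fun letter_index :: "letter \<Rightarrow> nat" where
  "letter_index (VarX j) = j"
| "letter_index (VarY k) = k"

definition words :: "nat \<Rightarrow> letter list set" where
  "words \<mu> = {w. \<forall>l \<in> set w. letter_index l < \<mu>}"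

text \<open>A polynomial is the function sending a word \<open>w\<close> to its coefficient \<open>p\<^sub>w\<close>. All coefficients,
  the zero ones included, have the same size, so that \<open>p []\<close> displays the size of \<open>p\<close>, and
  equality of polynomials is equality of functions.\<close>

type_synonym fpoly = "letter list \<Rightarrow> complex mat"

definition fpolys :: "nat \<Rightarrow> nat \<Rightarrow> nat \<Rightarrow> fpoly set" where
  "fpolys \<mu> r c = {p. (\<forall>w. p w \<in> carrier_mat r c) \<and>
     finite {w. p w \<noteq> 0\<^sub>m r c} \<and> {w. p w \<noteq> 0\<^sub>m r c} \<subseteq> words \<mu>}"

definition fp_one :: "nat \<Rightarrow> fpoly" where
  "fp_one r = (\<lambda>w. if w = [] then 1\<^sub>m r else 0\<^sub>m r r)"

definition fp_add :: "fpoly \<Rightarrow> fpoly \<Rightarrow> fpoly" where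
  "fp_add p q = (\<lambda>w. p w + q w)"

definition fp_uminus :: "fpoly \<Rightarrow> fpoly" where
  "fp_uminus p = (\<lambda>w. - p w)"

definition fp_minus :: "fpoly \<Rightarrow> fpoly \<Rightarrow> fpoly" where
  "fp_minus p q = (\<lambda>w. p w - q w)"

text \<open>The coefficient of \<open>w\<close> in a product is the sum of \<open>p\<^sub>u q\<^sub>v\<close> over all factorizations \<open>w = uv\<close>.
  The sum is taken entrywise because \<open>complex mat\<close> is not a commutative monoid.\<close>

definition fp_mult :: "fpoly \<Rightarrow> fpoly \<Rightarrow> fpoly" where
  "fp_mult p q = (\<lambda>w. mat (dim_row (p [])) (dim_col (q []))
     (\<lambda>ij. \<Sum>k\<le>length w. (p (take k w) * q (drop k w)) $$ ij))"

definition fp_star :: "fpoly \<Rightarrow> fpoly" where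
  "fp_star p = (\<lambda>w. mat_adjoint (p (rev w)))"

definition fp_hermitian :: "fpoly \<Rightarrow> bool" where
  "fp_hermitian p \<longleftrightarrow> fp_star p = p"

definition fp_block :: "fpoly \<Rightarrow> fpoly \<Rightarrow> fpoly \<Rightarrow> fpoly \<Rightarrow> fpoly" where
  "fp_block A B C D = (\<lambda>w. four_block_mat (A w) (B w) (C w) (D w))"

text \<open>\<open>S\<close> is the Schur complement \<open>D - C A\<^sup>-\<^sup>1 B\<close> of \<open>M\<close> with respect to its upper left
  \<open>N \<times> N\<close> block \<open>A\<close>, which has to be invertible in the matrices over the free algebra.\<close>

definition fp_schur_complement :: "nat \<Rightarrow> nat \<Rightarrow> nat \<Rightarrow> fpoly \<Rightarrow> fpoly \<Rightarrow> bool" where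
  "fp_schur_complement \<mu> N d M S \<longleftrightarrow>
     (\<exists>A \<in> fpolys \<mu> N N. \<exists>B \<in> fpolys \<mu> N d. \<exists>C \<in> fpolys \<mu> d N. \<exists>D \<in> fpolys \<mu> d d.
        \<exists>A' \<in> fpolys \<mu> N N.
          M = fp_block A B C D \<and>
          fp_mult A A' = fp_one N \<and> fp_mult A' A = fp_one N \<and>
          S = fp_minus D (fp_mult (fp_mult C A') B))"

fun letter_eval :: "(nat \<Rightarrow> complex mat) \<Rightarrow> (nat \<Rightarrow> complex mat) \<Rightarrow> letter \<Rightarrow> complex mat" where
  "letter_eval X Y (VarX j) = X j"
| "letter_eval X Y (VarY k) = Y k"

definition word_eval ::
  "nat \<Rightarrow> (nat \<Rightarrow> complex mat) \<Rightarrow> (nat \<Rightarrow> complex mat) \<Rightarrow> letter list \<Rightarrow> complex mat" where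
  "word_eval n X Y w = foldr (\<lambda>l M. letter_eval X Y l * M) w (1\<^sub>m n)"

text \<open>\<open>p(X,Y) = \<Sum>\<^sub>w p\<^sub>w \<otimes> w(X,Y)\<close> for \<open>n \<times> n\<close> matrices, summed entrywise over the words with nonzero
  coefficient.\<close>

definition fp_eval ::
  "nat \<Rightarrow> fpoly \<Rightarrow> (nat \<Rightarrow> complex mat) \<Rightarrow> (nat \<Rightarrow> complex mat) \<Rightarrow> complex mat" where
  "fp_eval n p X Y = (let r = dim_row (p []); c = dim_col (p []) in
     mat (r * n) (c * n)
       (\<lambda>ij. \<Sum>w \<in> {w. p w \<noteq> 0\<^sub>m r c}. kron (p w) (word_eval n X Y w) $$ ij))"


section \<open>Pencils and convexity\<close>

text \<open>The polynomial
  \<open>A\<^sub>0 - \<Sum>\<^sub>j A\<^sub>j x\<^sub>j - \<Sum>\<^sub>k B\<^sub>k y\<^sub>k - \<Sum>\<^sub>p\<^sub>q C\<^sub>p\<^sub>q x\<^sub>p y\<^sub>q - \<Sum>\<^sub>p\<^sub>q D\<^sub>q\<^sub>p y\<^sub>q x\<^sub>p\<close>, given by its coefficients.\<close>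

definition xy_pencil_of ::
  "nat \<Rightarrow> nat \<Rightarrow> nat \<Rightarrow> complex mat \<Rightarrow> (nat \<Rightarrow> complex mat) \<Rightarrow> (nat \<Rightarrow> complex mat) \<Rightarrow>
     (nat \<Rightarrow> nat \<Rightarrow> complex mat) \<Rightarrow> (nat \<Rightarrow> nat \<Rightarrow> complex mat) \<Rightarrow> fpoly" where
  "xy_pencil_of \<mu> r c A0 A B C D = (\<lambda>w.
     if w \<in> words \<mu> then
       (case w of
          [] \<Rightarrow> A0
        | [VarX j] \<Rightarrow> - A j
        | [VarY k] \<Rightarrow> - B k
        | [VarX p, VarY q] \<Rightarrow> - C p q
        | [VarY q, VarX p] \<Rightarrow> - D q p
        | _ \<Rightarrow> 0\<^sub>m r c)
     else 0\<^sub>m r c)"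

definition xy_pencil :: "nat \<Rightarrow> nat \<Rightarrow> nat \<Rightarrow> fpoly \<Rightarrow> bool" where
  "xy_pencil \<mu> r c L \<longleftrightarrow>
     (\<exists>A0 A B C D. A0 \<in> carrier_mat r c \<and>
        (\<forall>j<\<mu>. A j \<in> carrier_mat r c \<and> B j \<in> carrier_mat r c) \<and>
        (\<forall>i<\<mu>. \<forall>j<\<mu>. C i j \<in> carrier_mat r c \<and> D i j \<in> carrier_mat r c) \<and>
        L = xy_pencil_of \<mu> r c A0 A B C D)"

definition hermitian_xy_pencil :: "nat \<Rightarrow> nat \<Rightarrow> fpoly \<Rightarrow> bool" where
  "hermitian_xy_pencil \<mu> d L \<longleftrightarrow> xy_pencil \<mu> d d L \<and> fp_hermitian L"

definition xy_pair ::
  "nat \<Rightarrow> nat \<Rightarrow> nat \<Rightarrow> (nat \<Rightarrow> complex mat) \<Rightarrow> (nat \<Rightarrow> complex mat) \<Rightarrow> complex mat \<Rightarrow> bool" where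
  "xy_pair \<mu> n m X Y V \<longleftrightarrow>
     0 < n \<and> 0 < m \<and> X \<in> hermitian_tuples \<mu> n \<and> Y \<in> hermitian_tuples \<mu> n \<and>
     V \<in> carrier_mat n m \<and> mat_adjoint V * V = 1\<^sub>m m \<and>
     (\<forall>i<\<mu>. \<forall>j<\<mu>. compress V (X i * Y j) = compress V (X i) * compress V (Y j))"

definition xy_convex :: "nat \<Rightarrow> nat \<Rightarrow> fpoly \<Rightarrow> bool" where
  "xy_convex \<mu> d p \<longleftrightarrow>
     (\<forall>n m X Y V. xy_pair \<mu> n m X Y V \<longrightarrow>
        loewner_le (fp_eval m p (\<lambda>j. compress V (X j)) (\<lambda>k. compress V (Y k)))
                   (compress (kron (1\<^sub>m d) V) (fp_eval n p X Y)))"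

end

theory Submission
  imports "HOL-Analysis.Function_Topology" "HOL-Analysis.Topology_Euclidean_Space" Defs
begin

text \<open>Let \<open>p\<close> be \<open>xy\<close>-convex. Compressing to a coordinate subspace deletes from the entries of
  \<open>p(X, Y)\<close> the walks that leave the subspace, so that convexity says that the walks with an
  excursion form a positive form. On a path graph labelled by a word \<open>w\<close> of maximal length the
  only walk between the two ends is \<open>w\<close> itself, while walks from the far end back to itself are
  too long to make an excursion; a positive form with a vanishing diagonal entry has vanishing row,
  hence \<open>p\<^sub>w = 0\<close>. This leaves pencil words and words \<open>s\<^sup>* t\<close> where \<open>s\<close>, \<open>t\<close> are non-empty pencil
  words.

  It remains to find a positive semidefinite Gram matrix \<open>G\<close> indexed by the pencil words for the
  words outside of a pencil. If there is none, a functional separates \<open>p\<close> from the squares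
  \<open>\<Lambda>\<^sup>* \<Lambda>\<close>, and a GNS construction turns it into an \<open>xy\<close>-pair: vanishing on pencils provides the
  orthogonality which the definition of \<open>xy\<close>-pairs demands, and convexity on this pair contradicts
  the separation. The converse holds since pencils are compatible with compression along
  \<open>xy\<close>-pairs and \<open>V V\<^sup>* \<preceq> I\<close>.\<close>

subsection \<open>Positive semidefinite kernels\<close>

text \<open>As \<open>lam\<close> is an arbitrary hermitian pencil, a square has to match
  \<open>p\<close> only outside of the pencil words; the difference is then a pencil, and hermitian
  because both terms are. For the same reason the empty word is left out of the Gram index: its
  products with pencil words are pencil words again. This also leaves only indices of length 1 and
  2, so that a word \<open>rev s @ s\<close> arises from no other pair of indices. Hence every
  diagonal entry of the Gram matrix is prescribed, and this makes the cone in the separation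
  argument closed. Off the diagonal a word such as \<open>x y x\<close> splits in two ways, so only
  sums of Gram entries are prescribed; no formula gives the matrix and duality is called for.

  The obstacle in the GNS step is that a letter has to act on the Gram vectors by a hermitian
  operator with prescribed images. For a degenerate functional a linear relation between the vectors
  need not be respected by these images. A strictly positive functional makes the vectors a basis,
  on which the operator can be given by its matrix.\<close>

definition herm_on :: "'a set \<Rightarrow> ('a \<Rightarrow> 'a \<Rightarrow> complex) \<Rightarrow> bool" where
  "herm_on A M \<longleftrightarrow> (\<forall>a\<in>A. \<forall>b\<in>A. M b a = cnj (M a b))"

text \<open>Indices come from an arbitrary finite set instead of an initial segment of the naturals,
  because they will be pairs of a word and a coordinate, or of a coordinate and a vertex.\<close>

definition qform :: "'a set \<Rightarrow> ('a \<Rightarrow> 'a \<Rightarrow> complex) \<Rightarrow> ('a \<Rightarrow> complex) \<Rightarrow> complex" where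
  "qform A M v = (\<Sum>a\<in>A. \<Sum>b\<in>A. cnj (v a) * M a b * v b)"

definition psd_on :: "'a set \<Rightarrow> ('a \<Rightarrow> 'a \<Rightarrow> complex) \<Rightarrow> bool" where
  "psd_on A M \<longleftrightarrow> herm_on A M \<and> (\<forall>v. 0 \<le> Re (qform A M v))"

lemma herm_onD: "herm_on A M \<Longrightarrow> a \<in> A \<Longrightarrow> b \<in> A \<Longrightarrow> M b a = cnj (M a b)"
  unfolding herm_on_def by blast

lemma psd_on_herm: "psd_on A M \<Longrightarrow> herm_on A M"
  and psd_on_qform: "psd_on A M \<Longrightarrow> 0 \<le> Re (qform A M v)"
  by (auto simp: psd_on_def)

lemma qform_cong:
  assumes "\<And>a b. a \<in> A \<Longrightarrow> b \<in> A \<Longrightarrow> M a b = M' a b" "\<And>a. a \<in> A \<Longrightarrow> v a = v' a"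
  shows "qform A M v = qform A M' v'"
  unfolding qform_def using assms by (intro sum.cong) auto

lemma psd_on_cong:
  assumes "\<And>a b. a \<in> A \<Longrightarrow> b \<in> A \<Longrightarrow> M a b = M' a b"
  shows "psd_on A M \<longleftrightarrow> psd_on A M'"
proof -
  have "qform A M v = qform A M' v" for v by (rule qform_cong) (auto simp: assms)
  moreover have "herm_on A M \<longleftrightarrow> herm_on A M'" unfolding herm_on_def by (simp add: assms)
  ultimately show ?thesis unfolding psd_on_def by simp
qed

lemma qform_two_points:
  assumes "finite A" "x \<in> A" "y \<in> A" "x \<noteq> y"
  shows "qform A M (\<lambda>a. if a = x then s else if a = y then t else 0) =
    cnj s * M x x * s + cnj s * M x y * t + cnj t * M y x * s + cnj t * M y y * t"
proof -
  let ?v = "\<lambda>a. if a = x then s else if a = y then t else 0"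
  have inner: "(\<Sum>b\<in>A. cnj (?v a) * M a b * ?v b) = cnj (?v a) * (M a x * s + M a y * t)" for a
  proof -
    have "(\<Sum>b\<in>A. cnj (?v a) * M a b * ?v b) = (\<Sum>b\<in>{x,y}. cnj (?v a) * M a b * ?v b)"
      using assms by (intro sum.mono_neutral_right) auto
    then show ?thesis using assms by (simp add: algebra_simps)
  qed
  have "qform A M ?v = (\<Sum>a\<in>A. cnj (?v a) * (M a x * s + M a y * t))"
    unfolding qform_def inner ..
  also have "\<dots> = (\<Sum>a\<in>{x,y}. cnj (?v a) * (M a x * s + M a y * t))"
    using assms by (intro sum.mono_neutral_right) auto
  finally show ?thesis using assms by (simp add: algebra_simps)
qed

lemma qform_insert:
  assumes "finite A" "k \<notin> A" and H: "herm_on (insert k A) M"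
  shows "qform (insert k A) M v =
    cnj (v k) * M k k * v k + cnj (v k) * (\<Sum>b\<in>A. M k b * v b) +
      cnj (\<Sum>b\<in>A. M k b * v b) * v k + qform A M v"
proof -
  have "(\<Sum>a\<in>A. cnj (v a) * M a k * v k) = cnj (\<Sum>b\<in>A. M k b * v b) * v k"
    unfolding cnj_sum sum_distrib_right
    using herm_onD[OF H, of k] by (intro sum.cong) auto
  then show ?thesis using assms
    by (simp add: qform_def sum.distrib sum_distrib_left mult.assoc)
qed

text \<open>This is how a vanishing diagonal entry annihilates its row: with weight \<open>z\<close>
  on that index and weight 1 on another one, the value of the form is affine in \<open>z\<close>,
  and its slope is the off-diagonal entry \<open>s\<close>.\<close>

lemma linear_bounded_below_imp_zero:
  fixes s :: complex and c :: real
  assumes "\<And>z. 0 \<le> 2 * Re (cnj z * s) + c"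
  shows "s = 0"
proof (rule ccontr)
  assume "s \<noteq> 0"
  then have n: "(cmod s)\<^sup>2 > 0" by simp
  \<comment> \<open>Scaled such that the bounded expression takes the value
    \<open>- (c + 1) + c = - 1\<close>.\<close>
  define r where "r = (c + 1) / (2 * (cmod s)\<^sup>2)"
  have "cnj (- (of_real r) * s) * s = - of_real (r * (cmod s)\<^sup>2)"
    using complex_norm_square[of s] by (simp add: mult.commute mult.left_commute)
  then have "2 * Re (cnj (- (of_real r) * s) * s) = - 2 * r * (cmod s)\<^sup>2"
    by (simp del: complex_cnj_mult complex_cnj_minus of_real_mult)
  also have "\<dots> = - (c + 1)" using n by (simp add: r_def)
  finally show False using assms[of "- (of_real r) * s"] by linarith
qed

section \<open>Entries and Gram factorizations of positive semidefinite kernels\<close>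

lemma psd_on_diag:
  assumes "finite A" "psd_on A M" "a \<in> A"
  shows "M a a = complex_of_real (Re (M a a))" "0 \<le> Re (M a a)"
proof -
  have "cnj (M a a) = M a a"
    by (rule herm_onD[OF psd_on_herm[OF assms(2)] assms(3,3), symmetric])
  then show "M a a = complex_of_real (Re (M a a))"
    by (simp add: complex_eq_iff)
  have "qform A M (\<lambda>x. if x = a then 1 else 0) = M a a"
  proof -
    have "(\<Sum>b\<in>A. cnj (if x = a then 1 else 0) * M x b * (if b = a then 1 else 0)) =
        (if x = a then M x a else 0)" for x
      using assms by (simp add: if_distrib cong: if_cong)
    then show ?thesis unfolding qform_def using assms by simp
  qed
  then show "0 \<le> Re (M a a)" using psd_on_qform[OF assms(2), of "\<lambda>x. if x = a then 1 else 0"] by simp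
qed

text \<open>Test with weight 1 at \<open>a\<close> and a unimodular weight \<open>z\<close> at
  \<open>b\<close> that rotates \<open>M a b\<close> onto the negative real axis. The bound makes
  compactness a matter of diagonal entries only.\<close>

lemma psd_on_entry_bound:
  assumes "finite A" "psd_on A M" "a \<in> A" "b \<in> A"
  shows "cmod (M a b) \<le> (Re (M a a) + Re (M b b)) / 2"
proof (cases "a = b \<or> M a b = 0")
  case True
  have "cmod (M a a) = Re (M a a)"
    using psd_on_diag[OF assms(1,2,3)] by (metis abs_of_nonneg norm_of_real)
  with True show ?thesis
    using psd_on_diag(2)[OF assms(1,2,3)] psd_on_diag(2)[OF assms(1,2,4)]
    by auto
next
  case False
  define z where "z = - cnj (M a b) / of_real (cmod (M a b))"
  have n: "cmod (M a b) > 0" using False by simp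
  have zz: "cnj z * z = 1"
    using n complex_norm_square[of "M a b"]
    by (simp add: z_def field_simps power2_eq_square)
  have zm: "M a b * z = - of_real (cmod (M a b))"
    using n complex_norm_square[of "M a b"]
    by (simp add: z_def field_simps power2_eq_square)
  have zm': "cnj z * M b a = - of_real (cmod (M a b))"
    using arg_cong[OF zm, of cnj] herm_onD[OF psd_on_herm[OF assms(2)] assms(3,4)]
    by (simp add: mult.commute)
  have "0 \<le> Re (qform A M (\<lambda>x. if x = a then 1 else if x = b then z else 0))"
    by (rule psd_on_qform[OF assms(2)])
  also have "qform A M (\<lambda>x. if x = a then 1 else if x = b then z else 0) =
      M a a + M a b * z + cnj z * M b a + (cnj z * z) * M b b"
    using qform_two_points[OF assms(1,3,4), of M 1 z] False by (simp add: algebra_simps)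
  finally show ?thesis unfolding zz zm zm' by simp
qed

text \<open>Cholesky factorization by induction on the index set. If the pivot \<open>M k k\<close>
  is 0, its row vanishes and \<open>k\<close> contributes nothing; otherwise the Schur complement of
  the pivot is factored and the row \<open>M k b / sqrt m\<close> is added. The columns of
  \<open>B\<close> are the Gram vectors.\<close>

lemma psd_on_factorization:
  assumes "finite A" "psd_on A M"
  shows "\<exists>B. \<forall>a\<in>A. \<forall>b\<in>A. M a b = (\<Sum>c\<in>A. cnj (B c a) * B c b)"
  using assms
proof (induction A arbitrary: M rule: finite_induct)
  case empty
  then show ?case by simp
next
  case (insert k A)
  have H: "herm_on (insert k A) M" by (rule psd_on_herm[OF insert.prems])
  have HA: "herm_on A M" using H unfolding herm_on_def by blast
  define m where "m = Re (M k k)"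
  have fin: "finite (insert k A)" using insert.hyps by simp
  have Mkk: "M k k = of_real m" and m0: "0 \<le> m"
    using psd_on_diag[OF fin insert.prems, of k] by (auto simp: m_def)
  have pos: "0 \<le> Re (qform (insert k A) M v)" for v
    by (rule psd_on_qform[OF insert.prems])
  note expand = qform_insert[OF insert.hyps H]
  have ne: "a \<noteq> k" if "a \<in> A" for a using that insert.hyps by auto
  show ?case
  proof (cases "m = 0")
    case True
    have zero: "M k b = 0" if b: "b \<in> A" for b
    proof (rule linear_bounded_below_imp_zero)
      fix z
      let ?e = "\<lambda>x. if x = b then 1 else 0 :: complex"
      let ?v = "\<lambda>x. if x = k then z else ?e x"
      have s: "(\<Sum>c\<in>A. M k c * ?v c) = M k b"
      proof -
        have "(\<Sum>c\<in>A. M k c * ?v c) = (\<Sum>c\<in>A. if c = b then M k b else 0)"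
          using ne by (intro sum.cong) auto
        then show ?thesis using b insert.hyps by simp
      qed
      have "qform A M ?v = qform A M ?e"
        using ne by (intro qform_cong) auto
      then have "Re (qform (insert k A) M ?v) = 2 * Re (cnj z * M k b) + Re (qform A M ?e)"
        unfolding expand s Mkk True by simp
      with pos[of ?v] show "0 \<le> 2 * Re (cnj z * M k b) + Re (qform A M ?e)" by linarith
    qed
    then have zero': "M b k = 0" if "b \<in> A" for b
      using that herm_onD[OF H, of k b] by simp
    have "psd_on A M"
      unfolding psd_on_def
    proof (intro conjI allI HA)
      fix v
      have "qform A M (v(k := 0)) = qform A M v"
        using ne by (intro qform_cong) auto
      then have "qform (insert k A) M (v(k := 0)) = qform A M v"
        unfolding expand by simp
      with pos[of "v(k := 0)"] show "0 \<le> Re (qform A M v)" by (simp only:)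
    qed
    then obtain B where B: "\<And>a b. a \<in> A \<Longrightarrow> b \<in> A \<Longrightarrow> M a b = (\<Sum>c\<in>A. cnj (B c a) * B c b)"
      using insert.IH by blast
    define B' where "B' = (\<lambda>c b. if c = k \<or> b = k then 0 else B c b)"
    have "(\<Sum>c\<in>A. cnj (B' c a) * B' c b) = (\<Sum>c\<in>A. cnj (B c a) * B c b)"
      if "a \<in> A" "b \<in> A" for a b
      using that ne by (intro sum.cong) (auto simp: B'_def)
    then have "M a b = (\<Sum>c\<in>insert k A. cnj (B' c a) * B' c b)"
      if "a \<in> insert k A" "b \<in> insert k A" for a b
      using that insert.hyps zero zero' B Mkk True by (auto simp: B'_def)
    then show ?thesis by blast
  next
    case False
    then have mp: "m > 0" using m0 by simp
    define M' where "M' = (\<lambda>a b. M a b - M a k * M k b / of_real m)"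
    have "psd_on A M'"
      unfolding psd_on_def
    proof (intro conjI allI)
      show "herm_on A M'"
        unfolding herm_on_def M'_def
      proof (intro ballI)
        fix a b assume "a \<in> A" "b \<in> A"
        then have "M b a = cnj (M a b)" "M b k = cnj (M k b)" "M k a = cnj (M a k)"
          using herm_onD[OF H] by blast+
        then show "M b a - M b k * M k a / of_real m = cnj (M a b - M a k * M k b / of_real m)"
          by simp
      qed
      fix v
      define S where "S = (\<Sum>b\<in>A. M k b * v b)"
      \<comment> \<open>This value at \<open>k\<close> minimizes the form for given values on
        \<open>A\<close>: by completing the square, the form of \<open>M\<close> at
        \<open>v'\<close> is the form of the Schur complement at \<open>v\<close>.\<close>
      define v' where "v' = v(k := - S / of_real m)"
      have S': "(\<Sum>b\<in>A. M k b * v' b) = S"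
        unfolding S_def v'_def using ne by (intro sum.cong) auto
      have q': "qform A M v' = qform A M v"
        unfolding v'_def using ne by (intro qform_cong) auto
      have cS: "(\<Sum>a\<in>A. cnj (v a) * M a k) = cnj S"
        unfolding S_def cnj_sum using herm_onD[OF H, of k]
        by (intro sum.cong) (auto simp: mult.commute)
      have "qform A M' v = qform A M v -
          (\<Sum>a\<in>A. \<Sum>b\<in>A. (cnj (v a) * M a k) * (M k b * v b)) / of_real m"
        unfolding qform_def M'_def sum_divide_distrib sum_subtractf[symmetric]
        by (intro sum.cong refl) (simp add: algebra_simps)
      also have "(\<Sum>a\<in>A. \<Sum>b\<in>A. (cnj (v a) * M a k) * (M k b * v b)) = cnj S * S"
        unfolding sum_product[symmetric] cS by (simp add: S_def)
      finally have qq: "qform A M' v = qform A M v - cnj S * S / of_real m" .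
      have "qform (insert k A) M v' = qform A M v - cnj S * S / of_real m"
        unfolding expand S' q' Mkk using mp by (simp add: v'_def field_simps)
      with pos[of v'] show "0 \<le> Re (qform A M' v)" unfolding qq by (simp only:)
    qed
    then obtain B where B: "\<And>a b. a \<in> A \<Longrightarrow> b \<in> A \<Longrightarrow> M' a b = (\<Sum>c\<in>A. cnj (B c a) * B c b)"
      using insert.IH by blast
    define B' where "B' = (\<lambda>c b. if c = k then M k b / of_real (sqrt m) else if b = k then 0 else B c b)"
    have sq: "complex_of_real (sqrt m) * complex_of_real (sqrt m) = of_real m"
      using mp by (simp add: m0 flip: of_real_mult)
    have top: "cnj (B' k a) * B' k b = M a k * M k b / of_real m" if "a \<in> insert k A" for a b
    proof -
      have "cnj (M k a) = M a k" using herm_onD[OF H _ that, of k] by simp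
      then show ?thesis by (simp add: B'_def sq)
    qed
    have "M a b = (\<Sum>c\<in>insert k A. cnj (B' c a) * B' c b)"
      if ab: "a \<in> insert k A" "b \<in> insert k A" for a b
    proof -
      have eq: "(\<Sum>c\<in>insert k A. cnj (B' c a) * B' c b) =
          M a k * M k b / of_real m + (\<Sum>c\<in>A. cnj (B' c a) * B' c b)"
        using insert.hyps top[OF ab(1)] by simp
      show ?thesis
      proof (cases "a = k \<or> b = k")
        case True
        then have "(\<Sum>c\<in>A. cnj (B' c a) * B' c b) = 0"
          using ne by (intro sum.neutral) (auto simp: B'_def)
        then show ?thesis unfolding eq using True Mkk mp by auto
      next
        case False
        then have "(\<Sum>c\<in>A. cnj (B' c a) * B' c b) = (\<Sum>c\<in>A. cnj (B c a) * B c b)"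
          using ne by (intro sum.cong) (auto simp: B'_def)
        also have "\<dots> = M' a b" using B[of a b] False ab by auto
        finally show ?thesis unfolding eq by (simp add: M'_def)
      qed
    qed
    then show ?thesis by blast
  qed
qed

text \<open>A trivial null space makes the determinant of the matrix enumerated by \<open>h\<close>
  non-zero, and the inverse matrix is carried back to \<open>A\<close>.\<close>

lemma injective_kernel_invertible:
  fixes B :: "'a \<Rightarrow> 'a \<Rightarrow> complex"
  assumes fin: "finite A"
    and inj: "\<And>v. (\<And>c. c \<in> A \<Longrightarrow> (\<Sum>b\<in>A. B c b * v b) = 0) \<Longrightarrow> (\<And>a. a \<in> A \<Longrightarrow> v a = 0)"
  shows "\<exists>C. \<forall>a\<in>A. \<forall>b\<in>A. (\<Sum>c\<in>A. C a c * B c b) = (if a = b then 1 else 0) \<and>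
    (\<Sum>c\<in>A. B a c * C c b) = (if a = b then 1 else 0)"
proof -
  define k where "k = card A"
  obtain h where h: "bij_betw h {0..<k} A"
    using ex_bij_betw_nat_finite[OF fin] by (auto simp: k_def)
  define h' where "h' = inv_into {0..<k} h"
  have h': "bij_betw h' A {0..<k}" unfolding h'_def by (rule bij_betw_inv_into[OF h])
  have hh': "h (h' a) = a" "h' a < k" if "a \<in> A" for a
    using that h bij_betw_inv_into_right[OF h] bij_betw_apply[OF h'] by (auto simp: h'_def)
  have h'h: "h' (h i) = i" "h i \<in> A" if "i < k" for i
    using that bij_betw_inv_into_left[OF h] bij_betw_apply[OF h] by (auto simp: h'_def)
  define Bm where "Bm = mat k k (\<lambda>(i, j). B (h i) (h j))"
  have Bc: "Bm \<in> carrier_mat k k" by (simp add: Bm_def)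
  have "det Bm \<noteq> 0"
  proof
    assume "det Bm = 0"
    then obtain v where v: "v \<in> carrier_vec k" "v \<noteq> 0\<^sub>v k" "Bm *\<^sub>v v = 0\<^sub>v k"
      using det_0_iff_vec_prod_zero[OF Bc] by blast
    have "(\<Sum>b\<in>A. B c b * v $ (h' b)) = 0" if c: "c \<in> A" for c
    proof -
      have "(\<Sum>b\<in>A. B c b * v $ (h' b)) = (\<Sum>i\<in>{0..<k}. B c (h i) * v $ (h' (h i)))"
        by (rule sum.reindex_bij_betw[OF h, symmetric])
      also have "\<dots> = (Bm *\<^sub>v v) $ (h' c)"
        using v(1) hh'[OF c] h'h by (auto simp: scalar_prod_def Bm_def intro!: sum.cong)
      finally show ?thesis using v hh'[OF c] by simp
    qed
    then have "v $ (h' a) = 0" if "a \<in> A" for a using inj[of "\<lambda>a. v $ (h' a)"] that by blast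
    then have "v $ i = 0" if "i < k" for i using h'h[OF that] by metis
    then have "v = 0\<^sub>v k" using v(1) by (intro eq_vecI) auto
    then show False using v(2) by simp
  qed
  then obtain Cm where Cm: "Cm \<in> carrier_mat k k" "Cm * Bm = 1\<^sub>m k" "Bm * Cm = 1\<^sub>m k"
    using det_non_zero_imp_unit[OF Bc] unfolding Units_def ring_mat_def by auto
  define C where "C = (\<lambda>a b. Cm $$ (h' a, h' b))"
  have iff: "h' a = h' b \<longleftrightarrow> a = b" if "a \<in> A" "b \<in> A" for a b
    using hh' that by metis
  show ?thesis
  proof (intro exI[of _ C] ballI conjI)
    fix a b assume ab: "a \<in> A" "b \<in> A"
    have "(\<Sum>c\<in>A. C a c * B c b) = (\<Sum>i\<in>{0..<k}. C a (h i) * B (h i) b)"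
      by (rule sum.reindex_bij_betw[OF h, symmetric])
    also have "\<dots> = (Cm * Bm) $$ (h' a, h' b)"
      using ab hh' h'h Cm(1) by (auto simp: scalar_prod_def Bm_def C_def intro!: sum.cong)
    finally show "(\<Sum>c\<in>A. C a c * B c b) = (if a = b then 1 else 0)"
      using Cm ab hh' iff by simp
    have "(\<Sum>c\<in>A. B a c * C c b) = (\<Sum>i\<in>{0..<k}. B a (h i) * C (h i) b)"
      by (rule sum.reindex_bij_betw[OF h, symmetric])
    also have "\<dots> = (Bm * Cm) $$ (h' a, h' b)"
      using ab hh' h'h Cm(1) by (auto simp: scalar_prod_def Bm_def C_def intro!: sum.cong)
    finally show "(\<Sum>c\<in>A. B a c * C c b) = (if a = b then 1 else 0)"
      using Cm ab hh' iff by simp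
  qed
qed

text \<open>If \<open>B\<close> annihilates \<open>v\<close>, the form vanishes at \<open>v\<close>;
  so definiteness makes the square factor \<open>B\<close> injective. Its two-sided inverse
  \<open>C\<close> expresses the standard basis in the Gram vectors, which allows operators to be
  prescribed on the latter.\<close>

lemma posdef_factorization:
  assumes fin: "finite A" and M: "psd_on A M"
    and pos: "\<And>v. \<exists>a\<in>A. v a \<noteq> 0 \<Longrightarrow> 0 < Re (qform A M v)"
  obtains B C where
    "\<And>a b. a \<in> A \<Longrightarrow> b \<in> A \<Longrightarrow> M a b = (\<Sum>c\<in>A. cnj (B c a) * B c b)"
    "\<And>a b. a \<in> A \<Longrightarrow> b \<in> A \<Longrightarrow> (\<Sum>c\<in>A. C a c * B c b) = (if a = b then 1 else 0)"
    "\<And>a b. a \<in> A \<Longrightarrow> b \<in> A \<Longrightarrow> (\<Sum>c\<in>A. B a c * C c b) = (if a = b then 1 else 0)"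
proof -
  obtain B where B: "\<And>a b. a \<in> A \<Longrightarrow> b \<in> A \<Longrightarrow> M a b = (\<Sum>c\<in>A. cnj (B c a) * B c b)"
    using psd_on_factorization[OF fin M] by blast
  have "\<exists>C. \<forall>a\<in>A. \<forall>b\<in>A. (\<Sum>c\<in>A. C a c * B c b) = (if a = b then 1 else 0) \<and>
    (\<Sum>c\<in>A. B a c * C c b) = (if a = b then 1 else 0)"
  proof (rule injective_kernel_invertible[OF fin])
    fix v a assume z: "\<And>c. c \<in> A \<Longrightarrow> (\<Sum>b\<in>A. B c b * v b) = 0" and a: "a \<in> A"
    have "(\<Sum>b\<in>A. M x b * v b) = 0" if x: "x \<in> A" for x
    proof -
      have "(\<Sum>b\<in>A. M x b * v b) = (\<Sum>b\<in>A. \<Sum>c\<in>A. cnj (B c x) * (B c b * v b))"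
        using x B by (intro sum.cong) (auto simp: sum_distrib_right mult.assoc)
      also have "\<dots> = (\<Sum>c\<in>A. cnj (B c x) * (\<Sum>b\<in>A. B c b * v b))"
        by (subst sum.swap) (simp add: sum_distrib_left)
      finally show ?thesis using z by simp
    qed
    then have "qform A M v = 0"
      unfolding qform_def by (simp add: mult.assoc flip: sum_distrib_left)
    then show "v a = 0" using pos[of v] a by force
  qed
  then show thesis using that[of B] B by blast
qed

section \<open>Closest points in the cone and separation\<close>

text \<open>First-order condition at a minimum: \<open>L\<close> is the slope at 0 from the right,
  and for small \<open>t\<close> the quadratic term cannot compensate a negative slope.\<close>

lemma linear_quadratic_nonneg:
  fixes L W :: real
  assumes "\<And>t. 0 < t \<Longrightarrow> t \<le> 1 \<Longrightarrow> 0 \<le> t * L + t\<^sup>2 * W"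
  shows "0 \<le> L"
proof (rule ccontr)
  assume "\<not> 0 \<le> L"
  then have L: "L < 0" by simp
  define t where "t = min 1 (- L / (2 * (\<bar>W\<bar> + 1)))"
  have t: "0 < t" "t \<le> 1" using L by (auto simp: t_def field_simps)
  have "t * (\<bar>W\<bar> + 1) \<le> - L / (2 * (\<bar>W\<bar> + 1)) * (\<bar>W\<bar> + 1)"
    by (rule mult_right_mono) (auto simp: t_def)
  also have "\<dots> = - L / 2" by (simp add: field_simps)
  finally have "t * (\<bar>W\<bar> + 1) \<le> - L / 2" .
  moreover have "t * W \<le> t * (\<bar>W\<bar> + 1)" using t by (intro mult_left_mono) auto
  ultimately have "L + t * W < 0" using L by linarith
  then have "t * (L + t * W) < 0" using t by (simp add: mult_pos_neg)
  then show False using assms[OF t] by (simp add: power2_eq_square algebra_simps)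
qed

text \<open>Duality for the cone of positive semidefinite \<open>G\<close> of which only the sums over the classes
  outside of \<open>Z\<close> are prescribed. The cone of attainable class sums is closed because the
  diagonal of \<open>G\<close> can be read off its class sums, so that a closest point \<open>\<Phi> G\<close> to the target
  \<open>q\<close> exists; the residual \<open>\<Phi> G - q\<close> is then a separating functional, which becomes
  strictly positive after adding a small multiple of the trace.\<close>

lemma psd_class_sums:
  fixes cls :: "'a \<Rightarrow> 'a \<Rightarrow> 'c" and q :: "'c \<Rightarrow> complex" and st :: "'c \<Rightarrow> 'c"
    and A :: "'a set" and Z :: "'c set"
  defines "C \<equiv> (\<lambda>(a, b). cls a b) ` (A \<times> A) - Z"
  assumes fin: "finite A"
    and cls_st: "\<And>a b. a \<in> A \<Longrightarrow> b \<in> A \<Longrightarrow> cls b a = st (cls a b)"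
    and st_st: "\<And>c. st (st c) = c"
    and Z_st: "\<And>c. c \<in> Z \<Longrightarrow> st c \<in> Z"
    and q_st: "\<And>c. q (st c) = cnj (q c)"
    and diag: "\<And>a b b'. a \<in> A \<Longrightarrow> b \<in> A \<Longrightarrow> b' \<in> A \<Longrightarrow> cls b b' = cls a a \<Longrightarrow> b = a \<and> b' = a"
    and diag_Z: "\<And>a. a \<in> A \<Longrightarrow> cls a a \<notin> Z"
    and pairing: "\<And>m. (\<And>c. m (st c) = cnj (m c)) \<Longrightarrow> (\<And>c. c \<in> Z \<Longrightarrow> m c = 0) \<Longrightarrow>
      psd_on A (\<lambda>a b. m (cls a b)) \<Longrightarrow>
      (\<And>v. \<exists>a\<in>A. v a \<noteq> 0 \<Longrightarrow> 0 < Re (qform A (\<lambda>a b. m (cls a b)) v)) \<Longrightarrow>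
      0 \<le> Re (\<Sum>c\<in>C. m c * q c)"
  obtains G where "psd_on A G"
    "\<And>c. c \<in> C \<Longrightarrow> (\<Sum>(a, b)\<in>{(a, b)\<in>A \<times> A. cls a b = c}. G a b) = q c"
proof -
  define cell where "cell c = {(a, b)\<in>A \<times> A. cls a b = c}" for c
  \<comment> \<open>\<open>F\<close> is the map \<Phi> to the class sums, and \<open>f\<close> the
    squared distance of the class sums from the target \<open>q\<close>.\<close>
  define F where "F G c = (\<Sum>(a, b)\<in>cell c. G a b)" for G :: "'a \<Rightarrow> 'a \<Rightarrow> complex" and c
  define f where "f G = (\<Sum>c\<in>C. (cmod (F G c - q c))\<^sup>2)" for G
  have finC: "finite C" unfolding C_def using fin by simp
  have C_st: "st c \<in> C" if "c \<in> C" for c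
  proof -
    obtain a b where ab: "a \<in> A" "b \<in> A" "c = cls a b" "c \<notin> Z" using \<open>c \<in> C\<close> by (auto simp: C_def)
    then have "st c = cls b a" using cls_st[of a b] by simp
    moreover have "st c \<notin> Z" using Z_st[of "st c"] st_st ab by auto
    ultimately show ?thesis using ab by (force simp: C_def)
  qed
  have cells: "(\<Sum>a\<in>A. \<Sum>b\<in>A. m (cls a b) * G a b) = (\<Sum>c\<in>C. m c * F G c)"
    if m: "\<And>c. c \<notin> C \<Longrightarrow> m c = 0" for m :: "'c \<Rightarrow> complex" and G
  proof -
    let ?T = "(\<lambda>(a, b). cls a b) ` (A \<times> A)"
    have "(\<Sum>a\<in>A. \<Sum>b\<in>A. m (cls a b) * G a b) = (\<Sum>(a, b)\<in>A \<times> A. m (cls a b) * G a b)"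
      by (simp add: sum.cartesian_product)
    also have "\<dots> = (\<Sum>c\<in>?T. \<Sum>x\<in>{x \<in> A \<times> A. (\<lambda>(a, b). cls a b) x = c}. (\<lambda>(a, b). m (cls a b) * G a b) x)"
      using fin by (subst sum.image_gen[of "A \<times> A" _ "\<lambda>(a, b). cls a b"]) auto
    also have "\<dots> = (\<Sum>c\<in>?T. m c * F G c)"
      unfolding F_def cell_def sum_distrib_left
      by (intro sum.cong) (auto simp: case_prod_unfold)
    also have "\<dots> = (\<Sum>c\<in>C. m c * F G c)"
      using fin m by (intro sum.mono_neutral_right) (auto simp: C_def)
    finally show ?thesis .
  qed
  \<comment> \<open>By \<open>diag\<close> the class of \<open>(a, a)\<close> has no other member,
    so that its class sum is the diagonal entry itself.\<close>
  have F_diag: "F G (cls a a) = G a a" if "a \<in> A" for G a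
  proof -
    have "cell (cls a a) = {(a, a)}" using that diag unfolding cell_def by auto
    then show ?thesis by (simp add: F_def)
  qed
  have diag_C: "cls a a \<in> C" if "a \<in> A" for a using that diag_Z by (auto simp: C_def)
  have F_st: "F G (st c) = cnj (F G c)" if "psd_on A G" for G c
  proof -
    have inv: "cls a b = st c \<longleftrightarrow> cls b a = c" if "a \<in> A" "b \<in> A" for a b
      using cls_st[OF that] st_st by metis
    have "F G (st c) = (\<Sum>(a, b)\<in>cell c. G b a)"
      unfolding F_def
      by (rule sum.reindex_bij_witness[of _ "\<lambda>(a, b). (b, a)" "\<lambda>(a, b). (b, a)"])
        (auto simp: cell_def inv cls_st[symmetric])
    also have "\<dots> = cnj (F G c)"
      unfolding F_def cnj_sum using herm_onD[OF psd_on_herm[OF that]]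
      by (intro sum.cong) (auto simp: cell_def)
    finally show ?thesis .
  qed
  have F_add: "F (\<lambda>a b. G a b + of_real t * G' a b) c = F G c + of_real t * F G' c" for G G' t c
    by (simp add: F_def sum.distrib sum_distrib_left case_prod_unfold)

  have psd_add: "psd_on A (\<lambda>a b. G a b + of_real t * G' a b)"
    if "psd_on A G" "psd_on A G'" "0 \<le> t" for G G' t
  proof -
    have "qform A (\<lambda>a b. G a b + of_real t * G' a b) v = qform A G v + of_real t * qform A G' v" for v
      unfolding qform_def sum_distrib_left sum.distrib[symmetric]
      by (intro sum.cong refl) (simp add: algebra_simps)
    moreover have "herm_on A (\<lambda>a b. G a b + of_real t * G' a b)"
      unfolding herm_on_def
    proof (intro ballI)
      fix a b assume "a \<in> A" "b \<in> A"
      then have "G b a = cnj (G a b)" "G' b a = cnj (G' a b)"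
        using herm_onD[OF psd_on_herm[OF that(1)], of a b] herm_onD[OF psd_on_herm[OF that(2)], of a b]
        by blast+
      then show "G b a + of_real t * G' b a = cnj (G a b + of_real t * G' a b)" by simp
    qed
    ultimately show ?thesis using that by (auto simp: psd_on_def)
  qed
  have psd_scale: "psd_on A (\<lambda>a b. G a b + of_real (- t) * G a b)"
    if "psd_on A G" "t \<le> 1" for G t
  proof -
    have z: "psd_on A (\<lambda>a b. 0)" by (simp add: psd_on_def herm_on_def qform_def)
    have "(\<lambda>a b. G a b + of_real (- t) * G a b) = (\<lambda>a b. 0 + of_real (1 - t) * G a b)"
      by (simp add: algebra_simps)
    then show ?thesis using psd_add[OF z that(1), of "1 - t"] that(2) by (simp only:)
  qed
  \<comment> \<open>Rank one kernels serve as test directions: a function of the class, paired with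
    the class sums of such a kernel, yields its quadratic form at \<open>v\<close>.\<close>
  have psd_rank_one: "psd_on A (\<lambda>a b. cnj (v a) * v b)" for v
  proof -
    have "qform A (\<lambda>a b. cnj (v a) * v b) u = cnj (\<Sum>b\<in>A. v b * u b) * (\<Sum>b\<in>A. v b * u b)" for u
      unfolding qform_def cnj_sum sum_product
      by (intro sum.cong refl) (simp add: algebra_simps)
    then have "qform A (\<lambda>a b. cnj (v a) * v b) u = of_real ((cmod (\<Sum>b\<in>A. v b * u b))\<^sup>2)" for u
      unfolding complex_norm_square by (simp only: mult.commute)
    then have "0 \<le> Re (qform A (\<lambda>a b. cnj (v a) * v b) u)" for u by simp
    moreover have "herm_on A (\<lambda>a b. cnj (v a) * v b)" by (simp add: herm_on_def)
    ultimately show ?thesis by (simp add: psd_on_def)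
  qed

  \<comment> \<open>If \<open>f G\<close> is at most the value of \<open>f\<close> at the zero
    kernel, every class sum is within the root of that value from its target. This bounds the
    diagonal entries by \<open>R\<close>, hence all entries.\<close>
  define R where "R = sqrt (f (\<lambda>a b. 0)) + (\<Sum>c\<in>C. cmod (q c))"
  have f0: "0 \<le> f G" for G unfolding f_def by (intro sum_nonneg) auto
  have bound: "cmod (G a b) \<le> R"
    if G: "psd_on A G" and le: "f G \<le> f (\<lambda>a b. 0)" and ab: "a \<in> A" "b \<in> A" for G a b
  proof -
    have d: "Re (G a a) \<le> R" if a: "a \<in> A" for a
    proof -
      have "(cmod (F G (cls a a) - q (cls a a)))\<^sup>2 \<le> f G"
        unfolding f_def using finC diag_C[OF a] by (intro member_le_sum) auto
      then have "cmod (G a a - q (cls a a)) \<le> sqrt (f (\<lambda>a b. 0))"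
        unfolding F_diag[OF a] using le by (intro real_le_rsqrt) linarith
      moreover have "cmod (q (cls a a)) \<le> (\<Sum>c\<in>C. cmod (q c))"
        using finC diag_C[OF a] by (intro member_le_sum) auto
      moreover have "cmod (G a a) \<le> cmod (G a a - q (cls a a)) + cmod (q (cls a a))"
        using norm_triangle_ineq[of "G a a - q (cls a a)" "q (cls a a)"] by simp
      ultimately show ?thesis unfolding R_def using complex_Re_le_cmod[of "G a a"] by linarith
    qed
    show ?thesis
      using psd_on_entry_bound[OF fin G ab] d[OF ab(1)] d[OF ab(2)] by simp
  qed
  have R0: "0 \<le> R" unfolding R_def using f0 by (intro add_nonneg_nonneg sum_nonneg) auto

  \<comment> \<open>Compactness of \<open>K\<close> is Tychonoff for functions on all pairs of the
    type; a competitor is therefore cut off to 0 outside \<open>A\<close>, which changes neither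
    positivity nor class sums.\<close>
  have "\<exists>g. psd_on A g \<and> (\<forall>G. psd_on A G \<longrightarrow> f g \<le> f G)"
  proof -
    define P where "P = {g :: 'a \<times> 'a \<Rightarrow> complex. psd_on A (curry g)}"
    define K where "K = ((\<Pi>\<^sub>E x\<in>UNIV. cball 0 R) :: ('a \<times> 'a \<Rightarrow> complex) set)"
    have coord: "continuous_on UNIV (\<lambda>g :: 'a \<times> 'a \<Rightarrow> complex. g x)" for x by simp
    have "compactin (product_topology (\<lambda>_. euclidean) UNIV) K"
      unfolding K_def by (subst compactin_PiE) auto
    then have "compact K" by (simp add: euclidean_product_topology)
    moreover have "closed P"
    proof -
      have "P = (\<Inter>a\<in>A. \<Inter>b\<in>A. {g. g (b, a) = cnj (g (a, b))}) \<inter>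
          (\<Inter>v. {g. 0 \<le> Re (\<Sum>a\<in>A. \<Sum>b\<in>A. cnj (v a) * g (a, b) * v b)})"
        unfolding P_def psd_on_def herm_on_def qform_def curry_def by blast
      moreover have "closed {g :: 'a \<times> 'a \<Rightarrow> complex. g (b, a) = cnj (g (a, b))}" for a b
        by (intro closed_Collect_eq continuous_intros coord)
      moreover have "closed {g :: 'a \<times> 'a \<Rightarrow> complex.
          0 \<le> Re (\<Sum>a\<in>A. \<Sum>b\<in>A. cnj (v a) * g (a, b) * v b)}" for v
        by (intro closed_Collect_le continuous_intros coord)
      ultimately show ?thesis by (auto intro!: closed_Int closed_INT)
    qed
    ultimately have comp: "compact (K \<inter> P)" by (rule compact_Int_closed)
    have z: "(\<lambda>x. 0) \<in> K \<inter> P"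
      using R0 by (auto simp: K_def P_def psd_on_def herm_on_def qform_def curry_def)
    have cont: "continuous_on (K \<inter> P) (\<lambda>g. f (curry g))"
      unfolding f_def F_def curry_def case_prod_unfold
      by (intro continuous_intros continuous_on_subset[OF coord]) auto
    obtain g where g: "g \<in> K \<inter> P" "\<And>h. h \<in> K \<inter> P \<Longrightarrow> f (curry g) \<le> f (curry h)"
      using continuous_attains_inf[OF comp _ cont] z by blast
    have "f (curry g) \<le> f G" if G: "psd_on A G" for G
    proof (cases "f G \<le> f (\<lambda>a b. 0)")
      case True
      define h where "h = (\<lambda>(a, b). if a \<in> A \<and> b \<in> A then G a b else 0)"
      have h: "curry h a b = G a b" if "a \<in> A" "b \<in> A" for a b using that by (simp add: h_def)
      have "psd_on A (curry h)" using psd_on_cong[of A "curry h" G] h G by blast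
      moreover have "h \<in> K" using bound[OF G True] R0 by (auto simp: K_def h_def)
      moreover have "F (curry h) c = F G c" for c
        unfolding F_def using h by (intro sum.cong) (auto simp: cell_def)
      ultimately show ?thesis using g(2)[of h] by (simp add: P_def f_def)
    next
      case False
      have "f (curry g) \<le> f (curry (\<lambda>x. 0))" by (rule g(2)[OF z])
      then show ?thesis using False by (simp add: curry_def)
    qed
    then show ?thesis using g(1) by (auto simp: P_def)
  qed
  then obtain g where g: "psd_on A g" and g_min: "\<And>G. psd_on A G \<Longrightarrow> f g \<le> f G" by blast

  define r where "r c = F g c - q c" for c
  \<comment> \<open>Minimality of \<open>g\<close> in the direction \<open>s * G'\<close>. With
    \<open>s = 1\<close> every positive semidefinite \<open>G'\<close> is admissible, so the
    residual is nonnegative on the cone; with \<open>s = -1\<close> and \<open>G' = g\<close> one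
    moves towards the origin and gets the reverse inequality at \<open>g\<close>.\<close>
  have variation: "0 \<le> s * (\<Sum>c\<in>C. Re (cnj (r c) * F G' c))"
    if ps: "\<And>t. 0 < t \<Longrightarrow> t \<le> 1 \<Longrightarrow> psd_on A (\<lambda>a b. g a b + of_real (s * t) * G' a b)" for s G'
  proof -
    have "0 \<le> 2 * (s * (\<Sum>c\<in>C. Re (cnj (r c) * F G' c)))"
    proof (rule linear_quadratic_nonneg)
      fix t :: real assume t: "0 < t" "t \<le> 1"
      have "f (\<lambda>a b. g a b + of_real (s * t) * G' a b) =
          (\<Sum>c\<in>C. (cmod (r c + of_real (s * t) * F G' c))\<^sup>2)"
        unfolding f_def F_add r_def by (simp add: algebra_simps)
      also have "\<dots> = (\<Sum>c\<in>C. (cmod (r c))\<^sup>2 + t * (2 * (s * Re (cnj (r c) * F G' c))) +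
          t\<^sup>2 * (s\<^sup>2 * (cmod (F G' c))\<^sup>2))"
        by (intro sum.cong refl) (simp only: cmod_power2, simp add: power2_eq_square algebra_simps)
      also have "\<dots> = f g + t * (2 * (s * (\<Sum>c\<in>C. Re (cnj (r c) * F G' c)))) +
          t\<^sup>2 * (s\<^sup>2 * (\<Sum>c\<in>C. (cmod (F G' c))\<^sup>2))"
        unfolding sum.distrib sum_distrib_left f_def r_def ..
      finally show "0 \<le> t * (2 * (s * (\<Sum>c\<in>C. Re (cnj (r c) * F G' c)))) +
          t\<^sup>2 * (s\<^sup>2 * (\<Sum>c\<in>C. (cmod (F G' c))\<^sup>2))"
        using g_min[OF ps[OF t]] by linarith
    qed
    then show ?thesis by simp
  qed
  have r_pos: "0 \<le> (\<Sum>c\<in>C. Re (cnj (r c) * F G' c))" if "psd_on A G'" for G'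
    using variation[of 1 G'] psd_add[OF g that] by simp
  have r_g: "(\<Sum>c\<in>C. Re (cnj (r c) * F g c)) \<le> 0"
  proof -
    have "psd_on A (\<lambda>a b. g a b + of_real (-1 * t) * g a b)" if "t \<le> 1" for t
      using psd_scale[OF g that] by simp
    then show ?thesis using variation[of "-1" g] by simp
  qed
  have r_st: "r (st c) = cnj (r c)" for c unfolding r_def using F_st[OF g] q_st by simp

  \<comment> \<open>Summing the class sums over these classes gives the trace.\<close>
  define D where "D = (\<lambda>a. cls a a) ` A"
  have D_st: "st c \<in> D" if "c \<in> D" for c
    using that by (auto simp: D_def cls_st[symmetric])
  \<comment> \<open>\<open>pairing\<close> asks for strict positivity. Adding \<open>e\<close> on
    the diagonal classes adds \<open>e\<close> times the squared norm of \<open>v\<close> on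
    \<open>A\<close> to the form.\<close>
  have perturbed: "0 \<le> (\<Sum>c\<in>C. Re (cnj (r c) * q c)) + e * (\<Sum>c\<in>C \<inter> D. Re (q c))" if e: "0 < e" for e
  proof -
    define m where "m c = (if c \<in> C then cnj (r c) + (if c \<in> D then of_real e else 0) else 0)" for c
    have m0: "c \<notin> C \<Longrightarrow> m c = 0" for c by (simp add: m_def)
    have m_st: "m (st c) = cnj (m c)" for c
    proof -
      have "st c \<in> C \<longleftrightarrow> c \<in> C" "st c \<in> D \<longleftrightarrow> c \<in> D"
        using C_st[of c] C_st[of "st c"] D_st[of c] D_st[of "st c"] st_st[of c] by auto
      then show ?thesis by (simp add: m_def r_st)
    qed
    have split: "(\<Sum>c\<in>C. m c * h c) = (\<Sum>c\<in>C. cnj (r c) * h c) + of_real e * (\<Sum>c\<in>C \<inter> D. h c)" for h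
    proof -
      have "(\<Sum>c\<in>C. m c * h c) = (\<Sum>c\<in>C. cnj (r c) * h c + of_real e * (if c \<in> D then h c else 0))"
        by (intro sum.cong refl) (simp add: m_def algebra_simps)
      then show ?thesis using finC by (simp add: sum.distrib sum.inter_restrict flip: sum_distrib_left)
    qed
    have form: "Re (qform A (\<lambda>a b. m (cls a b)) v) =
        (\<Sum>c\<in>C. Re (cnj (r c) * F (\<lambda>a b. cnj (v a) * v b) c)) + e * (\<Sum>a\<in>A. (cmod (v a))\<^sup>2)" for v
    proof -
      have "qform A (\<lambda>a b. m (cls a b)) v = (\<Sum>a\<in>A. \<Sum>b\<in>A. m (cls a b) * (cnj (v a) * v b))"
        unfolding qform_def by (intro sum.cong refl) (simp add: algebra_simps)
      also have "\<dots> = (\<Sum>c\<in>C. m c * F (\<lambda>a b. cnj (v a) * v b) c)" by (rule cells[OF m0])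
      also have "\<dots> = (\<Sum>c\<in>C. cnj (r c) * F (\<lambda>a b. cnj (v a) * v b) c) +
          of_real e * (\<Sum>c\<in>C \<inter> D. F (\<lambda>a b. cnj (v a) * v b) c)" by (rule split)
      also have "C \<inter> D = D" using diag_C by (auto simp: D_def)
      also have "(\<Sum>c\<in>D. F (\<lambda>a b. cnj (v a) * v b) c) = (\<Sum>a\<in>A. F (\<lambda>a b. cnj (v a) * v b) (cls a a))"
        unfolding D_def using diag by (subst sum.reindex) (auto simp: inj_on_def)
      also have "\<dots> = (\<Sum>a\<in>A. of_real ((cmod (v a))\<^sup>2))"
        by (intro sum.cong refl) (simp only: F_diag complex_norm_square mult.commute)
      finally show ?thesis by simp
    qed
    have pos: "0 < Re (qform A (\<lambda>a b. m (cls a b)) v)" if "\<exists>a\<in>A. v a \<noteq> 0" for v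
    proof -
      have "0 < (\<Sum>a\<in>A. (cmod (v a))\<^sup>2)"
        using that fin by (auto intro: sum_pos2)
      then show ?thesis unfolding form using r_pos[OF psd_rank_one[of v]] e
        by (simp add: add_nonneg_pos)
    qed
    have "psd_on A (\<lambda>a b. m (cls a b))"
      unfolding psd_on_def
    proof (intro conjI allI)
      show "herm_on A (\<lambda>a b. m (cls a b))"
        unfolding herm_on_def
      proof (intro ballI)
        fix a b assume "a \<in> A" "b \<in> A"
        then show "m (cls b a) = cnj (m (cls a b))" by (simp only: cls_st[of a b] m_st)
      qed
      show "0 \<le> Re (qform A (\<lambda>a b. m (cls a b)) v)" for v
        unfolding form using r_pos[OF psd_rank_one[of v]] e
        by (simp add: sum_nonneg)
    qed
    then have "0 \<le> Re (\<Sum>c\<in>C. m c * q c)"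
      by (intro pairing m_st pos) (auto simp: m_def C_def)
    then show ?thesis unfolding split by simp
  qed
  \<comment> \<open>The limit of \<open>perturbed\<close> for \<open>e\<close> tending to 0, carried
    out with a single \<open>e\<close> for which the perturbation costs at most half of the supposed
    defect \<open>x\<close>.\<close>
  have "0 \<le> (\<Sum>c\<in>C. Re (cnj (r c) * q c))"
  proof (rule ccontr)
    assume neg: "\<not> ?thesis"
    define x where "x = - (\<Sum>c\<in>C. Re (cnj (r c) * q c))"
    define y where "y = \<bar>\<Sum>c\<in>C \<inter> D. Re (q c)\<bar>"
    have x: "x > 0" using neg by (simp add: x_def)
    have "x / (2 * (y + 1)) * (\<Sum>c\<in>C \<inter> D. Re (q c)) \<le> x / (2 * (y + 1)) * (y + 1)"
      using x by (intro mult_left_mono) (auto simp: y_def)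
    also have "\<dots> = x / 2"
    proof -
      have "y + 1 \<noteq> 0" by (simp add: y_def)
      then show ?thesis by (simp add: field_simps)
    qed
    finally have "x / (2 * (y + 1)) * (\<Sum>c\<in>C \<inter> D. Re (q c)) \<le> x / 2" .
    moreover have "0 < x / (2 * (y + 1))" using x by (simp add: y_def)
    then have "0 \<le> (\<Sum>c\<in>C. Re (cnj (r c) * q c)) + x / (2 * (y + 1)) * (\<Sum>c\<in>C \<inter> D. Re (q c))"
      by (rule perturbed)
    moreover have "(\<Sum>c\<in>C. Re (cnj (r c) * q c)) = - x" unfolding x_def by (rule minus_minus[symmetric])
    ultimately show False using x by linarith
  qed
  \<comment> \<open>As \<open>q = F g - r\<close>, the residual pairs with \<open>q\<close> to a
    nonpositive number minus its own squared norm; the previous inequality forces it to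
    vanish.\<close>
  moreover have "(\<Sum>c\<in>C. Re (cnj (r c) * q c)) =
      (\<Sum>c\<in>C. Re (cnj (r c) * F g c)) - (\<Sum>c\<in>C. (cmod (r c))\<^sup>2)"
  proof -
    have "Re (cnj (r c) * q c) = Re (cnj (r c) * F g c) - (cmod (r c))\<^sup>2" for c
      unfolding r_def by (simp only: cmod_power2, simp add: power2_eq_square algebra_simps)
    then show ?thesis by (simp add: sum_subtractf)
  qed
  ultimately have "(\<Sum>c\<in>C. (cmod (r c))\<^sup>2) \<le> 0" using r_g by linarith
  then have "(\<Sum>c\<in>C. (cmod (r c))\<^sup>2) = 0"
    using sum_nonneg[of C "\<lambda>c. (cmod (r c))\<^sup>2"] by simp
  then have "r c = 0" if "c \<in> C" for c
    using that finC by (simp add: sum_nonneg_eq_0_iff)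
  then show thesis using that[OF g] by (simp add: r_def F_def cell_def)
qed

subsection \<open>Words as sums over paths\<close>

text \<open>The entry \<open>(a, b)\<close> of the product of the matrices \<open>f l\<close> along
  the word, expanded into walks from \<open>a\<close> to \<open>b\<close>. The vertex set is a
  parameter because compression to a coordinate subspace keeps the weights and shrinks
  \<open>I\<close> to \<open>J\<close>.\<close>

fun path_sum :: "'i set \<Rightarrow> (letter \<Rightarrow> 'i \<Rightarrow> 'i \<Rightarrow> complex) \<Rightarrow> letter list \<Rightarrow> 'i \<Rightarrow> 'i \<Rightarrow> complex" where
  "path_sum I f [] a b = (if a = b then 1 else 0)"
| "path_sum I f (l # w) a b = (\<Sum>c\<in>I. f l a c * path_sum I f w c b)"

lemma path_sum_append:
  assumes "finite I" "a \<in> I"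
  shows "path_sum I f (u @ v) a b = (\<Sum>c\<in>I. path_sum I f u a c * path_sum I f v c b)"
  using assms(2)
proof (induction u arbitrary: a)
  case Nil
  have "(\<Sum>c\<in>I. path_sum I f [] a c * path_sum I f v c b) = (\<Sum>c\<in>I. if a = c then path_sum I f v a b else 0)"
    by (intro sum.cong) auto
  then show ?case using assms(1) Nil by simp
next
  case (Cons l u)
  have "path_sum I f ((l # u) @ v) a b =
      (\<Sum>c\<in>I. \<Sum>e\<in>I. f l a c * (path_sum I f u c e * path_sum I f v e b))"
    using Cons.IH by (simp add: sum_distrib_left)
  also have "\<dots> = (\<Sum>e\<in>I. path_sum I f (l # u) a e * path_sum I f v e b)"
    by (subst sum.swap) (simp add: sum_distrib_right mult.assoc)
  finally show ?case .
qed

lemma path_sum_single: "finite I \<Longrightarrow> b \<in> I \<Longrightarrow> path_sum I f [l] a b = f l a b"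
  by (simp add: if_distrib cong: if_cong)

lemma path_sum_rev:
  assumes fin: "finite I" and f: "\<And>l a b. l \<in> set w \<Longrightarrow> a \<in> I \<Longrightarrow> b \<in> I \<Longrightarrow> f l b a = cnj (f l a b)"
    and "a \<in> I" "b \<in> I"
  shows "path_sum I f (rev w) b a = cnj (path_sum I f w a b)"
  using f assms(3,4)
proof (induction w arbitrary: a)
  case Nil
  show ?case by simp
next
  case (Cons l w)
  have "path_sum I f (rev (l # w)) b a = (\<Sum>c\<in>I. path_sum I f (rev w) b c * path_sum I f [l] c a)"
    using path_sum_append[OF fin \<open>b \<in> I\<close>] by (simp only: rev.simps)
  also have "\<dots> = (\<Sum>c\<in>I. cnj (path_sum I f w c b) * cnj (f l a c))"
  proof (intro sum.cong refl)
    fix c assume c: "c \<in> I"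
    have "path_sum I f [l] c a = cnj (f l a c)"
      unfolding path_sum_single[OF fin \<open>a \<in> I\<close>] using Cons.prems(1)[OF _ \<open>a \<in> I\<close> c] by simp
    moreover have "path_sum I f (rev w) b c = cnj (path_sum I f w c b)"
      by (rule Cons.IH[OF Cons.prems(1) c \<open>b \<in> I\<close>]) simp_all
    ultimately show "path_sum I f (rev w) b c * path_sum I f [l] c a =
        cnj (path_sum I f w c b) * cnj (f l a c)" by simp
  qed
  finally show ?case by (simp add: mult.commute)
qed

lemma path_sum_eq_zero_letter:
  assumes "l \<in> set w" "\<And>a b. f l a b = 0"
  shows "path_sum I f w a b = 0"
  using assms(1)
proof (induction w arbitrary: a)
  case (Cons k w)
  show ?case
  proof (cases "l = k")
    case True
    then show ?thesis using assms(2) by simp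
  next
    case False
    then have "path_sum I f w c b = 0" for c using Cons by simp
    then show ?thesis by simp
  qed
qed simp

subsection \<open>Evaluation in coordinates\<close>

lemma mat_adjoint_dim [simp]: "dim_row (mat_adjoint A) = dim_col A" "dim_col (mat_adjoint A) = dim_row A"
  by (auto simp: mat_adjoint_def)

lemma mat_adjoint_index [simp]:
  "i < dim_col A \<Longrightarrow> j < dim_row A \<Longrightarrow> mat_adjoint A $$ (i, j) = conjugate (A $$ (j, i))"
  unfolding mat_adjoint_def by (simp add: mat_of_rows_index)

lemma mat_adjoint_carrier [simp]: "A \<in> carrier_mat m n \<Longrightarrow> mat_adjoint A \<in> carrier_mat n m"
  by auto

lemma hermitian_mats_iff:
  "A \<in> hermitian_mats n \<longleftrightarrow>
    A \<in> carrier_mat n n \<and> (\<forall>i<n. \<forall>j<n. A $$ (j, i) = cnj (A $$ (i, j)))"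
proof -
  have "mat_adjoint A = A \<longleftrightarrow> (\<forall>i<n. \<forall>j<n. A $$ (j, i) = cnj (A $$ (i, j)))"
    if A: "A \<in> carrier_mat n n"
  proof
    assume eq: "mat_adjoint A = A"
    show "\<forall>i<n. \<forall>j<n. A $$ (j, i) = cnj (A $$ (i, j))"
    proof (intro allI impI)
      fix i j assume "i < n" "j < n"
      then have "mat_adjoint A $$ (j, i) = cnj (A $$ (i, j))" using A by simp
      then show "A $$ (j, i) = cnj (A $$ (i, j))" unfolding eq .
    qed
  next
    assume eq: "\<forall>i<n. \<forall>j<n. A $$ (j, i) = cnj (A $$ (i, j))"
    show "mat_adjoint A = A"
    proof (rule eq_matI)
      fix i j assume "i < dim_row A" "j < dim_col A"
      then show "mat_adjoint A $$ (i, j) = A $$ (i, j)"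
        using A eq[rule_format, of j i] by simp
    qed (use A in auto)
  qed
  then show ?thesis unfolding hermitian_mats_def by blast
qed

lemma compress_carrier [simp]:
  "V \<in> carrier_mat n m \<Longrightarrow> compress V T \<in> carrier_mat m m"
  by (auto simp: compress_def)

lemma compress_index:
  assumes V: "V \<in> carrier_mat n m" and T: "T \<in> carrier_mat n n" and s: "s < m" "s' < m"
  shows "compress V T $$ (s, s') = (\<Sum>r<n. \<Sum>r'<n. cnj (V $$ (r, s)) * T $$ (r, r') * V $$ (r', s'))"
proof -
  have "compress V T $$ (s, s') =
      (\<Sum>r'<n. (\<Sum>r<n. cnj (V $$ (r, s)) * T $$ (r, r')) * V $$ (r', s'))"
    unfolding compress_def using assms
    by (auto simp: scalar_prod_def lessThan_atLeast0 intro!: sum.cong)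
  also have "\<dots> = (\<Sum>r<n. \<Sum>r'<n. cnj (V $$ (r, s)) * T $$ (r, r') * V $$ (r', s'))"
    by (subst sum.swap) (simp add: sum_distrib_right)
  finally show ?thesis .
qed

text \<open>\<open>E\<close> and \<open>e\<close> enumerate the large and the small index set, and
  \<open>V\<close> includes the latter in the former. Stated for general index sets, as it is
  applied both to \<open>V\<close> and to its ampliation, whose indices are pairs.\<close>

lemma compress_inclusion_index:
  assumes E: "bij_betw E {..<n} I" and e: "e ` {..<m} \<subseteq> I"
    and V: "V = mat n m (\<lambda>(r, s). if E r = e s then 1 else 0)"
    and T: "T \<in> carrier_mat n n" "\<And>r r'. r < n \<Longrightarrow> r' < n \<Longrightarrow> T $$ (r, r') = H (E r) (E r')"
    and s: "s < m" "s' < m"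
  shows "compress V T $$ (s, s') = H (e s) (e s')"
proof -
  have fin: "finite I" using E bij_betw_finite by blast
  have es: "e s \<in> I" "e s' \<in> I" using e s by auto
  have "compress V T $$ (s, s') = (\<Sum>r<n. \<Sum>r'<n. cnj (V $$ (r, s)) * T $$ (r, r') * V $$ (r', s'))"
    by (rule compress_index[OF _ T(1) s]) (simp add: V)
  also have "\<dots> = (\<Sum>r<n. \<Sum>r'<n. (if E r = e s then 1 else 0) * H (E r) (E r') * (if E r' = e s' then 1 else 0))"
    using s T(2) by (intro sum.cong) (auto simp: V)
  also have "\<dots> = (\<Sum>r<n. \<Sum>y\<in>I. (if E r = e s then 1 else 0) * H (E r) y * (if y = e s' then 1 else 0))"
    by (intro sum.cong refl) (rule sum.reindex_bij_betw[OF E])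
  also have "\<dots> = (\<Sum>x\<in>I. \<Sum>y\<in>I. (if x = e s then 1 else 0) * H x y * (if y = e s' then 1 else 0))"
    by (rule sum.reindex_bij_betw[OF E])
  also have "\<dots> = (\<Sum>x\<in>I. if x = e s then H x (e s') else 0)"
    using fin es by (intro sum.cong) (auto simp: if_distrib cong: if_cong)
  finally show ?thesis using fin es by simp
qed

lemma cscalar_form:
  assumes "T \<in> carrier_mat n n" "v \<in> carrier_vec n"
  shows "(T *\<^sub>v v) \<bullet>c v = (\<Sum>r<n. \<Sum>s<n. cnj (v $ r) * T $$ (r, s) * v $ s)"
proof -
  have "(T *\<^sub>v v) \<bullet>c v = (\<Sum>r<n. (\<Sum>s<n. T $$ (r, s) * v $ s) * cnj (v $ r))"
    using assms by (auto simp: scalar_prod_def lessThan_atLeast0 intro!: sum.cong)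
  then show ?thesis by (simp add: sum_distrib_left mult_ac)
qed

lemma cscalar_form_eq_qform:
  assumes e: "bij_betw e {..<n} A" and T: "T \<in> carrier_mat n n"
    "\<And>r s. r < n \<Longrightarrow> s < n \<Longrightarrow> T $$ (r, s) = H (e r) (e s)"
  shows "(T *\<^sub>v vec n (\<lambda>r. v (e r))) \<bullet>c vec n (\<lambda>r. v (e r)) = qform A H v"
proof -
  have "(T *\<^sub>v vec n (\<lambda>r. v (e r))) \<bullet>c vec n (\<lambda>r. v (e r)) =
      (\<Sum>r<n. \<Sum>s<n. cnj (v (e r)) * H (e r) (e s) * v (e s))"
    using T by (subst cscalar_form) auto
  also have "\<dots> = (\<Sum>r<n. \<Sum>y\<in>A. cnj (v (e r)) * H (e r) y * v y)"
    by (intro sum.cong refl) (rule sum.reindex_bij_betw[OF e])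
  also have "\<dots> = (\<Sum>x\<in>A. \<Sum>y\<in>A. cnj (v x) * H x y * v y)"
    by (rule sum.reindex_bij_betw[OF e])
  finally show ?thesis by (simp add: qform_def)
qed

text \<open>The index convention of \<open>kron\<close>: the quotient is the index in the left
  factor, the remainder the one in the right factor.\<close>

lemma bij_betw_div_mod:
  fixes d m :: nat
  assumes "bij_betw g {..<m} J"
  shows "bij_betw (\<lambda>r. (r div m, g (r mod m))) {..<d * m} ({..<d} \<times> J)"
proof -
  have "bij_betw (\<lambda>r. (r div m, r mod m)) {..<d * m} ({..<d} \<times> {..<m})"
  proof (rule bij_betw_byWitness[where f' = "\<lambda>(i, b). i * m + b"])
    show "(\<lambda>(i, b). i * m + b) ` ({..<d} \<times> {..<m}) \<subseteq> {..<d * m}"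
    proof safe
      fix i b assume ib: "i < d" "b < m"
      have "i * m + b < Suc i * m" using ib by simp
      also have "\<dots> \<le> d * m" using ib by (intro mult_right_mono) auto
      finally show "i * m + b < d * m" .
    qed
    show "(\<lambda>r. (r div m, r mod m)) ` {..<d * m} \<subseteq> {..<d} \<times> {..<m}"
    proof safe
      fix r assume r: "r < d * m"
      then show "r div m < d" by (simp add: less_mult_imp_div_less)
      show "r mod m < m" using r by (cases m) auto
    qed
  qed auto
  moreover have "bij_betw (map_prod id g) ({..<d} \<times> {..<m}) ({..<d} \<times> J)"
    by (rule bij_betw_map_prod[OF bij_betw_id assms])
  ultimately have "bij_betw (map_prod id g \<circ> (\<lambda>r. (r div m, r mod m))) {..<d * m} ({..<d} \<times> J)"
    by (rule bij_betw_trans)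
  then show ?thesis by (simp add: comp_def)
qed

lemma mult_index_sum:
  assumes "A \<in> carrier_mat n k" "B \<in> carrier_mat k m" "i < n" "j < m"
  shows "(A * B) $$ (i, j) = (\<Sum>c<k. A $$ (i, c) * B $$ (c, j))"
  using assms by (auto simp: scalar_prod_def lessThan_atLeast0 intro!: sum.cong)

lemma word_eval_carrier:
  assumes "\<And>l. l \<in> set w \<Longrightarrow> letter_eval X Y l \<in> carrier_mat n n"
  shows "word_eval n X Y w \<in> carrier_mat n n"
  using assms
proof (induction w)
  case (Cons l w)
  have "letter_eval X Y l \<in> carrier_mat n n" "word_eval n X Y w \<in> carrier_mat n n"
    using Cons by auto
  then show ?case by (simp add: word_eval_def)
qed (simp add: word_eval_def)

lemma word_eval_index:
  assumes g: "bij_betw g {..<n} I"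
    and f: "\<And>l. l \<in> set w \<Longrightarrow> letter_eval X Y l \<in> carrier_mat n n"
      "\<And>l a b. l \<in> set w \<Longrightarrow> a < n \<Longrightarrow> b < n \<Longrightarrow> letter_eval X Y l $$ (a, b) = f l (g a) (g b)"
    and ab: "a < n" "b < n"
  shows "word_eval n X Y w $$ (a, b) = path_sum I f w (g a) (g b)"
  using f ab
proof (induction w arbitrary: a)
  case Nil
  have "g a = g b \<longleftrightarrow> a = b" using g Nil.prems by (auto simp: bij_betw_def inj_on_def)
  then show ?case using Nil.prems by (simp add: word_eval_def)
next
  case (Cons l w)
  have W: "word_eval n X Y w \<in> carrier_mat n n" using Cons.prems by (intro word_eval_carrier) auto
  have L: "letter_eval X Y l \<in> carrier_mat n n" using Cons.prems by auto
  have "word_eval n X Y (l # w) $$ (a, b) = (letter_eval X Y l * word_eval n X Y w) $$ (a, b)"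
    by (simp add: word_eval_def)
  also have "\<dots> = (\<Sum>c<n. letter_eval X Y l $$ (a, c) * word_eval n X Y w $$ (c, b))"
    by (rule mult_index_sum[OF L W Cons.prems(3,4)])
  also have "\<dots> = (\<Sum>c<n. f l (g a) (g c) * path_sum I f w (g c) (g b))"
    using Cons by (intro sum.cong) auto
  also have "\<dots> = (\<Sum>c\<in>I. f l (g a) c * path_sum I f w c (g b))"
    by (rule sum.reindex_bij_betw[OF g])
  finally show ?case by simp
qed

lemma fpolys_carrier: "p \<in> fpolys \<mu> r c \<Longrightarrow> p w \<in> carrier_mat r c"
  by (auto simp: fpolys_def)

lemma fpolys_dim [simp]:
  assumes "p \<in> fpolys \<mu> r c"
  shows "dim_row (p w) = r" "dim_col (p w) = c"
  using fpolys_carrier[OF assms, of w] by auto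

lemma fpolys_finite: "p \<in> fpolys \<mu> r c \<Longrightarrow> finite {w. p w \<noteq> 0\<^sub>m r c}"
  and fpolys_words: "p \<in> fpolys \<mu> r c \<Longrightarrow> p w \<noteq> 0\<^sub>m r c \<Longrightarrow> w \<in> words \<mu>"
  by (auto simp: fpolys_def)

lemma fp_eval_carrier: "p \<in> fpolys \<mu> r c \<Longrightarrow> fp_eval n p X Y \<in> carrier_mat (r * n) (c * n)"
  by (simp add: fp_eval_def)

lemma letter_eval_hermitian:
  assumes "X \<in> hermitian_tuples \<mu> n" "Y \<in> hermitian_tuples \<mu> n" "w \<in> words \<mu>" "l \<in> set w"
  shows "letter_eval X Y l \<in> hermitian_mats n"
  using assms by (cases l) (auto simp: hermitian_tuples_def words_def)

lemma hermitian_mats_carrier: "A \<in> hermitian_mats n \<Longrightarrow> A \<in> carrier_mat n n"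
  by (simp add: hermitian_mats_def)

text \<open>Any finite superset \<open>W\<close> of the support will do, so that several polynomials
  can be evaluated over a common set of words.\<close>

lemma fp_eval_index:
  assumes p: "p \<in> fpolys \<mu> r c" and X: "X \<in> hermitian_tuples \<mu> n" and Y: "Y \<in> hermitian_tuples \<mu> n"
    and W: "finite W" "{w. p w \<noteq> 0\<^sub>m r c} \<subseteq> W" and st: "s < r * n" "t < c * n"
  shows "fp_eval n p X Y $$ (s, t) =
    (\<Sum>w\<in>W. p w $$ (s div n, t div n) * word_eval n X Y w $$ (s mod n, t mod n))"
proof -
  have n: "0 < n" using st by (cases n) auto
  have div: "s div n < r" "t div n < c" using st by (auto simp: less_mult_imp_div_less)
  have "fp_eval n p X Y $$ (s, t) = (\<Sum>w\<in>{w. p w \<noteq> 0\<^sub>m r c}. kron (p w) (word_eval n X Y w) $$ (s, t))"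
    using st p by (simp add: fp_eval_def)
  also have "\<dots> = (\<Sum>w\<in>{w. p w \<noteq> 0\<^sub>m r c}. p w $$ (s div n, t div n) * word_eval n X Y w $$ (s mod n, t mod n))"
  proof (intro sum.cong refl)
    fix w assume "w \<in> {w. p w \<noteq> 0\<^sub>m r c}"
    then have "word_eval n X Y w \<in> carrier_mat n n"
      using fpolys_words[OF p] letter_eval_hermitian[OF X Y] hermitian_mats_carrier
      by (intro word_eval_carrier) blast
    then show "kron (p w) (word_eval n X Y w) $$ (s, t) =
        p w $$ (s div n, t div n) * word_eval n X Y w $$ (s mod n, t mod n)"
      using st p by (simp add: kron_def)
  qed
  also have "\<dots> = (\<Sum>w\<in>W. p w $$ (s div n, t div n) * word_eval n X Y w $$ (s mod n, t mod n))"
    using W div by (intro sum.mono_neutral_left) auto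
  finally show ?thesis .
qed

subsection \<open>Testing convexity on weighted graphs\<close>

text \<open>The data of an \<open>xy\<close>-pair with \<open>V\<close> the inclusion of a coordinate subspace: hermitian
  matrices are weights on the edges of a graph with vertex set \<open>I\<close>, and compressing to \<open>J\<close>
  removes the walks that leave \<open>J\<close>.\<close>

lemma xy_convex_path_sums:
  fixes f :: "letter \<Rightarrow> 'i \<Rightarrow> 'i \<Rightarrow> complex"
  assumes p: "p \<in> fpolys \<mu> d d" and conv: "xy_convex \<mu> d p"
    and I: "finite I" and J: "J \<subseteq> I"
    and f: "\<And>l a b. a \<in> I \<Longrightarrow> b \<in> I \<Longrightarrow> f l b a = cnj (f l a b)"
    and xy: "\<And>i j a b. i < \<mu> \<Longrightarrow> j < \<mu> \<Longrightarrow> a \<in> J \<Longrightarrow> b \<in> J \<Longrightarrow>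
      (\<Sum>c\<in>I - J. f (VarX i) a c * f (VarY j) c b) = 0"
  shows "0 \<le> Re (qform ({..<d} \<times> J) (\<lambda>(i, a) (j, b). \<Sum>w\<in>{w. p w \<noteq> 0\<^sub>m d d}.
    p w $$ (i, j) * (path_sum I f w a b - path_sum J f w a b)) v)"
\<comment> \<open>An \<open>xy\<close>-pair has \<open>m > 0\<close>, so an empty \<open>J\<close>
  gives no pair; the form is then an empty sum.\<close>
proof (cases "J = {}")
  case True
  then show ?thesis by (simp add: qform_def)
next
  case False
  have finJ: "finite J" using I J finite_subset by blast
  define n m where "n = card I" and "m = card J"
  have nm: "0 < n" "0 < m" using False I J finJ by (auto simp: n_def m_def card_gt_0_iff)
  obtain g where g: "bij_betw g {..<n} I"
    using ex_bij_betw_nat_finite[OF I] by (auto simp: n_def lessThan_atLeast0)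
  obtain h where h: "bij_betw h {..<m} J"
    using ex_bij_betw_nat_finite[OF finJ] by (auto simp: m_def lessThan_atLeast0)
  have gI: "g a \<in> I" if "a < n" for a using bij_betw_apply[OF g] that by simp
  have hJ: "h a \<in> J" "h a \<in> I" if "a < m" for a using bij_betw_apply[OF h] that J by auto
  define L where "L l = mat n n (\<lambda>(a, b). f l (g a) (g b))" for l
  define X Y where "X j = L (VarX j)" and "Y j = L (VarY j)" for j
  define V where "V = mat n m (\<lambda>(a, b). if g a = h b then 1 else 0 :: complex)"
  have L: "L l \<in> carrier_mat n n" for l by (simp add: L_def)
  have Vc: "V \<in> carrier_mat n m" by (simp add: V_def)
  have h_sub: "h ` {..<m} \<subseteq> I" using hJ by auto
  have XY: "letter_eval X Y l = L l" for l by (cases l) (simp_all add: X_def Y_def)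
  have herm: "X \<in> hermitian_tuples \<mu> n" "Y \<in> hermitian_tuples \<mu> n"
  proof -
    have "L l \<in> hermitian_mats n" for l
      unfolding hermitian_mats_iff
    proof (intro conjI allI impI L)
      fix i j assume "i < n" "j < n"
      then show "L l $$ (j, i) = cnj (L l $$ (i, j))"
        using f[OF gI gI, of i j l] by (simp add: L_def)
    qed
    then show "X \<in> hermitian_tuples \<mu> n" "Y \<in> hermitian_tuples \<mu> n"
      by (auto simp: hermitian_tuples_def X_def Y_def)
  qed
  have compress_idx: "compress V T $$ (s, s') = H (h s) (h s')"
    if "T \<in> carrier_mat n n" "\<And>r r'. r < n \<Longrightarrow> r' < n \<Longrightarrow> T $$ (r, r') = H (g r) (g r')"
      "s < m" "s' < m" for T H s s'
    by (rule compress_inclusion_index[OF g h_sub V_def that])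
  have compress_L: "compress V (L l) $$ (s, s') = f l (h s) (h s')" if "s < m" "s' < m" for l s s'
    by (rule compress_idx[OF L _ that]) (simp add: L_def)
  have iso: "mat_adjoint V * V = 1\<^sub>m m"
  proof (rule eq_matI)
    fix s s' assume s: "s < dim_row (1\<^sub>m m)" "s' < dim_col (1\<^sub>m m)"
    have eq: "h s = h s' \<longleftrightarrow> s = s'" using h s by (auto simp: bij_betw_def inj_on_def)
    have "(mat_adjoint V * V) $$ (s, s') = compress V (1\<^sub>m n) $$ (s, s')"
      using Vc by (simp add: compress_def right_mult_one_mat[OF mat_adjoint_carrier])
    also have "\<dots> = (if h s = h s' then 1 else 0)"
    proof (rule compress_idx)
      fix r r' assume r: "r < n" "r' < n"
      then have "g r = g r' \<longleftrightarrow> r = r'" using g by (auto simp: bij_betw_def inj_on_def)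
      then show "1\<^sub>m n $$ (r, r') = (if g r = g r' then 1 else 0)" using r by simp
    qed (use s in auto)
    finally show "(mat_adjoint V * V) $$ (s, s') = 1\<^sub>m m $$ (s, s')" using s eq by simp
  qed (use Vc in auto)
  \<comment> \<open>Walks of length two through \<open>J\<close> make up the product of the
    compressions; those through \<open>I - J\<close> are the error term, and \<open>xy\<close> says
    that it vanishes.\<close>
  have mult: "compress V (X i * Y j) = compress V (X i) * compress V (Y j)" if ij: "i < \<mu>" "j < \<mu>" for i j
  proof (rule eq_matI)
    fix s s' assume "s < dim_row (compress V (X i) * compress V (Y j))"
      "s' < dim_col (compress V (X i) * compress V (Y j))"
    then have s: "s < m" "s' < m" using Vc by (auto simp: compress_def)
    have "compress V (X i * Y j) $$ (s, s') =
        (\<Sum>c\<in>I. f (VarX i) (h s) c * f (VarY j) c (h s'))"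
    proof (rule compress_idx)
      show "X i * Y j \<in> carrier_mat n n" unfolding X_def Y_def by (rule mult_carrier_mat[OF L L])
      fix r r' assume r: "r < n" "r' < n"
      have "(X i * Y j) $$ (r, r') = (\<Sum>c<n. f (VarX i) (g r) (g c) * f (VarY j) (g c) (g r'))"
        unfolding X_def Y_def mult_index_sum[OF L L r]
        using r by (intro sum.cong) (auto simp: L_def)
      also have "\<dots> = (\<Sum>c\<in>I. f (VarX i) (g r) c * f (VarY j) c (g r'))"
        by (rule sum.reindex_bij_betw[OF g])
      finally show "(X i * Y j) $$ (r, r') = (\<Sum>c\<in>I. f (VarX i) (g r) c * f (VarY j) c (g r'))" .
    qed (use s in auto)
    also have "\<dots> = (\<Sum>c\<in>J. f (VarX i) (h s) c * f (VarY j) c (h s'))"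
      using xy[OF ij hJ(1)[OF s(1)] hJ(1)[OF s(2)]] by (subst sum.subset_diff[OF J I]) simp
    also have "\<dots> = (\<Sum>c<m. f (VarX i) (h s) (h c) * f (VarY j) (h c) (h s'))"
      by (rule sum.reindex_bij_betw[OF h, symmetric])
    also have "\<dots> = (\<Sum>c<m. compress V (X i) $$ (s, c) * compress V (Y j) $$ (c, s'))"
      unfolding X_def Y_def using s by (intro sum.cong refl) (simp add: compress_L)
    also have "\<dots> = (compress V (X i) * compress V (Y j)) $$ (s, s')"
      by (rule mult_index_sum[OF compress_carrier[OF Vc] compress_carrier[OF Vc] s, symmetric])
    finally show "compress V (X i * Y j) $$ (s, s') = (compress V (X i) * compress V (Y j)) $$ (s, s')" .
  qed (use Vc in \<open>auto simp: compress_def\<close>)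
  define X' Y' where "X' j = compress V (X j)" and "Y' j = compress V (Y j)" for j
  have XY': "letter_eval X' Y' l = compress V (L l)" for l
    by (cases l) (simp_all add: X'_def Y'_def X_def Y_def)
  have herm': "X' \<in> hermitian_tuples \<mu> m" "Y' \<in> hermitian_tuples \<mu> m"
  proof -
    have "compress V (L l) \<in> hermitian_mats m" for l
      unfolding hermitian_mats_iff
    proof (intro conjI allI impI compress_carrier[OF Vc])
      fix i j assume "i < m" "j < m"
      then show "compress V (L l) $$ (j, i) = cnj (compress V (L l) $$ (i, j))"
        using f[OF hJ(2) hJ(2), of i j l] by (simp add: compress_L)
    qed
    then show "X' \<in> hermitian_tuples \<mu> m" "Y' \<in> hermitian_tuples \<mu> m"
      by (auto simp: hermitian_tuples_def X_def Y_def X'_def Y'_def)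
  qed
  have pair: "xy_pair \<mu> n m X Y V" unfolding xy_pair_def using nm herm Vc iso mult by blast

  let ?S = "{w. p w \<noteq> 0\<^sub>m d d}"
  define P where "P K = (\<lambda>(i, a) (j, b). \<Sum>w\<in>?S. p w $$ (i, j) * path_sum K f w a b)" for K :: "'i set"
  define E where "E r = (r div n, g (r mod n))" for r
  define e where "e r = (r div m, h (r mod m))" for r
  have E: "bij_betw E {..<d * n} ({..<d} \<times> I)" unfolding E_def by (rule bij_betw_div_mod[OF g])
  have e: "bij_betw e {..<d * m} ({..<d} \<times> J)" unfolding e_def by (rule bij_betw_div_mod[OF h])
  have big: "fp_eval n p X Y $$ (s, t) = P I (E s) (E t)" if st: "s < d * n" "t < d * n" for s t
  proof -
    have "word_eval n X Y w $$ (s mod n, t mod n) = path_sum I f w (g (s mod n)) (g (t mod n))" for w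
      by (rule word_eval_index[OF g]) (use nm in \<open>auto simp: XY L L_def\<close>)
    then show ?thesis
      unfolding fp_eval_index[OF p herm fpolys_finite[OF p] order_refl st] by (simp add: P_def E_def)
  qed
  have small: "fp_eval m p X' Y' $$ (s, t) = P J (e s) (e t)" if st: "s < d * m" "t < d * m" for s t
  proof -
    have "word_eval m X' Y' w $$ (s mod m, t mod m) = path_sum J f w (h (s mod m)) (h (t mod m))" for w
      by (rule word_eval_index[OF h]) (use nm Vc in \<open>auto simp: XY' compress_L\<close>)
    then show ?thesis
      unfolding fp_eval_index[OF p herm' fpolys_finite[OF p] order_refl st] by (simp add: P_def e_def)
  qed
  \<comment> \<open>The ampliation of the inclusion is the inclusion of
    \<open>{..<d} \<times> J\<close> into \<open>{..<d} \<times> I\<close>, so the same entry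
    formula applies to it.\<close>
  have K: "kron (1\<^sub>m d) V = mat (d * n) (d * m) (\<lambda>(r, s). if E r = e s then 1 else 0)"
  proof (rule eq_matI)
    fix r s assume "r < dim_row (mat (d * n) (d * m) (\<lambda>(r, s). if E r = e s then 1 else 0 :: complex))"
      "s < dim_col (mat (d * n) (d * m) (\<lambda>(r, s). if E r = e s then 1 else 0 :: complex))"
    then have "r < d * n" "s < d * m" by auto
    then show "kron (1\<^sub>m d) V $$ (r, s) = mat (d * n) (d * m) (\<lambda>(r, s). if E r = e s then 1 else 0) $$ (r, s)"
      using nm by (auto simp: kron_def V_def E_def e_def less_mult_imp_div_less)
  qed (auto simp: kron_def V_def)
  define T where "T = compress (kron (1\<^sub>m d) V) (fp_eval n p X Y) - fp_eval m p X' Y'"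
  have Tc: "T \<in> carrier_mat (d * m) (d * m)"
    unfolding T_def by (rule minus_carrier_mat[OF fp_eval_carrier[OF p]])
  have e_sub: "e ` {..<d * m} \<subseteq> {..<d} \<times> I" using e J by (auto simp: bij_betw_def)
  have T: "T $$ (r, s) = (\<lambda>x y. P I x y - P J x y) (e r) (e s)" if "r < d * m" "s < d * m" for r s
  proof -
    have "compress (kron (1\<^sub>m d) V) (fp_eval n p X Y) $$ (r, s) = P I (e r) (e s)"
      by (rule compress_inclusion_index[OF E e_sub K fp_eval_carrier[OF p] big that])
    then show ?thesis unfolding T_def using that fp_eval_carrier[OF p, of m X' Y'] small by simp
  qed
  have "psd T"
    using conv[unfolded xy_convex_def, rule_format, OF pair]
    by (simp add: loewner_le_def T_def X'_def[abs_def] Y'_def[abs_def])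
  then have "0 \<le> Re ((T *\<^sub>v vec (d * m) (\<lambda>r. v (e r))) \<bullet>c vec (d * m) (\<lambda>r. v (e r)))"
    using Tc by (auto simp: psd_def)
  also have "(T *\<^sub>v vec (d * m) (\<lambda>r. v (e r))) \<bullet>c vec (d * m) (\<lambda>r. v (e r)) =
      qform ({..<d} \<times> J) (\<lambda>x y. P I x y - P J x y) v"
    by (rule cscalar_form_eq_qform[OF e Tc T])
  also have "\<dots> = qform ({..<d} \<times> J) (\<lambda>(i, a) (j, b). \<Sum>w\<in>?S.
      p w $$ (i, j) * (path_sum I f w a b - path_sum J f w a b)) v"
    by (rule qform_cong) (auto simp: P_def sum_subtractf algebra_simps)
  finally show ?thesis .
qed

subsection \<open>The words of an \<open>xy\<close>-convex polynomial\<close>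

text \<open>The path graph with vertices \<open>0, \<dots>, length v\<close> whose \<open>k\<close>-th edge carries the letter \<open>v ! k\<close>,
  so that the walk from \<open>0\<close> to \<open>length v\<close> reads the word \<open>rev v\<close>.\<close>

definition path_graph :: "letter list \<Rightarrow> letter \<Rightarrow> nat \<Rightarrow> nat \<Rightarrow> complex" where
  "path_graph v l a b =
    (if (b = Suc a \<and> a < length v \<and> v ! a = l) \<or> (a = Suc b \<and> b < length v \<and> v ! b = l)
     then 1 else 0)"

fun is_x :: "letter \<Rightarrow> bool" where
  "is_x (VarX j) = True"
| "is_x (VarY k) = False"

lemma path_graph_sym: "path_graph v l b a = cnj (path_graph v l a b)"
  by (auto simp: path_graph_def)

lemma path_graph_adjacent: "path_graph v l a b \<noteq> 0 \<Longrightarrow> b = Suc a \<or> a = Suc b"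
  by (auto simp: path_graph_def split: if_splits)

lemma path_sum_ConsE:
  assumes "path_sum I f (l # w) a b \<noteq> 0"
  obtains c where "c \<in> I" "f l a c \<noteq> 0" "path_sum I f w c b \<noteq> 0"
proof -
  have "\<exists>c\<in>I. f l a c * path_sum I f w c b \<noteq> 0"
  proof (rule ccontr)
    assume "\<not> ?thesis"
    then have "path_sum I f (l # w) a b = 0" by (auto intro!: sum.neutral)
    with assms show False by simp
  qed
  then show thesis using that by auto
qed

text \<open>Every step of a walk changes the vertex by exactly one.\<close>

lemma path_sum_path_graph_reach:
  "path_sum I (path_graph v) w b 0 \<noteq> 0 \<Longrightarrow> b \<le> length w \<and> even (b + length w)"
proof (induction w arbitrary: b)
  case (Cons l w)
  then obtain c where "path_graph v l b c \<noteq> 0" "path_sum I (path_graph v) w c 0 \<noteq> 0"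
    by (blast elim: path_sum_ConsE)
  then show ?case using Cons.IH[of c] path_graph_adjacent[of v l b c] by auto
qed (auto split: if_splits)

text \<open>With no more steps than the distance, each step has to go down. The walk is therefore
  unique, and it reads the lowest \<open>length w\<close> edges in descending order.\<close>

lemma path_sum_path_graph_extremal:
  "length w \<le> length v \<Longrightarrow> path_sum {..length v} (path_graph v) w (length w) 0 =
    (if w = rev (take (length w) v) then 1 else 0)"
proof (induction w)
  case (Cons l w)
  let ?k = "length w"
  have k: "?k < length v" using Cons.prems by simp
  have "path_sum {..length v} (path_graph v) (l # w) (length (l # w)) 0 =
      (\<Sum>c\<in>{..length v}. if c = ?k then path_graph v l (Suc ?k) ?k * path_sum {..length v} (path_graph v) w ?k 0 else 0)"
    unfolding path_sum.simps
  proof (intro sum.cong refl)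
    fix c
    have "path_graph v l (Suc ?k) c * path_sum {..length v} (path_graph v) w c 0 = 0" if "c \<noteq> ?k"
    proof (rule ccontr)
      assume "path_graph v l (Suc ?k) c * path_sum {..length v} (path_graph v) w c 0 \<noteq> 0"
      then have "path_graph v l (Suc ?k) c \<noteq> 0" "path_sum {..length v} (path_graph v) w c 0 \<noteq> 0" by auto
      then show False
        using path_graph_adjacent[of v l "Suc ?k" c] path_sum_path_graph_reach[of _ v w c] that by force
    qed
    then show "path_graph v l (length (l # w)) c * path_sum {..length v} (path_graph v) w c 0 =
        (if c = ?k then path_graph v l (Suc ?k) ?k * path_sum {..length v} (path_graph v) w ?k 0 else 0)"
      by auto
  qed
  also have "\<dots> = path_graph v l (Suc ?k) ?k * path_sum {..length v} (path_graph v) w ?k 0"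
    using k by simp
  also have "path_graph v l (Suc ?k) ?k = (if v ! ?k = l then 1 else 0)"
    using k by (simp add: path_graph_def)
  also have "path_sum {..length v} (path_graph v) w ?k 0 = (if w = rev (take ?k v) then 1 else 0)"
    using Cons.IH k by simp
  finally show ?case using k by (auto simp: take_Suc_conv_app_nth)
qed simp

text \<open>Vertex 0 can be entered only from vertex 1, which is missing in
  \<open>J\<close>.\<close>

lemma path_sum_path_graph_cut:
  assumes "Suc 0 \<notin> J" "a \<in> J" "a \<noteq> 0"
  shows "path_sum J (path_graph v) w a 0 = 0"
  using assms(2,3)
proof (induction w arbitrary: a)
  case (Cons l w)
  show ?case
  proof (rule ccontr)
    assume "path_sum J (path_graph v) (l # w) a 0 \<noteq> 0"
    then obtain c where c: "c \<in> J" "path_graph v l a c \<noteq> 0" "path_sum J (path_graph v) w c 0 \<noteq> 0"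
      by (rule path_sum_ConsE)
    then have "c = 0" using Cons.IH[of c] by blast
    then show False using path_graph_adjacent[OF c(2)] Cons.prems assms(1) by auto
  qed
qed simp

lemma path_sum_path_graph_reach_end:
  "path_sum J (path_graph v) w b N \<noteq> 0 \<Longrightarrow> N \<le> b + length w"
proof (induction w arbitrary: b)
  case (Cons l w)
  then obtain c where "path_graph v l b c \<noteq> 0" "path_sum J (path_graph v) w c N \<noteq> 0"
    by (blast elim: path_sum_ConsE)
  then show ?case using Cons.IH[of c] path_graph_adjacent[of v l b c] by auto
qed (auto split: if_splits)

text \<open>A walk from \<open>N = length v\<close> back to \<open>b\<close> that visits \<open>{1..\<kappa>}\<close> has at least
  \<open>(N - \<kappa>) + (b - \<kappa>)\<close> steps.\<close>

lemma path_sum_path_graph_return: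
  fixes v :: "letter list" and \<kappa> :: nat
  defines "I \<equiv> {..length v}" and "J \<equiv> {..length v} - {1..\<kappa>}"
  assumes \<kappa>: "\<kappa> < length v" and b: "b \<in> I"
    and ne: "path_sum I (path_graph v) w b (length v) \<noteq>
      (if b \<in> J then path_sum J (path_graph v) w b (length v) else 0)"
  shows "b + length v \<le> 2 * \<kappa> + length w"
  using b ne
proof (induction w arbitrary: b)
  case Nil
  then show ?case using \<kappa> by (auto simp: I_def J_def split: if_splits)
next
  case (Cons l w)
  let ?f = "path_graph v" and ?N = "length v"
  let ?g = "\<lambda>c. path_sum I ?f w c ?N"
  \<comment> \<open>Extended by 0 outside of \<open>J\<close>, the sums over \<open>J\<close> obey a
    recursion over \<open>I\<close> as well, so that a difference between the two kinds of sums
    propagates along an edge.\<close>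
  let ?h = "\<lambda>c. if c \<in> J then path_sum J ?f w c ?N else 0"
  show ?case
  proof (cases "b \<in> J")
    case True
    have "(\<Sum>c\<in>J. ?f l b c * path_sum J ?f w c ?N) = (\<Sum>c\<in>I. ?f l b c * ?h c)"
      by (rule sum.mono_neutral_cong_left) (auto simp: I_def J_def)
    then have "(\<Sum>c\<in>I. ?f l b c * ?g c) \<noteq> (\<Sum>c\<in>I. ?f l b c * ?h c)"
      using Cons.prems True by simp
    then obtain c where c: "c \<in> I" "?f l b c * ?g c \<noteq> ?f l b c * ?h c"
      by (meson sum.cong)
    then have "?f l b c \<noteq> 0" "?g c \<noteq> ?h c" by auto
    then show ?thesis using Cons.IH[OF c(1)] path_graph_adjacent[of v l b c] by fastforce
  next
    case False
    then have b: "b \<le> \<kappa>" using Cons.prems by (auto simp: I_def J_def)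
    have "path_sum I ?f (l # w) b ?N \<noteq> 0" using Cons.prems False by simp
    then obtain c where c: "c \<in> I" "?f l b c \<noteq> 0" "?g c \<noteq> 0"
      by (rule path_sum_ConsE)
    show ?thesis
    proof (cases "?g c = ?h c")
      case True
      \<comment> \<open>Some walk inside \<open>J\<close> leads from \<open>c\<close> to the end; it
        covers the distance from \<open>c \<le> b + 1\<close>, and \<open>b \<le> \<kappa>\<close>
        yields the bound.\<close>
      then have "?h c \<noteq> 0" using c by simp
      then have "path_sum J ?f w c ?N \<noteq> 0" by (simp split: if_splits)
      then show ?thesis
        using path_sum_path_graph_reach_end[of J v w c ?N] path_graph_adjacent[OF c(2)] b by auto
    next
      case False
      then show ?thesis using Cons.IH[OF c(1)] path_graph_adjacent[OF c(2)] by fastforce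
    qed
  qed
qed

lemma fp_hermitian_index:
  assumes "p \<in> fpolys \<mu> d d" "fp_hermitian p" "i < d" "j < d"
  shows "p (rev w) $$ (j, i) = cnj (p w $$ (i, j))"
proof -
  have "fp_star p (rev w) = p (rev w)" using assms by (simp add: fp_hermitian_def)
  then have "mat_adjoint (p w) $$ (j, i) = p (rev w) $$ (j, i)" by (simp add: fp_star_def)
  then show ?thesis using assms by simp
qed

text \<open>Remove the vertices \<open>1..\<kappa>\<close> from the path graph. The entry of the
  convexity form between the far end and 0 is \<open>p w\<close>: removal cuts off vertex 0, and by
  \<open>supp\<close> no other word of the support leads there. By \<open>return\<close> the
  diagonal entry at the far end vanishes, hence its row. \<open>same\<close> is the price of
  \<open>\<kappa> = 1\<close>: the removed vertex then joins two vertices of \<open>J\<close>, and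
  the condition on \<open>xy\<close>-pairs rules out an \<open>x\<close>-edge next to a
  \<open>y\<close>-edge.\<close>

lemma xy_convex_coeff_zero:
  fixes w :: "letter list" and \<kappa> :: nat
  defines "I \<equiv> {..length w}" and "J \<equiv> {..length w} - {1..\<kappa>}"
  assumes p: "p \<in> fpolys \<mu> d d" and herm: "fp_hermitian p" and conv: "xy_convex \<mu> d p"
    and \<kappa>: "1 \<le> \<kappa>" "\<kappa> < length w"
    and same: "\<kappa> = 1 \<Longrightarrow> is_x (rev w ! 0) = is_x (rev w ! 1)"
    and supp: "\<And>u. p u \<noteq> 0\<^sub>m d d \<Longrightarrow> length u \<le> length w \<or> odd (length u + length w)"
    and return: "\<And>u. p u \<noteq> 0\<^sub>m d d \<Longrightarrow> path_sum I (path_graph (rev w)) u (length w) (length w) =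
      path_sum J (path_graph (rev w)) u (length w) (length w)"
  shows "p w = 0\<^sub>m d d"
proof -
  let ?v = "rev w" and ?N = "length w"
  let ?f = "path_graph ?v" and ?S = "{u. p u \<noteq> 0\<^sub>m d d}"
  have fin: "finite I" "finite J" by (auto simp: I_def J_def)
  have JI: "J \<subseteq> I" by (auto simp: I_def J_def)
  have NJ: "?N \<in> J" "0 \<in> J" "?N \<noteq> 0" using \<kappa> by (auto simp: J_def)
  have NI: "?N \<in> I" "0 \<in> I" using NJ JI by auto
  define H where "H = (\<lambda>(i, a) (j, b). \<Sum>u\<in>?S. p u $$ (i, j) * (path_sum I ?f u a b - path_sum J ?f u a b))"
  have pos: "0 \<le> Re (qform ({..<d} \<times> J) H x)" for x
    unfolding H_def
  proof (rule xy_convex_path_sums[OF p conv fin(1) JI path_graph_sym])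
    fix i j a b assume "a \<in> J" "b \<in> J"
    show "(\<Sum>c\<in>I - J. ?f (VarX i) a c * ?f (VarY j) c b) = 0"
    proof (intro sum.neutral ballI)
      fix c assume c: "c \<in> I - J"
      show "?f (VarX i) a c * ?f (VarY j) c b = 0"
      proof (rule ccontr)
        assume "\<not> ?thesis"
        then have ne: "?f (VarX i) a c \<noteq> 0" "?f (VarY j) c b \<noteq> 0" by auto
        have c': "1 \<le> c" "c \<le> \<kappa>" using c by (auto simp: I_def J_def)
        have ab: "a = 0 \<or> \<kappa> < a" "b = 0 \<or> \<kappa> < b" using \<open>a \<in> J\<close> \<open>b \<in> J\<close> by (auto simp: J_def)
        have adj: "c = Suc a \<or> a = Suc c" "b = Suc c \<or> c = Suc b"
          using path_graph_adjacent[OF ne(1)] path_graph_adjacent[OF ne(2)] by auto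
        show False
        \<comment> \<open>An edge carries only one letter, which excludes \<open>a = b\<close>. A
          removed vertex with two distinct neighbours in \<open>J\<close> occurs only for
          \<open>\<kappa> = 1\<close>.\<close>
        proof (cases "a = b")
          case True
          then show False using ne adj by (auto simp: path_graph_def split: if_splits)
        next
          case False
          then have "c = 1" "\<kappa> = 1" "{a, b} = {0, 2}" using adj ab c' by auto
          then have "a = 0 \<and> b = 2 \<or> a = 2 \<and> b = 0" by (auto simp: doubleton_eq_iff)
          then have "is_x (?v ! 0) \<noteq> is_x (?v ! 1)"
            using ne \<open>c = 1\<close> by (auto simp: path_graph_def numeral_2_eq_2 split: if_splits)
          then show False using same[OF \<open>\<kappa> = 1\<close>] by simp
        qed
      qed
    qed
  qed
  have end_I: "path_sum I ?f u ?N 0 = (if u = w then 1 else 0)" if u: "u \<in> ?S" for u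
  proof (cases "length u = ?N")
    case True
    then show ?thesis using path_sum_path_graph_extremal[of u ?v] by (simp add: I_def)
  next
    case False
    have "path_sum I ?f u ?N 0 = 0"
    proof (rule ccontr)
      assume "path_sum I ?f u ?N 0 \<noteq> 0"
      then have "?N \<le> length u" "even (?N + length u)" using path_sum_path_graph_reach by blast+
      then show False using supp[of u] u False by (auto simp: add.commute)
    qed
    then show ?thesis using False by auto
  qed
  have end_J: "path_sum J ?f u ?N 0 = 0" for u
    by (rule path_sum_path_graph_cut[OF _ NJ(1,3)]) (use \<kappa> in \<open>auto simp: J_def\<close>)
  have rev_I: "path_sum I ?f u 0 ?N = cnj (path_sum I ?f (rev u) ?N 0)" for u
    using path_sum_rev[OF fin(1) path_graph_sym[of ?v] NI, where w = "rev u"] by simp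
  have rev_J: "path_sum J ?f u 0 ?N = 0" for u
    using path_sum_rev[OF fin(2) path_graph_sym[of ?v] NJ(1,2), where w = "rev u"] end_J by simp
  have finS: "finite ?S" by (rule fpolys_finite[OF p])
  have "p w $$ (i, j) = 0" if ij: "i < d" "j < d" for i j
  proof (rule linear_bounded_below_imp_zero)
    fix z
    let ?x = "(i, ?N)" and ?y = "(j, 0 :: nat)"
    have z: "p u = 0\<^sub>m d d" if "u \<notin> ?S" for u using that by simp
    have Hxx: "H ?x ?x = 0" unfolding H_def using return by simp
    have "H ?x ?y = (\<Sum>u\<in>?S. if u = w then p w $$ (i, j) else 0)"
      unfolding H_def using end_I end_J by (auto intro!: sum.cong)
    then have Hxy: "H ?x ?y = p w $$ (i, j)" using finS z[of w] ij by auto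
    have S_rev: "p (rev u) \<noteq> 0\<^sub>m d d" if "u \<in> ?S" for u
    proof
      assume "p (rev u) = 0\<^sub>m d d"
      then have "p u $$ (a, b) = 0" if "a < d" "b < d" for a b
        using fp_hermitian_index[OF p herm that(2,1), of "rev u"] that by simp
      then have "p u = 0\<^sub>m d d" using p by (intro eq_matI) auto
      then show False using that by simp
    qed
    have "H ?y ?x = (\<Sum>u\<in>?S. if u = rev w then p (rev w) $$ (j, i) else 0)"
      unfolding H_def using S_rev end_I by (auto simp: rev_I rev_J intro!: sum.cong)
    then have Hyx: "H ?y ?x = cnj (p w $$ (i, j))"
      using finS z[of "rev w"] ij fp_hermitian_index[OF p herm ij, of w] by auto
    have "0 \<le> Re (qform ({..<d} \<times> J) H (\<lambda>a. if a = ?x then z else if a = ?y then 1 else 0))"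
      by (rule pos)
    also have "qform ({..<d} \<times> J) H (\<lambda>a. if a = ?x then z else if a = ?y then 1 else 0) =
        cnj z * p w $$ (i, j) + cnj (p w $$ (i, j)) * z + H ?y ?y"
      using ij NJ fin by (subst qform_two_points) (auto simp: Hxx Hxy Hyx)
    finally show "0 \<le> 2 * Re (cnj z * p w $$ (i, j)) + Re (H ?y ?y)" by (simp add: algebra_simps)
  qed
  then show ?thesis using p by (intro eq_matI) auto
qed

section \<open>Restrictions on the support, by length\<close>

text \<open>Removing two vertices meets the condition on \<open>xy\<close>-pairs whatever the
  letters are. A walk from the far end back to itself through a removed vertex then reads at least
  \<open>2 * N - 4\<close> letters, which exceeds the maximal length \<open>N\<close> as soon as
  \<open>N \<ge> 5\<close>; this is where the 4 comes from.\<close>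

lemma xy_convex_length_le_4:
  assumes p: "p \<in> fpolys \<mu> d d" and herm: "fp_hermitian p" and conv: "xy_convex \<mu> d p"
    and w: "p w \<noteq> 0\<^sub>m d d"
  shows "length w \<le> 4"
proof (rule ccontr)
  assume "\<not> length w \<le> 4"
  let ?S = "{u. p u \<noteq> 0\<^sub>m d d}"
  have fin: "finite ?S" by (rule fpolys_finite[OF p])
  define N where "N = Max (length ` ?S)"
  have max: "length u \<le> N" if "u \<in> ?S" for u unfolding N_def using fin that by simp
  have N: "5 \<le> N" using max[of w] w \<open>\<not> length w \<le> 4\<close> by simp
  have "N \<in> length ` ?S" unfolding N_def using fin w by (intro Max_in) auto
  then obtain u where u: "length u = N" "p u \<noteq> 0\<^sub>m d d" by auto
  have "p u = 0\<^sub>m d d"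
  proof (rule xy_convex_coeff_zero[OF p herm conv, of 2])
    show "2 < length u" using u N by simp
    fix t assume t: "p t \<noteq> 0\<^sub>m d d"
    then show "length t \<le> length u \<or> odd (length t + length u)" using max u by simp
    show "path_sum {..length u} (path_graph (rev u)) t (length u) (length u) =
        path_sum ({..length u} - {1..2}) (path_graph (rev u)) t (length u) (length u)"
      using path_sum_path_graph_return[of 2 "rev u" "length u" t] max[of t] t u N by auto
  qed auto
  then show False using u by simp
qed

text \<open>For \<open>\<kappa> = 1\<close> an excursion takes at least 6 letters, more than any
  word of the support has. The two edges at the removed vertex carry the last two letters of the
  word; the first two are treated by hermitian symmetry.\<close>

lemma xy_convex_length_4:
  assumes p: "p \<in> fpolys \<mu> d d" and herm: "fp_hermitian p" and conv: "xy_convex \<mu> d p"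
    and w: "p [l1, l2, l3, l4] \<noteq> 0\<^sub>m d d"
  shows "is_x l1 \<noteq> is_x l2" "is_x l3 \<noteq> is_x l4"
proof -
  have *: "p [k1, k2, k3, k4] = 0\<^sub>m d d" if same: "is_x k3 = is_x k4" for k1 k2 k3 k4
  proof (rule xy_convex_coeff_zero[OF p herm conv, of 1])
    fix t assume t: "p t \<noteq> 0\<^sub>m d d"
    let ?u = "[k1, k2, k3, k4]"
    have len: "length t \<le> 4" by (rule xy_convex_length_le_4[OF p herm conv t])
    then show "length t \<le> length ?u \<or> odd (length t + length ?u)" by simp
    show "path_sum {..length ?u} (path_graph (rev ?u)) t (length ?u) (length ?u) =
        path_sum ({..length ?u} - {1..1}) (path_graph (rev ?u)) t (length ?u) (length ?u)"
      using path_sum_path_graph_return[of 1 "rev ?u" "length ?u" t] len by auto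
  qed (use same in auto)
  show "is_x l3 \<noteq> is_x l4" using * w by blast
  show "is_x l1 \<noteq> is_x l2"
  proof
    assume "is_x l1 = is_x l2"
    then have "p [l4, l3, l2, l1] = 0\<^sub>m d d" by (intro *) simp
    then have "p [l1, l2, l3, l4] $$ (i, j) = 0" if "i < d" "j < d" for i j
      using fp_hermitian_index[OF p herm that(2,1), of "[l4, l3, l2, l1]"] that by simp
    then have "p [l1, l2, l3, l4] = 0\<^sub>m d d" using p by (intro eq_matI) auto
    then show False using w by simp
  qed
qed

text \<open>For \<open>\<kappa> = 1\<close> an excursion takes at least 4 letters, so the words of
  length 4 might interfere. They contain letters of both kinds, whereas the graph of a word of a
  single kind has edges of that kind only.\<close>

lemma xy_convex_length_3:
  assumes p: "p \<in> fpolys \<mu> d d" and herm: "fp_hermitian p" and conv: "xy_convex \<mu> d p"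
    and w: "p [l1, l2, l3] \<noteq> 0\<^sub>m d d"
  shows "\<not> (is_x l1 = is_x l2 \<and> is_x l2 = is_x l3)"
proof
  assume same: "is_x l1 = is_x l2 \<and> is_x l2 = is_x l3"
  let ?u = "[l1, l2, l3]"
  have "p ?u = 0\<^sub>m d d"
  proof (rule xy_convex_coeff_zero[OF p herm conv, of 1])
    fix t assume t: "p t \<noteq> 0\<^sub>m d d"
    have len: "length t \<le> 4" by (rule xy_convex_length_le_4[OF p herm conv t])
    then have "length t \<le> 3 \<or> length t = 4" by auto
    then show "length t \<le> length ?u \<or> odd (length t + length ?u)" by auto
    show "path_sum {..length ?u} (path_graph (rev ?u)) t (length ?u) (length ?u) =
        path_sum ({..length ?u} - {1..1}) (path_graph (rev ?u)) t (length ?u) (length ?u)"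
    proof (cases "length t = 4")
      case True
      then obtain k1 k2 k3 k4 where t4: "t = [k1, k2, k3, k4]"
        by (auto simp: numeral_eq_Suc length_Suc_conv)
      then have "is_x k1 \<noteq> is_x k2" using xy_convex_length_4[OF p herm conv] t by blast
      then obtain l where l: "l \<in> set t" "is_x l \<noteq> is_x l1" using t4 by (metis list.set_intros)
      have "path_graph (rev ?u) l a b = 0" for a b
      proof -
        have "rev ?u ! k \<noteq> l" if "k < 3" for k
          using that l(2) same by (auto simp: numeral_3_eq_3 less_Suc_eq)
        then show ?thesis by (auto simp: path_graph_def)
      qed
      then show ?thesis using path_sum_eq_zero_letter[OF l(1)] by metis
    next
      case False
      show ?thesis
        using path_sum_path_graph_return[of 1 "rev ?u" "length ?u" t] len False by auto
    qed
  qed (use same in auto)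
  then show False using w by simp
qed

subsection \<open>The Gram matrix of an \<open>xy\<close>-convex polynomial\<close>

definition pencil_words :: "nat \<Rightarrow> letter list set" where
  "pencil_words \<mu> = {w \<in> words \<mu>. w = [] \<or> (\<exists>l. w = [l]) \<or> (\<exists>l l'. w = [l, l'] \<and> is_x l \<noteq> is_x l')}"

lemma finite_pencil_words: "finite (pencil_words \<mu>)"
proof (rule finite_subset)
  let ?L = "VarX ` {..<\<mu>} \<union> VarY ` {..<\<mu>}"
  show "finite {w. set w \<subseteq> ?L \<and> length w \<le> 2}" by (intro finite_lists_length_le) auto
  have "l \<in> ?L" if "letter_index l < \<mu>" for l using that by (cases l) auto
  then show "pencil_words \<mu> \<subseteq> {w. set w \<subseteq> ?L \<and> length w \<le> 2}"
    by (auto simp: pencil_words_def words_def)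
qed

lemma rev_pencil_words: "w \<in> pencil_words \<mu> \<Longrightarrow> rev w \<in> pencil_words \<mu>"
  by (auto simp: pencil_words_def words_def)

text \<open>Length 3 requires a mixed pair of neighbours, length 4 a mixed pair in each half, and
  this is what the restrictions by length supply. The splitting is not unique in general, as
  \<open>x y x\<close> shows.\<close>

lemma xy_convex_support:
  assumes p: "p \<in> fpolys \<mu> d d" and herm: "fp_hermitian p" and conv: "xy_convex \<mu> d p"
    and w: "p w \<noteq> 0\<^sub>m d d" "w \<notin> pencil_words \<mu>"
  obtains s t where "s \<in> pencil_words \<mu> - {[]}" "t \<in> pencil_words \<mu> - {[]}" "w = rev s @ t"
proof -
  have W: "w \<in> words \<mu>" using fpolys_words[OF p w(1)] .
  have single: "[l] \<in> pencil_words \<mu>" if "l \<in> set w" for l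
    using that W by (auto simp: pencil_words_def words_def)
  have double: "[l, l'] \<in> pencil_words \<mu>" if "l \<in> set w" "l' \<in> set w" "is_x l \<noteq> is_x l'" for l l'
    using that W by (auto simp: pencil_words_def words_def)
  have "length w \<le> 4" by (rule xy_convex_length_le_4[OF p herm conv w(1)])
  moreover have "w \<noteq> []" "length w \<noteq> 1"
    using w(2) W by (auto simp: pencil_words_def length_Suc_conv)
  moreover have "length w \<noteq> 0" using \<open>w \<noteq> []\<close> by simp
  ultimately have "length w = 2 \<or> length w = 3 \<or> length w = 4" by linarith
  then consider l1 l2 where "w = [l1, l2]" | l1 l2 l3 where "w = [l1, l2, l3]"
    | l1 l2 l3 l4 where "w = [l1, l2, l3, l4]"
    by (auto simp: numeral_eq_Suc length_Suc_conv)
  then show thesis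
  proof cases
    case 1
    then show ?thesis using that[of "[l1]" "[l2]"] single by simp
  next
    case 2
    then have "is_x l2 \<noteq> is_x l3 \<or> is_x l2 \<noteq> is_x l1"
      using xy_convex_length_3[OF p herm conv] w(1) by blast
    then show ?thesis
    proof
      assume "is_x l2 \<noteq> is_x l3"
      then show ?thesis using that[of "[l1]" "[l2, l3]"] single[of l1] double[of l2 l3] 2 by simp
    next
      assume "is_x l2 \<noteq> is_x l1"
      then show ?thesis using that[of "[l2, l1]" "[l3]"] single[of l3] double[of l2 l1] 2 by simp
    qed
  next
    case 3
    then have "is_x l1 \<noteq> is_x l2" "is_x l3 \<noteq> is_x l4"
      using xy_convex_length_4[OF p herm conv] w(1) by blast+
    then show ?thesis
      using that[of "[l2, l1]" "[l3, l4]"] double[of l2 l1] double[of l3 l4] 3 by simp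
  qed
qed

text \<open>A positive definite \<open>M\<close> depending on the classes only is the Gram matrix of vectors \<open>z\<^sub>s\<close>,
  and it is realized by walks: the letter \<open>l\<close> joins the \<open>i\<close>-th vertex of \<open>J\<close> to \<open>z\<^sub>l\<close>, where
  vanishing on the pencil words makes the \<open>x\<close>-vectors orthogonal to the \<open>y\<close>-vectors, and acts
  outside of \<open>J\<close> as a hermitian matrix with \<open>z\<^sub>k \<mapsto> z\<^sub>l\<^sub>k\<close> whenever \<open>l\<close> and \<open>k\<close> are letters of
  different kinds. The latter exists because \<open>\<langle>z\<^sub>l\<^sub>k, z\<^sub>h\<rangle>\<close> and \<open>\<langle>z\<^sub>k, z\<^sub>l\<^sub>h\<rangle>\<close> are both the value
  at the word \<open>h l k\<close>.\<close>

lemma gram_walks: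
  fixes m :: "letter list \<times> nat \<times> nat \<Rightarrow> complex" and \<mu> d :: nat
  defines "A \<equiv> (pencil_words \<mu> - {[]}) \<times> {..<d}"
    and "M \<equiv> \<lambda>(s, i) (t, j). m (rev s @ t, i, j)"
  assumes m_rev: "\<And>w i j. m (rev w, j, i) = cnj (m (w, i, j))"
    and m_pencil: "\<And>w i j. w \<in> pencil_words \<mu> \<Longrightarrow> m (w, i, j) = 0"
    and psd: "psd_on A M" and pos: "\<And>v. \<exists>a\<in>A. v a \<noteq> 0 \<Longrightarrow> 0 < Re (qform A M v)"
  obtains f :: "letter \<Rightarrow> nat + (letter list \<times> nat) \<Rightarrow> nat + (letter list \<times> nat) \<Rightarrow> complex"
  where "\<And>l a b. f l b a = cnj (f l a b)"
    "\<And>l i j. f l (Inl i) (Inl j) = 0"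
    "\<And>k l i j. k < \<mu> \<Longrightarrow> l < \<mu> \<Longrightarrow> i < d \<Longrightarrow> j < d \<Longrightarrow>
      (\<Sum>c\<in>A. f (VarX k) (Inl i) (Inr c) * f (VarY l) (Inr c) (Inl j)) = 0"
    "\<And>s t i j. s \<in> pencil_words \<mu> - {[]} \<Longrightarrow> t \<in> pencil_words \<mu> - {[]} \<Longrightarrow> i < d \<Longrightarrow> j < d \<Longrightarrow>
      path_sum (Inl ` {..<d} \<union> Inr ` A) f (rev s @ t) (Inl i) (Inl j) = m (rev s @ t, i, j)"
    "\<And>t i j. t \<in> pencil_words \<mu> - {[]} \<Longrightarrow> i < d \<Longrightarrow> j < d \<Longrightarrow>
      path_sum (Inl ` {..<d} \<union> Inr ` A) f t (Inl i) (Inl j) = 0"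
proof -
  have finA: "finite A" unfolding A_def using finite_pencil_words by simp
  obtain B C where B: "\<And>a b. a \<in> A \<Longrightarrow> b \<in> A \<Longrightarrow> M a b = (\<Sum>c\<in>A. cnj (B c a) * B c b)"
    and CB: "\<And>a b. a \<in> A \<Longrightarrow> b \<in> A \<Longrightarrow> (\<Sum>c\<in>A. C a c * B c b) = (if a = b then 1 else 0)"
    and BC: "\<And>a b. a \<in> A \<Longrightarrow> b \<in> A \<Longrightarrow> (\<Sum>c\<in>A. B a c * C c b) = (if a = b then 1 else 0)"
    using posdef_factorization[OF finA psd pos] by blast
  define mixed where "mixed l a = (\<exists>k. fst a = [k] \<and> is_x k \<noteq> is_x l)" for l and a :: "letter list \<times> nat"
  \<comment> \<open>The matrix of the letter \<open>l\<close> in the basis of Gram vectors. The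
    columns at letters of the other kind are forced by the prescribed images, the corresponding rows
    by symmetry, and where both apply they agree; all other entries are set to 0.\<close>
  define \<Phi> where "\<Phi> l a b = (if mixed l a \<or> mixed l b then m (rev (fst a) @ l # fst b, snd a, snd b) else 0)"
    for l a b
  \<comment> \<open>The same operator in orthonormal coordinates, \<open>C\<^sup>* \<Phi> C\<close>,
    where hermitian operators have hermitian matrices.\<close>
  define E where "E l c e = (\<Sum>a\<in>A. \<Sum>b\<in>A. cnj (C a c) * \<Phi> l a b * C b e)" for l c e
  have \<Phi>_herm: "\<Phi> l b a = cnj (\<Phi> l a b)" for l a b
    using m_rev[of "rev (fst a) @ l # fst b" "snd b" "snd a"] by (auto simp: \<Phi>_def)
  have E_herm: "E l e c = cnj (E l c e)" for l c e
  proof -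
    have flip: "cnj (cnj (C a c) * \<Phi> l a b * C b e) = C a c * \<Phi> l b a * cnj (C b e)" for a b
      by (simp add: \<Phi>_herm[of l b a])
    have "cnj (E l c e) = (\<Sum>a\<in>A. \<Sum>b\<in>A. C a c * \<Phi> l b a * cnj (C b e))"
      unfolding E_def cnj_sum flip ..
    also have "\<dots> = E l e c"
      unfolding E_def by (subst sum.swap) (intro sum.cong refl, simp)
    finally show ?thesis ..
  qed
  have E_act: "(\<Sum>e\<in>A. E l c e * B e ([k], j)) = B c ([l, k], j)"
    if c: "c \<in> A" and lk: "[l, k] \<in> pencil_words \<mu>" and j: "j < d" for l k c j
  proof -
    have kA: "([k], j) \<in> A" and lkA: "([l, k], j) \<in> A" and mix: "mixed l ([k], j)"
      using lk j by (auto simp: A_def pencil_words_def words_def mixed_def)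
    have "(\<Sum>e\<in>A. E l c e * B e ([k], j)) =
        (\<Sum>e\<in>A. \<Sum>a\<in>A. \<Sum>b\<in>A. cnj (C a c) * \<Phi> l a b * (C b e * B e ([k], j)))"
      unfolding E_def sum_distrib_right by (simp add: mult.assoc)
    also have "\<dots> = (\<Sum>a\<in>A. \<Sum>e\<in>A. \<Sum>b\<in>A. cnj (C a c) * \<Phi> l a b * (C b e * B e ([k], j)))"
      by (rule sum.swap)
    also have "\<dots> = (\<Sum>a\<in>A. \<Sum>b\<in>A. \<Sum>e\<in>A. cnj (C a c) * \<Phi> l a b * (C b e * B e ([k], j)))"
      by (rule sum.cong[OF refl]) (rule sum.swap)
    also have "\<dots> = (\<Sum>a\<in>A. \<Sum>b\<in>A. cnj (C a c) * \<Phi> l a b * (if b = ([k], j) then 1 else 0))"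
      unfolding sum_distrib_left[symmetric] using CB[OF _ kA] by (intro sum.cong refl) simp
    also have "\<dots> = (\<Sum>a\<in>A. cnj (C a c) * \<Phi> l a ([k], j))"
      using finA kA by (simp add: if_distrib cong: if_cong)
    \<comment> \<open>Since \<open>[k]\<close> is mixed for \<open>l\<close>, the kernel
      \<open>\<Phi>\<close> has its prescribed value here, the inner product with the Gram vector of
      \<open>[l, k]\<close>.\<close>
    also have "\<dots> = (\<Sum>a\<in>A. cnj (C a c) * M a ([l, k], j))"
      using mix by (intro sum.cong refl) (simp add: \<Phi>_def M_def case_prod_unfold)
    also have "\<dots> = (\<Sum>a\<in>A. \<Sum>e\<in>A. cnj (C a c) * (cnj (B e a) * B e ([l, k], j)))"
      using B[OF _ lkA] by (intro sum.cong refl) (simp add: sum_distrib_left)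
    also have "\<dots> = (\<Sum>e\<in>A. cnj (\<Sum>a\<in>A. B e a * C a c) * B e ([l, k], j))"
      by (subst sum.swap) (simp add: sum_distrib_left sum_distrib_right mult_ac)
    also have "\<dots> = (\<Sum>e\<in>A. if e = c then B c ([l, k], j) else 0)"
      using BC[OF _ c] by (intro sum.cong refl) simp
    finally show ?thesis using finA c by simp
  qed

  define f :: "letter \<Rightarrow> nat + (letter list \<times> nat) \<Rightarrow> nat + (letter list \<times> nat) \<Rightarrow> complex" where
    "f l x y = (case x of
        Inl i \<Rightarrow> (case y of Inl j \<Rightarrow> 0 | Inr e \<Rightarrow> cnj (B e ([l], i)))
      | Inr c \<Rightarrow> (case y of Inl j \<Rightarrow> B c ([l], j) | Inr e \<Rightarrow> E l c e))" for l x y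
  let ?I = "Inl ` {..<d} \<union> Inr ` A"
  have finI: "finite ?I" using finA by simp
  have f_simps: "f l (Inl i) (Inl j) = 0" "f l (Inl i) (Inr c) = cnj (B c ([l], i))"
    "f l (Inr c) (Inl j) = B c ([l], j)" "f l (Inr c) (Inr e) = E l c e" for l i j c e
    by (simp_all add: f_def)
  have f_herm: "f l b a = cnj (f l a b)" for l a b
    by (cases a; cases b) (simp_all add: f_simps E_herm[symmetric])
  have sum_I: "(\<Sum>c\<in>?I. h c) = (\<Sum>k<d. h (Inl k)) + (\<Sum>c\<in>A. h (Inr c))"
    for h :: "_ \<Rightarrow> complex"
    using finA by (subst sum.union_disjoint) (auto simp: sum.reindex)
  have dot: "(\<Sum>c\<in>A. cnj (B c (s, i)) * B c (t, j)) = m (rev s @ t, i, j)"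
    if "s \<in> pencil_words \<mu> - {[]}" "t \<in> pencil_words \<mu> - {[]}" "i < d" "j < d" for s t i j
    using B[of "(s, i)" "(t, j)"] that by (simp add: A_def M_def)
  have single: "[l] \<in> pencil_words \<mu> - {[]}" if "letter_index l < \<mu>" for l
    using that by (auto simp: pencil_words_def words_def)
  \<comment> \<open>Reading \<open>t\<close> towards \<open>Inl j\<close> produces the Gram vector
    of \<open>t\<close> on the vertices \<open>Inr c\<close>. The components at the vertices
    \<open>Inl i\<close> are 0, for words of length two because \<open>m\<close> vanishes on pencil
    words.\<close>
  have walk: "path_sum ?I f t (Inl i) (Inl j) = 0" "c \<in> A \<Longrightarrow> path_sum ?I f t (Inr c) (Inl j) = B c (t, j)"
    if t: "t \<in> pencil_words \<mu> - {[]}" and j: "j < d" and i: "i < d" for t i j c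
  proof -
    have jI: "Inl j \<in> ?I" using j by simp
    have one: "path_sum ?I f [l] x (Inl j) = f l x (Inl j)" for l x
      by (rule path_sum_single[OF finI jI])
    have two: "path_sum ?I f [l, k] x (Inl j) = (\<Sum>e\<in>A. f l x (Inr e) * B e ([k], j))" for l k x
      unfolding path_sum.simps(2)[of ?I f l] sum_I one by (simp add: f_simps)
    from t consider l where "t = [l]" | l k where "t = [l, k]"
      by (auto simp: pencil_words_def)
    then have "path_sum ?I f t (Inl i) (Inl j) = 0 \<and>
        (c \<in> A \<longrightarrow> path_sum ?I f t (Inr c) (Inl j) = B c (t, j))"
    proof cases
      case 1
      then show ?thesis unfolding 1 one by (simp add: f_simps)
    next
      case 2
      have lk: "[l] \<in> pencil_words \<mu> - {[]}" "[k] \<in> pencil_words \<mu> - {[]}"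
        using t 2 by (auto simp: pencil_words_def words_def)
      have "(\<Sum>e\<in>A. cnj (B e ([l], i)) * B e ([k], j)) = 0"
        using dot[OF lk i j] m_pencil[of "[l, k]"] t 2 by simp
      then show ?thesis unfolding 2 two using E_act[of c l k j] t j 2 by (simp add: f_simps)
    qed
    then show "path_sum ?I f t (Inl i) (Inl j) = 0"
      "c \<in> A \<Longrightarrow> path_sum ?I f t (Inr c) (Inl j) = B c (t, j)" by auto
  qed
  show thesis
  proof (rule that)
    show "f l b a = cnj (f l a b)" for l a b by (rule f_herm)
    show "f l (Inl i) (Inl j) = 0" for l i j by (simp add: f_simps)
    show "(\<Sum>c\<in>A. f (VarX k) (Inl i) (Inr c) * f (VarY l) (Inr c) (Inl j)) = 0"
      if "k < \<mu>" "l < \<mu>" "i < d" "j < d" for k l i j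
    proof -
      have "[VarX k, VarY l] \<in> pencil_words \<mu>" using that by (auto simp: pencil_words_def words_def)
      then show ?thesis
        using dot[OF single single that(3,4), of "VarX k" "VarY l"] that m_pencil by (simp add: f_simps)
    qed
    show "path_sum ?I f t (Inl i) (Inl j) = 0" if "t \<in> pencil_words \<mu> - {[]}" "i < d" "j < d" for t i j
      by (rule walk(1)[OF that(1,3,2)])
    fix s t i j
    assume s: "s \<in> pencil_words \<mu> - {[]}" and t: "t \<in> pencil_words \<mu> - {[]}" and ij: "i < d" "j < d"
    have iI: "Inl i \<in> ?I" using ij by simp
    have rev_s: "path_sum ?I f (rev s) (Inl i) c = cnj (path_sum ?I f s c (Inl i))" if "c \<in> ?I" for c
      by (rule path_sum_rev[OF finI f_herm that iI])
    \<comment> \<open>Cut between \<open>rev s\<close> and \<open>t\<close>: as the weights are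
      hermitian, this is the inner product of the vectors produced by \<open>s\<close> and by
      \<open>t\<close>.\<close>
    have "path_sum ?I f (rev s @ t) (Inl i) (Inl j) =
        (\<Sum>c\<in>?I. path_sum ?I f (rev s) (Inl i) c * path_sum ?I f t c (Inl j))"
      by (rule path_sum_append[OF finI iI])
    also have "\<dots> = (\<Sum>c\<in>?I. cnj (path_sum ?I f s c (Inl i)) * path_sum ?I f t c (Inl j))"
      using rev_s by (intro sum.cong refl) simp
    also have "\<dots> = (\<Sum>k<d. cnj (path_sum ?I f s (Inl k) (Inl i)) * path_sum ?I f t (Inl k) (Inl j)) +
        (\<Sum>c\<in>A. cnj (path_sum ?I f s (Inr c) (Inl i)) * path_sum ?I f t (Inr c) (Inl j))"
      by (rule sum_I)
    also have "(\<Sum>k<d. cnj (path_sum ?I f s (Inl k) (Inl i)) * path_sum ?I f t (Inl k) (Inl j)) = 0"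
      using walk(1)[OF t ij(2)] by (intro sum.neutral) auto
    also have "(\<Sum>c\<in>A. cnj (path_sum ?I f s (Inr c) (Inl i)) * path_sum ?I f t (Inr c) (Inl j)) =
        (\<Sum>c\<in>A. cnj (B c (s, i)) * B c (t, j))"
      using walk(2)[OF s ij(1) ij(1)] walk(2)[OF t ij(2) ij(1)] by (intro sum.cong refl) simp
    also have "\<dots> = m (rev s @ t, i, j)" by (rule dot[OF s t ij])
    finally show "path_sum ?I f (rev s @ t) (Inl i) (Inl j) = m (rev s @ t, i, j)" by simp
  qed
qed

lemma qform_support:
  assumes "finite A" "D \<subseteq> A" "\<And>a. a \<in> A - D \<Longrightarrow> v a = 0"
  shows "qform A M v = qform D M v"
proof -
  have "(\<Sum>b\<in>A. cnj (v a) * M a b * v b) = (\<Sum>b\<in>D. cnj (v a) * M a b * v b)" for a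
    using assms by (intro sum.mono_neutral_right) auto
  then show ?thesis
    unfolding qform_def using assms by (simp, intro sum.mono_neutral_right) auto
qed

text \<open>The duality for class sums, with the pair \<open>(s, i)\<close>, \<open>(t, j)\<close>
  in the class of the word \<open>rev s @ t\<close> and the entry \<open>(i, j)\<close>, and with
  \<open>Z\<close> the classes of pencil words. A functional \<open>m\<close> as in its hypothesis
  is realized by walks, and convexity on these is the inequality to be shown.\<close>

lemma xy_convex_gram:
  fixes \<mu> d :: nat
  defines "A \<equiv> (pencil_words \<mu> - {[]}) \<times> {..<d}"
  assumes p: "p \<in> fpolys \<mu> d d" and herm: "fp_hermitian p" and conv: "xy_convex \<mu> d p"
  obtains B where "\<And>w i j. w \<notin> pencil_words \<mu> \<Longrightarrow> i < d \<Longrightarrow> j < d \<Longrightarrow>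
    p w $$ (i, j) = (\<Sum>k\<in>{k. k \<le> length w \<and> rev (take k w) \<in> pencil_words \<mu> - {[]} \<and>
      drop k w \<in> pencil_words \<mu> - {[]}}. \<Sum>c\<in>A. cnj (B c (rev (take k w), i)) * B c (drop k w, j))"
proof -
  let ?P = "pencil_words \<mu> - {[]}"
  define cls :: "letter list \<times> nat \<Rightarrow> letter list \<times> nat \<Rightarrow> letter list \<times> nat \<times> nat" where
    "cls = (\<lambda>(s, i) (t, j). (rev s @ t, i, j))"
  define st :: "letter list \<times> nat \<times> nat \<Rightarrow> letter list \<times> nat \<times> nat" where
    "st = (\<lambda>(w, i, j). (rev w, j, i))"
  define Z :: "(letter list \<times> nat \<times> nat) set" where "Z = {c. fst c \<in> pencil_words \<mu>}"
  define q where "q = (\<lambda>(w, i, j). if i < d \<and> j < d then p w $$ (i, j) else 0)"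
  let ?C = "(\<lambda>(a, b). cls a b) ` (A \<times> A) - Z"
  have finA: "finite A" unfolding A_def using finite_pencil_words by simp
  have len: "length s = 1 \<or> length s = 2" if "s \<in> ?P" for s
    using that by (auto simp: pencil_words_def)
  obtain G where G: "psd_on A G"
    and G_cls: "\<And>c. c \<in> ?C \<Longrightarrow> (\<Sum>(a, b)\<in>{(a, b)\<in>A \<times> A. cls a b = c}. G a b) = q c"
  proof (rule psd_class_sums[OF finA, of cls st Z q])
    show "cls b a = st (cls a b)" for a b by (simp add: cls_def st_def case_prod_unfold)
    show "st (st c) = c" for c by (simp add: st_def case_prod_unfold)
    show "st c \<in> Z" if "c \<in> Z" for c
      using that rev_pencil_words by (auto simp: Z_def st_def case_prod_unfold)
    show "q (st c) = cnj (q c)" for c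
      using fp_hermitian_index[OF p herm] by (auto simp: q_def st_def case_prod_unfold)
    \<comment> \<open>All indices have length 1 or 2, so a product of two of them that has the
      length of \<open>rev s @ s\<close> is cut in the middle.\<close>
    show "b = a \<and> b' = a" if "a \<in> A" "b \<in> A" "b' \<in> A" "cls b b' = cls a a" for a b b'
    proof -
      obtain s i where a: "a = (s, i)" "s \<in> ?P" using \<open>a \<in> A\<close> by (auto simp: A_def)
      obtain t j where b: "b = (t, j)" "t \<in> ?P" using \<open>b \<in> A\<close> by (auto simp: A_def)
      obtain t' j' where b': "b' = (t', j')" "t' \<in> ?P" using \<open>b' \<in> A\<close> by (auto simp: A_def)
      have eq: "rev t @ t' = rev s @ s" "j = i" "j' = i" using that(4) by (auto simp: a b b' cls_def)
      then have "length t + length t' = length s + length s"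
        by (metis length_append length_rev)
      then have "length t = length s" using len[OF a(2)] len[OF b(2)] len[OF b'(2)] by auto
      then show ?thesis using eq a b b' by simp
    qed
    show "cls a a \<notin> Z" if "a \<in> A" for a
    proof -
      obtain s i where a: "a = (s, i)" "s \<in> ?P" using \<open>a \<in> A\<close> by (auto simp: A_def)
      then consider l where "s = [l]" | l k where "s = [l, k]" by (auto simp: pencil_words_def)
      then show ?thesis by cases (auto simp: a cls_def Z_def pencil_words_def)
    qed
  next
    fix m :: "letter list \<times> nat \<times> nat \<Rightarrow> complex"
    assume m_st: "\<And>c. m (st c) = cnj (m c)" and m_Z: "\<And>c. c \<in> Z \<Longrightarrow> m c = 0"
      and psd: "psd_on A (\<lambda>a b. m (cls a b))"
      and pos: "\<And>v. \<exists>a\<in>A. v a \<noteq> 0 \<Longrightarrow> 0 < Re (qform A (\<lambda>a b. m (cls a b)) v)"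
    have M: "(\<lambda>(s, i) (t, j). m (rev s @ t, i, j)) = (\<lambda>a b. m (cls a b))"
      by (simp add: cls_def case_prod_unfold)
    let ?J = "Inl ` {..<d} :: (nat + letter list \<times> nat) set" and ?I = "Inl ` {..<d} \<union> Inr ` A"
    have m_rev: "m (rev w, j, i) = cnj (m (w, i, j))" for w i j
      using m_st[of "(w, i, j)"] by (simp add: st_def)
    have m_pencil: "m (w, i, j) = 0" if "w \<in> pencil_words \<mu>" for w i j
      using m_Z that by (simp add: Z_def)
    obtain f :: "letter \<Rightarrow> nat + (letter list \<times> nat) \<Rightarrow> nat + (letter list \<times> nat) \<Rightarrow> complex"
      where f_herm: "\<And>l a b. f l b a = cnj (f l a b)"
        and f_zero: "\<And>l i j. f l (Inl i) (Inl j) = 0"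
        and f_xy: "\<And>k l i j. k < \<mu> \<Longrightarrow> l < \<mu> \<Longrightarrow> i < d \<Longrightarrow> j < d \<Longrightarrow>
          (\<Sum>c\<in>A. f (VarX k) (Inl i) (Inr c) * f (VarY l) (Inr c) (Inl j)) = 0"
        and f_gram: "\<And>s t i j. s \<in> ?P \<Longrightarrow> t \<in> ?P \<Longrightarrow> i < d \<Longrightarrow> j < d \<Longrightarrow>
          path_sum ?I f (rev s @ t) (Inl i) (Inl j) = m (rev s @ t, i, j)"
        and f_pencil: "\<And>t i j. t \<in> ?P \<Longrightarrow> i < d \<Longrightarrow> j < d \<Longrightarrow> path_sum ?I f t (Inl i) (Inl j) = 0"
    proof (rule gram_walks[of m \<mu> d, folded A_def, unfolded M])
      show "m (rev w, j, i) = cnj (m (w, i, j))" for w i j by (rule m_rev)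
      show "m (w, i, j) = 0" if "w \<in> pencil_words \<mu>" for w i j by (rule m_pencil[OF that])
      show "psd_on A (\<lambda>a b. m (cls a b))" by (rule psd)
      show "0 < Re (qform A (\<lambda>a b. m (cls a b)) v)" if "\<exists>a\<in>A. v a \<noteq> 0" for v by (rule pos[OF that])
    qed (rule that)
    let ?S = "{w. p w \<noteq> 0\<^sub>m d d}"
    have finS: "finite ?S" by (rule fpolys_finite[OF p])
    have finI: "finite ?I" using finA by simp
    \<comment> \<open>Non-empty walks inside \<open>J\<close> have weight 0, and the empty word
      contributes equally to both sums. A word of the support that is no pencil word splits as
      \<open>rev s @ t\<close>, where the walks realize \<open>m\<close>.\<close>
    have diff: "path_sum ?I f w (Inl i) (Inl j) - path_sum ?J f w (Inl i) (Inl j) = m (w, i, j)"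
      if w: "w \<in> ?S" and ij: "i < d" "j < d" for w i j
    proof (cases w)
      case Nil
      then show ?thesis using m_pencil[of "[]"] by (simp add: pencil_words_def words_def)
    next
      case (Cons l u)
      have "path_sum ?J f w (Inl i) (Inl j) = 0"
        unfolding Cons path_sum.simps by (rule sum.neutral) (auto simp: f_zero)
      moreover have "path_sum ?I f w (Inl i) (Inl j) = m (w, i, j)"
      proof (cases "w \<in> pencil_words \<mu>")
        case True
        then show ?thesis using f_pencil[of w i j] m_pencil ij Cons by simp
      next
        case False
        obtain s t where "s \<in> ?P" "t \<in> ?P" "w = rev s @ t"
          using xy_convex_support[OF p herm conv _ False] w by blast
        then show ?thesis using f_gram ij by simp
      qed
      ultimately show ?thesis by simp
    qed
    define H where "H = (\<lambda>(i, a) (j, b). \<Sum>w\<in>?S. p w $$ (i, j) * (path_sum ?I f w a b - path_sum ?J f w a b))"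
    \<comment> \<open>The sum of all \<open>e_i \<otimes> e_i\<close>: at this vector the form takes
      the value of the pairing of \<open>m\<close> with the coefficients of
      \<open>p\<close>.\<close>
    have "0 \<le> Re (qform ({..<d} \<times> ?J) H (\<lambda>(i, a). if a = Inl i then 1 else 0))"
      unfolding H_def
    proof (rule xy_convex_path_sums[OF p conv finI _ f_herm])
      fix k l a b assume "k < \<mu>" "l < \<mu>" "a \<in> ?J" "b \<in> ?J"
      moreover have "?I - ?J = Inr ` A" by auto
      ultimately show "(\<Sum>c\<in>?I - ?J. f (VarX k) a c * f (VarY l) c b) = 0"
        using f_xy by (auto simp: sum.reindex)
    qed auto
    also have "qform ({..<d} \<times> ?J) H (\<lambda>(i, a). if a = Inl i then 1 else 0) =
        qform ((\<lambda>i. (i, Inl i)) ` {..<d}) H (\<lambda>_. 1)"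
      by (subst qform_support[where D = "(\<lambda>i. (i, Inl i)) ` {..<d}"]) (auto intro!: qform_cong)
    also have "\<dots> = (\<Sum>i<d. \<Sum>j<d. H (i, Inl i) (j, Inl j))"
      unfolding qform_def by (subst sum.reindex, force simp: inj_on_def)+ (simp add: sum.reindex inj_on_def)
    also have "\<dots> = (\<Sum>i<d. \<Sum>j<d. \<Sum>w\<in>?S. m (w, i, j) * q (w, i, j))"
      unfolding H_def using diff by (intro sum.cong refl) (auto simp: q_def mult.commute intro!: sum.cong)
    also have "\<dots> = (\<Sum>w\<in>?S. \<Sum>i<d. \<Sum>j<d. m (w, i, j) * q (w, i, j))"
      by (subst sum.swap, subst (2) sum.swap) (rule refl)
    also have "\<dots> = (\<Sum>c\<in>?S \<times> {..<d} \<times> {..<d}. m c * q c)"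
      by (simp add: sum.cartesian_product case_prod_unfold)
    \<comment> \<open>From the support of \<open>p\<close> to the classes: the terms dropped belong
      to pencil words, where \<open>m\<close> vanishes; the terms added afterwards belong to zeros
      of \<open>q\<close>.\<close>
    also have "\<dots> = (\<Sum>c\<in>?C \<inter> (?S \<times> {..<d} \<times> {..<d}). m c * q c)"
    proof (rule sum.mono_neutral_right)
      show "\<forall>c\<in>?S \<times> {..<d} \<times> {..<d} - ?C \<inter> (?S \<times> {..<d} \<times> {..<d}). m c * q c = 0"
      proof
        fix c assume c: "c \<in> ?S \<times> {..<d} \<times> {..<d} - ?C \<inter> (?S \<times> {..<d} \<times> {..<d})"
        obtain w i j where cw: "c = (w, i, j)" by (cases c)
        have w: "p w \<noteq> 0\<^sub>m d d" and ij: "i < d" "j < d" and nC: "(w, i, j) \<notin> ?C"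
          using c unfolding cw by blast+
        have "w \<in> pencil_words \<mu>"
        proof (rule ccontr)
          assume np: "w \<notin> pencil_words \<mu>"
          obtain s t where "s \<in> ?P" "t \<in> ?P" "w = rev s @ t"
            using xy_convex_support[OF p herm conv w np] by blast
          then have "(w, i, j) = cls (s, i) (t, j)" "(s, i) \<in> A" "(t, j) \<in> A"
            using ij by (auto simp: cls_def A_def)
          then have "(w, i, j) \<in> (\<lambda>(a, b). cls a b) ` (A \<times> A)"
            by (intro image_eqI[of _ _ "((s, i), (t, j))"]) auto
          then show False using nC np by (simp add: Z_def)
        qed
        then show "m c * q c = 0" using m_pencil cw by simp
      qed
    qed (use finS in auto)
    also have "\<dots> = (\<Sum>c\<in>?C. m c * q c)"
    proof (rule sum.mono_neutral_left)
      show "\<forall>c\<in>?C - ?C \<inter> (?S \<times> {..<d} \<times> {..<d}). m c * q c = 0"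
      proof
        fix c assume c: "c \<in> ?C - ?C \<inter> (?S \<times> {..<d} \<times> {..<d})"
        obtain w i j where cw: "c = (w, i, j)" by (cases c)
        have "\<not> (i < d \<and> j < d \<and> p w \<noteq> 0\<^sub>m d d)" using c unfolding cw by blast
        then have "q c = 0" by (auto simp: q_def cw)
        then show "m c * q c = 0" by simp
      qed
    qed (use finA in auto)
    finally show "0 \<le> Re (\<Sum>c\<in>?C. m c * q c)" .
  qed (rule that)
  obtain B where B: "\<And>a b. a \<in> A \<Longrightarrow> b \<in> A \<Longrightarrow> G a b = (\<Sum>c\<in>A. cnj (B c a) * B c b)"
    using psd_on_factorization[OF finA G] by blast
  show thesis
  proof (rule that)
    fix w i j assume w: "w \<notin> pencil_words \<mu>" and ij: "i < d" "j < d"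
    let ?K = "{k. k \<le> length w \<and> rev (take k w) \<in> ?P \<and> drop k w \<in> ?P}"
    let ?cell = "{(a, b)\<in>A \<times> A. cls a b = (w, i, j)}"
    have "(\<Sum>k\<in>?K. \<Sum>c\<in>A. cnj (B c (rev (take k w), i)) * B c (drop k w, j)) =
        (\<Sum>k\<in>?K. G (rev (take k w), i) (drop k w, j))"
      using ij by (intro sum.cong refl B[symmetric]) (auto simp: A_def)
    \<comment> \<open>The pairs in a class correspond to the positions at which \<open>w\<close> can
      be cut into two indices.\<close>
    also have "\<dots> = (\<Sum>(a, b)\<in>?cell. G a b)"
      by (rule sum.reindex_bij_witness[of _ "\<lambda>(a, b). length (fst a)"
            "\<lambda>k. ((rev (take k w), i), (drop k w, j))"]) (use ij in \<open>auto simp: A_def cls_def\<close>)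
    also have "\<dots> = p w $$ (i, j)"
    proof (cases "?cell = {}")
      case False
      then have "(w, i, j) \<in> ?C" using w by (force simp: Z_def)
      then show ?thesis using G_cls ij by (simp add: q_def)
    next
      \<comment> \<open>\<open>w\<close> cannot be cut into two indices, so the right-hand side is
        an empty sum, and the description of the support gives \<open>p w = 0\<close>.\<close>
      case True
      have "p w = 0\<^sub>m d d"
      proof (rule ccontr)
        assume "p w \<noteq> 0\<^sub>m d d"
        then obtain s t where "s \<in> ?P" "t \<in> ?P" "w = rev s @ t"
          using xy_convex_support[OF p herm conv _ w] by blast
        then have "((s, i), (t, j)) \<in> ?cell" using ij by (auto simp: A_def cls_def)
        then show False using True by blast
      qed
      then show ?thesis unfolding True using ij by simp
    qed
    finally show "p w $$ (i, j) = (\<Sum>k\<in>?K. \<Sum>c\<in>A. cnj (B c (rev (take k w), i)) * B c (drop k w, j))"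
      by simp
  qed
qed

subsection \<open>Evaluation is a homomorphism\<close>

lemma mat_adjoint_adjoint [simp]: "mat_adjoint (mat_adjoint A) = (A :: complex mat)"
  by (rule eq_matI) auto

lemma mat_adjoint_mult:
  fixes A B :: "complex mat"
  assumes "A \<in> carrier_mat n k" "B \<in> carrier_mat k m"
  shows "mat_adjoint (A * B) = mat_adjoint B * mat_adjoint A"
proof (rule eq_matI)
  fix i j assume "i < dim_row (mat_adjoint B * mat_adjoint A)" "j < dim_col (mat_adjoint B * mat_adjoint A)"
  then have ij: "i < m" "j < n" using assms by auto
  have "mat_adjoint (A * B) $$ (i, j) = cnj (\<Sum>c<k. A $$ (j, c) * B $$ (c, i))"
    using assms ij by (simp add: mult_index_sum[OF assms, symmetric] del: index_mult_mat(1))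
  also have "\<dots> = (\<Sum>c<k. mat_adjoint B $$ (i, c) * mat_adjoint A $$ (c, j))"
    using assms ij by (simp add: mult.commute)
  also have "\<dots> = (mat_adjoint B * mat_adjoint A) $$ (i, j)"
    by (rule mult_index_sum[symmetric]) (use assms ij in auto)
  finally show "mat_adjoint (A * B) $$ (i, j) = (mat_adjoint B * mat_adjoint A) $$ (i, j)" .
qed (use assms in auto)

lemma fpolysI:
  assumes "\<And>w. p w \<in> carrier_mat r c" "finite W" "W \<subseteq> words \<mu>" "\<And>w. w \<notin> W \<Longrightarrow> p w = 0\<^sub>m r c"
  shows "p \<in> fpolys \<mu> r c"
proof -
  have "{w. p w \<noteq> 0\<^sub>m r c} \<subseteq> W" using assms(4) by blast
  then show ?thesis unfolding fpolys_def using assms finite_subset by blast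
qed

lemma fpolys_support:
  "p \<in> fpolys \<mu> r c \<Longrightarrow> \<exists>W. finite W \<and> W \<subseteq> words \<mu> \<and> (\<forall>w. w \<notin> W \<longrightarrow> p w = 0\<^sub>m r c)"
  unfolding fpolys_def by blast

lemma fpolys_eqI:
  assumes "p \<in> fpolys \<mu> r c" "q \<in> fpolys \<mu> r c"
    "\<And>w i j. i < r \<Longrightarrow> j < c \<Longrightarrow> p w $$ (i, j) = q w $$ (i, j)"
  shows "p = q"
  using fpolys_dim[OF assms(1)] fpolys_dim[OF assms(2)] assms(3) by (intro ext eq_matI) simp_all

lemma rev_words [simp]: "rev w \<in> words \<mu> \<longleftrightarrow> w \<in> words \<mu>"
  by (simp add: words_def)

lemma append_words [simp]: "u @ v \<in> words \<mu> \<longleftrightarrow> u \<in> words \<mu> \<and> v \<in> words \<mu>"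
  by (auto simp: words_def)

lemma fp_add_fpolys:
  assumes p: "p \<in> fpolys \<mu> r c" and q: "q \<in> fpolys \<mu> r c"
  shows "fp_add p q \<in> fpolys \<mu> r c"
proof -
  obtain W where "finite W" "W \<subseteq> words \<mu>" "\<And>w. w \<notin> W \<Longrightarrow> p w = 0\<^sub>m r c" using fpolys_support[OF p] by blast
  moreover obtain W' where "finite W'" "W' \<subseteq> words \<mu>" "\<And>w. w \<notin> W' \<Longrightarrow> q w = 0\<^sub>m r c"
    using fpolys_support[OF q] by blast
  ultimately show ?thesis
    using fpolys_carrier[OF p] fpolys_carrier[OF q]
    by (intro fpolysI[of _ _ _ "W \<union> W'"]) (auto simp: fp_add_def)
qed

lemma fp_uminus_fpolys:
  assumes p: "p \<in> fpolys \<mu> r c"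
  shows "fp_uminus p \<in> fpolys \<mu> r c"
proof -
  obtain W where "finite W" "W \<subseteq> words \<mu>" "\<And>w. w \<notin> W \<Longrightarrow> p w = 0\<^sub>m r c" using fpolys_support[OF p] by blast
  then show ?thesis
    using fpolys_carrier[OF p] by (intro fpolysI[of _ _ _ W]) (auto simp: fp_uminus_def)
qed

lemma fp_minus_fpolys:
  assumes p: "p \<in> fpolys \<mu> r c" and q: "q \<in> fpolys \<mu> r c"
  shows "fp_minus p q \<in> fpolys \<mu> r c"
proof -
  obtain W where "finite W" "W \<subseteq> words \<mu>" "\<And>w. w \<notin> W \<Longrightarrow> p w = 0\<^sub>m r c" using fpolys_support[OF p] by blast
  moreover obtain W' where "finite W'" "W' \<subseteq> words \<mu>" "\<And>w. w \<notin> W' \<Longrightarrow> q w = 0\<^sub>m r c"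
    using fpolys_support[OF q] by blast
  ultimately show ?thesis
    using fpolys_carrier[OF p] fpolys_carrier[OF q]
    by (intro fpolysI[of _ _ _ "W \<union> W'"]) (auto simp: fp_minus_def intro!: minus_carrier_mat)
qed

lemma fp_star_fpolys:
  assumes p: "p \<in> fpolys \<mu> r c"
  shows "fp_star p \<in> fpolys \<mu> c r"
proof -
  obtain W where W: "finite W" "W \<subseteq> words \<mu>" "\<And>w. w \<notin> W \<Longrightarrow> p w = 0\<^sub>m r c"
    using fpolys_support[OF p] by blast
  have "fp_star p w = 0\<^sub>m c r" if "w \<notin> rev ` W" for w
  proof -
    have "rev w \<notin> W" using that by (metis image_eqI rev_rev_ident)
    then have "fp_star p w = mat_adjoint (0\<^sub>m r c)" using W by (simp add: fp_star_def)
    then show ?thesis by (auto intro!: eq_matI)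
  qed
  then show ?thesis
    using W fpolys_carrier[OF p] by (intro fpolysI[of _ _ _ "rev ` W"]) (auto simp: fp_star_def)
qed

lemma fp_one_fpolys: "fp_one N \<in> fpolys \<mu> N N"
  by (rule fpolysI[of _ _ _ "{[]}"]) (auto simp: fp_one_def words_def)

lemma fp_star_index:
  assumes "p \<in> fpolys \<mu> r c" "i < c" "j < r"
  shows "fp_star p w $$ (i, j) = cnj (p (rev w) $$ (j, i))"
  using assms by (simp add: fp_star_def)

lemma fp_mult_index:
  assumes p: "p \<in> fpolys \<mu> r k" and q: "q \<in> fpolys \<mu> k c" and ij: "i < r" "j < c"
  shows "fp_mult p q w $$ (i, j) =
    (\<Sum>l\<le>length w. \<Sum>e<k. p (take l w) $$ (i, e) * q (drop l w) $$ (e, j))"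
proof -
  have "fp_mult p q w $$ (i, j) = (\<Sum>l\<le>length w. (p (take l w) * q (drop l w)) $$ (i, j))"
    using p q ij by (simp add: fp_mult_def del: index_mult_mat(1))
  also have "\<dots> = (\<Sum>l\<le>length w. \<Sum>e<k. p (take l w) $$ (i, e) * q (drop l w) $$ (e, j))"
    by (intro sum.cong refl mult_index_sum[OF fpolys_carrier[OF p] fpolys_carrier[OF q] ij])
  finally show ?thesis .
qed

lemma fp_mult_fpolys:
  assumes p: "p \<in> fpolys \<mu> r k" and q: "q \<in> fpolys \<mu> k c"
  shows "fp_mult p q \<in> fpolys \<mu> r c"
proof -
  obtain W where W: "finite W" "W \<subseteq> words \<mu>" "\<And>w. w \<notin> W \<Longrightarrow> p w = 0\<^sub>m r k"
    using fpolys_support[OF p] by blast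
  obtain W' where W': "finite W'" "W' \<subseteq> words \<mu>" "\<And>w. w \<notin> W' \<Longrightarrow> q w = 0\<^sub>m k c"
    using fpolys_support[OF q] by blast
  have dim: "fp_mult p q w \<in> carrier_mat r c" for w using p q by (simp add: fp_mult_def)
  have "fp_mult p q w = 0\<^sub>m r c" if w: "w \<notin> (\<lambda>(u, v). u @ v) ` (W \<times> W')" for w
  proof (rule eq_matI)
    fix i j assume "i < dim_row (0\<^sub>m r c)" "j < dim_col (0\<^sub>m r c)"
    then have ij: "i < r" "j < c" by auto
    have "p (take l w) $$ (i, e) * q (drop l w) $$ (e, j) = 0" if e: "e < k" for l e
    proof -
      have "take l w \<notin> W \<or> drop l w \<notin> W'"
        using w by (auto simp: image_iff) (metis append_take_drop_id)
      then show ?thesis using W(3) W'(3) ij e by auto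
    qed
    then have "fp_mult p q w $$ (i, j) = 0"
      unfolding fp_mult_index[OF p q ij] by (intro sum.neutral ballI) auto
    then show "fp_mult p q w $$ (i, j) = 0\<^sub>m r c $$ (i, j)" using ij by simp
  qed (use dim[of w] in auto)
  then show ?thesis
    using W W' dim by (intro fpolysI[of _ _ _ "(\<lambda>(u, v). u @ v) ` (W \<times> W')"]) auto
qed

lemma fp_block_fpolys:
  assumes A: "A \<in> fpolys \<mu> a b" and B: "B \<in> fpolys \<mu> a c"
    and C: "C \<in> fpolys \<mu> e b" and D: "D \<in> fpolys \<mu> e c"
  shows "fp_block A B C D \<in> fpolys \<mu> (a + e) (b + c)"
proof -
  let ?W = "{w. A w \<noteq> 0\<^sub>m a b} \<union> {w. B w \<noteq> 0\<^sub>m a c} \<union> {w. C w \<noteq> 0\<^sub>m e b} \<union> {w. D w \<noteq> 0\<^sub>m e c}"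
  show ?thesis
  proof (rule fpolysI[of _ _ _ ?W])
    show "fp_block A B C D w \<in> carrier_mat (a + e) (b + c)" for w
      using fpolys_carrier[OF A] fpolys_carrier[OF D] by (simp add: fp_block_def)
    show "finite ?W" using A B C D by (auto simp: fpolys_def)
    show "?W \<subseteq> words \<mu>" using A B C D by (auto simp: fpolys_def)
    show "fp_block A B C D w = 0\<^sub>m (a + e) (b + c)" if "w \<notin> ?W" for w
      using that by (auto simp: fp_block_def intro!: eq_matI)
  qed
qed

lemma sum_div_mod:
  fixes h :: "nat \<Rightarrow> nat \<Rightarrow> complex"
  shows "(\<Sum>x<k * n. h (x div n) (x mod n)) = (\<Sum>e<k. \<Sum>c<n. h e c)"
proof -
  have "bij_betw (\<lambda>x. (x div n, id (x mod n))) {..<k * n} ({..<k} \<times> {..<n})"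
    by (rule bij_betw_div_mod[OF bij_betw_id])
  from sum.reindex_bij_betw[OF this, of "\<lambda>(e, c). h e c"] show ?thesis
    by (simp add: sum.cartesian_product)
qed

text \<open>Concatenation identifies pairs of a word and a cut position with pairs of words. A word
  \<open>u @ v\<close> also has cuts outside of \<open>U \<times> V\<close>, and there
  \<open>F\<close> vanishes.\<close>

lemma sum_splittings:
  fixes F :: "'a list \<Rightarrow> 'a list \<Rightarrow> complex"
  assumes U: "finite U" and V: "finite V" and F: "\<And>u v. u \<notin> U \<or> v \<notin> V \<Longrightarrow> F u v = 0"
  shows "(\<Sum>w\<in>(\<lambda>(u, v). u @ v) ` (U \<times> V). \<Sum>l\<le>length w. F (take l w) (drop l w)) =
    (\<Sum>u\<in>U. \<Sum>v\<in>V. F u v)"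
proof -
  define W where "W = (\<lambda>(u, v). u @ v) ` (U \<times> V)"
  have W: "finite W" "\<And>u v. u \<in> U \<Longrightarrow> v \<in> V \<Longrightarrow> u @ v \<in> W" using U V by (auto simp: W_def)
  have "(\<Sum>w\<in>W. \<Sum>l\<le>length w. F (take l w) (drop l w)) =
      (\<Sum>(w, l)\<in>Sigma W (\<lambda>w. {..length w}). F (take l w) (drop l w))"
    using W by (subst sum.Sigma) auto
  also have "\<dots> = (\<Sum>(u, v)\<in>{(u, v). u @ v \<in> W}. F u v)"
    by (rule sum.reindex_bij_witness[of _ "\<lambda>(u, v). (u @ v, length u)" "\<lambda>(w, l). (take l w, drop l w)"])
      auto
  also have "\<dots> = (\<Sum>(u, v)\<in>U \<times> V. F u v)"
  proof (rule sum.mono_neutral_right)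
    show "finite {(u, v). u @ v \<in> W}"
    proof (rule finite_subset)
      show "{(u, v). u @ v \<in> W} \<subseteq> (\<lambda>(w, l). (take l w, drop l w)) ` Sigma W (\<lambda>w. {..length w})"
      proof
        fix x assume "x \<in> {(u, v). u @ v \<in> W}"
        then obtain u v where x: "x = (u, v)" and uv: "u @ v \<in> W" by blast
        show "x \<in> (\<lambda>(w, l). (take l w, drop l w)) ` Sigma W (\<lambda>w. {..length w})"
          by (rule image_eqI[of _ _ "(u @ v, length u)"]) (use x uv in simp_all)
      qed
      show "finite ((\<lambda>(w, l). (take l w, drop l w)) ` Sigma W (\<lambda>w. {..length w}))"
        using W by auto
    qed
    show "U \<times> V \<subseteq> {(u, v). u @ v \<in> W}" using W by auto
    show "\<forall>x\<in>{(u, v). u @ v \<in> W} - U \<times> V. (case x of (u, v) \<Rightarrow> F u v) = 0" using F by auto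
  qed
  finally show ?thesis by (simp add: sum.cartesian_product W_def)
qed

section \<open>Evaluation at a fixed pair of hermitian tuples\<close>

context
  fixes \<mu> n :: nat and X Y :: "nat \<Rightarrow> complex mat"
  assumes X: "X \<in> hermitian_tuples \<mu> n" and Y: "Y \<in> hermitian_tuples \<mu> n"
begin

lemma word_eval_carrier_words:
  "w \<in> words \<mu> \<Longrightarrow> word_eval n X Y w \<in> carrier_mat n n"
  using letter_eval_hermitian[OF X Y] hermitian_mats_carrier by (intro word_eval_carrier) blast

lemma word_eval_append:
  assumes "u \<in> words \<mu>" "v \<in> words \<mu>"
  shows "word_eval n X Y (u @ v) = word_eval n X Y u * word_eval n X Y v"
  using assms
proof (induction u)
  case Nil
  then show ?case using word_eval_carrier_words[of v] by (simp add: word_eval_def)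
next
  case (Cons l u)
  then have u: "u \<in> words \<mu>" and l: "[l] \<in> words \<mu>" by (auto simp: words_def)
  have "letter_eval X Y l \<in> carrier_mat n n"
    using letter_eval_hermitian[OF X Y l] hermitian_mats_carrier by simp
  then show ?case
    using Cons.IH[OF u] Cons.prems word_eval_carrier_words[OF u] word_eval_carrier_words[of v]
    by (simp add: word_eval_def assoc_mult_mat[of _ n n _ n _ n])
qed

lemma word_eval_rev:
  "w \<in> words \<mu> \<Longrightarrow> word_eval n X Y (rev w) = mat_adjoint (word_eval n X Y w)"
proof (induction w)
  case Nil
  show ?case by (auto simp: word_eval_def intro!: eq_matI)
next
  case (Cons l w)
  then have w: "w \<in> words \<mu>" and l: "[l] \<in> words \<mu>" by (auto simp: words_def)
  have L: "letter_eval X Y l \<in> carrier_mat n n" "mat_adjoint (letter_eval X Y l) = letter_eval X Y l"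
    using letter_eval_hermitian[OF X Y l] by (auto simp: hermitian_mats_def)
  have "word_eval n X Y (rev (l # w)) = word_eval n X Y (rev w) * word_eval n X Y [l]"
    using w l by (simp add: word_eval_append)
  also have "word_eval n X Y [l] = mat_adjoint (letter_eval X Y l)"
    using L by (simp add: word_eval_def)
  also have "word_eval n X Y (rev w) = mat_adjoint (word_eval n X Y w)" by (rule Cons.IH[OF w])
  also have "mat_adjoint (word_eval n X Y w) * mat_adjoint (letter_eval X Y l) =
      mat_adjoint (word_eval n X Y (l # w))"
    using mat_adjoint_mult[OF L(1) word_eval_carrier_words[OF w]] by (simp add: word_eval_def)
  finally show ?case .
qed

lemma fp_eval_add:
  assumes p: "p \<in> fpolys \<mu> r c" and q: "q \<in> fpolys \<mu> r c"
  shows "fp_eval n (fp_add p q) X Y = fp_eval n p X Y + fp_eval n q X Y"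
proof (rule eq_matI)
  fix s t assume "s < dim_row (fp_eval n p X Y + fp_eval n q X Y)"
    "t < dim_col (fp_eval n p X Y + fp_eval n q X Y)"
  then have st: "s < r * n" "t < c * n" using fp_eval_carrier[OF q, of n X Y] by auto
  have div: "s div n < r" "t div n < c" using st by (auto simp: less_mult_imp_div_less)
  let ?W = "{w. p w \<noteq> 0\<^sub>m r c} \<union> {w. q w \<noteq> 0\<^sub>m r c} \<union> {w. fp_add p q w \<noteq> 0\<^sub>m r c}"
  have fin: "finite ?W" using p q fp_add_fpolys[OF p q] by (simp add: fpolys_finite)
  have "fp_eval n (fp_add p q) X Y $$ (s, t) = fp_eval n p X Y $$ (s, t) + fp_eval n q X Y $$ (s, t)"
    using fp_eval_index[OF p X Y fin _ st] fp_eval_index[OF q X Y fin _ st]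
      fp_eval_index[OF fp_add_fpolys[OF p q] X Y fin _ st] div p q
    by (simp add: fp_add_def sum.distrib distrib_right le_supI1 le_supI2)
  then show "fp_eval n (fp_add p q) X Y $$ (s, t) = (fp_eval n p X Y + fp_eval n q X Y) $$ (s, t)"
    using st fp_eval_carrier[OF q, of n X Y] by simp
qed (use fp_eval_carrier[OF q, of n X Y] fp_eval_carrier[OF fp_add_fpolys[OF p q], of n X Y] in auto)

lemma fp_eval_uminus:
  assumes p: "p \<in> fpolys \<mu> r c"
  shows "fp_eval n (fp_uminus p) X Y = - fp_eval n p X Y"
proof (rule eq_matI)
  fix s t assume "s < dim_row (- fp_eval n p X Y)" "t < dim_col (- fp_eval n p X Y)"
  then have st: "s < r * n" "t < c * n" using fp_eval_carrier[OF p, of n X Y] by auto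
  have div: "s div n < r" "t div n < c" using st by (auto simp: less_mult_imp_div_less)
  let ?W = "{w. p w \<noteq> 0\<^sub>m r c} \<union> {w. fp_uminus p w \<noteq> 0\<^sub>m r c}"
  have fin: "finite ?W" using p fp_uminus_fpolys[OF p] by (simp add: fpolys_finite)
  show "fp_eval n (fp_uminus p) X Y $$ (s, t) = (- fp_eval n p X Y) $$ (s, t)"
    using fp_eval_index[OF p X Y fin _ st] fp_eval_index[OF fp_uminus_fpolys[OF p] X Y fin _ st]
      div p st fp_eval_carrier[OF p, of n X Y]
    by (simp add: fp_uminus_def sum_negf)
qed (use fp_eval_carrier[OF p, of n X Y] fp_eval_carrier[OF fp_uminus_fpolys[OF p], of n X Y] in auto)

lemma fp_eval_star:
  assumes p: "p \<in> fpolys \<mu> r c"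
  shows "fp_eval n (fp_star p) X Y = mat_adjoint (fp_eval n p X Y)"
proof (rule eq_matI)
  fix s t assume "s < dim_row (mat_adjoint (fp_eval n p X Y))" "t < dim_col (mat_adjoint (fp_eval n p X Y))"
  then have st: "s < c * n" "t < r * n" using fp_eval_carrier[OF p, of n X Y] by auto
  have n: "0 < n" using st by (cases n) auto
  have div: "s div n < c" "t div n < r" using st by (auto simp: less_mult_imp_div_less)
  let ?S = "{w. p w \<noteq> 0\<^sub>m r c}"
  have fin: "finite ?S" by (rule fpolys_finite[OF p])
  have sub: "{w. fp_star p w \<noteq> 0\<^sub>m c r} \<subseteq> rev ` ?S"
  proof
    fix w assume w: "w \<in> {w. fp_star p w \<noteq> 0\<^sub>m c r}"
    have "p (rev w) \<noteq> 0\<^sub>m r c"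
    proof
      assume "p (rev w) = 0\<^sub>m r c"
      then have "fp_star p w = 0\<^sub>m c r" by (auto simp: fp_star_def intro!: eq_matI)
      then show False using w by simp
    qed
    then show "w \<in> rev ` ?S" by (intro image_eqI[of _ _ "rev w"]) auto
  qed
  have "fp_eval n (fp_star p) X Y $$ (s, t) = (\<Sum>w\<in>rev ` ?S.
      fp_star p w $$ (s div n, t div n) * word_eval n X Y w $$ (s mod n, t mod n))"
    by (rule fp_eval_index[OF fp_star_fpolys[OF p] X Y _ sub st]) (use fin in simp)
  also have "\<dots> = (\<Sum>w\<in>?S. fp_star p (rev w) $$ (s div n, t div n) *
      word_eval n X Y (rev w) $$ (s mod n, t mod n))"
    by (subst sum.reindex) (auto simp: inj_on_def)
  also have "\<dots> = (\<Sum>w\<in>?S. cnj (p w $$ (t div n, s div n) * word_eval n X Y w $$ (t mod n, s mod n)))"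
  proof (intro sum.cong refl)
    fix w assume "w \<in> ?S"
    then have w: "w \<in> words \<mu>" using fpolys_words[OF p] by simp
    show "fp_star p (rev w) $$ (s div n, t div n) * word_eval n X Y (rev w) $$ (s mod n, t mod n) =
        cnj (p w $$ (t div n, s div n) * word_eval n X Y w $$ (t mod n, s mod n))"
      using word_eval_carrier_words[OF w] n by (simp add: fp_star_index[OF p div] word_eval_rev[OF w])
  qed
  also have "\<dots> = cnj (fp_eval n p X Y $$ (t, s))"
    unfolding fp_eval_index[OF p X Y fin order_refl st(2,1)] cnj_sum ..
  also have "\<dots> = mat_adjoint (fp_eval n p X Y) $$ (s, t)"
    using st fp_eval_carrier[OF p, of n X Y] by simp
  finally show "fp_eval n (fp_star p) X Y $$ (s, t) = mat_adjoint (fp_eval n p X Y) $$ (s, t)" .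
qed (use fp_eval_carrier[OF p, of n X Y] fp_eval_carrier[OF fp_star_fpolys[OF p], of n X Y] in auto)

text \<open>The sum over cuts becomes a double sum over words, the evaluated word factors at the
  cut, and the inner indices \<open>e\<close> of the coefficients and \<open>c\<close> of the
  matrices recombine to one index of the Kronecker product.\<close>

lemma fp_eval_mult:
  assumes p: "p \<in> fpolys \<mu> r k" and q: "q \<in> fpolys \<mu> k c"
  shows "fp_eval n (fp_mult p q) X Y = fp_eval n p X Y * fp_eval n q X Y"
proof (rule eq_matI)
  note cp = fp_eval_carrier[OF p, of n X Y] and cq = fp_eval_carrier[OF q, of n X Y]
  fix s t assume "s < dim_row (fp_eval n p X Y * fp_eval n q X Y)"
    "t < dim_col (fp_eval n p X Y * fp_eval n q X Y)"
  then have st: "s < r * n" "t < c * n" using cp cq by auto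
  have n: "0 < n" using st by (cases n) auto
  define S T a b where "S = s div n" and "T = t div n" and "a = s mod n" and "b = t mod n"
  have div: "S < r" "T < c" "a < n" "b < n"
    using st n by (auto simp: less_mult_imp_div_less S_def T_def a_def b_def)
  let ?U = "{w. p w \<noteq> 0\<^sub>m r k}" and ?V = "{w. q w \<noteq> 0\<^sub>m k c}"
  have fin: "finite ?U" "finite ?V" by (rule fpolys_finite[OF p], rule fpolys_finite[OF q])
  let ?W = "(\<lambda>(u, v). u @ v) ` (?U \<times> ?V)"
  let ?w = "\<lambda>u. word_eval n X Y u"
  define F where "F u v = (\<Sum>e<k. p u $$ (S, e) * q v $$ (e, T)) * ?w (u @ v) $$ (a, b)" for u v
  have F0: "F u v = 0" if "u \<notin> ?U \<or> v \<notin> ?V" for u v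
  proof -
    have "(\<Sum>e<k. p u $$ (S, e) * q v $$ (e, T)) = 0"
      using that div by (intro sum.neutral) auto
    then show ?thesis by (simp add: F_def)
  qed
  have sub: "{w. fp_mult p q w \<noteq> 0\<^sub>m r c} \<subseteq> ?W"
  proof
    fix w assume "w \<in> {w. fp_mult p q w \<noteq> 0\<^sub>m r c}"
    then have ne: "fp_mult p q w \<noteq> 0\<^sub>m r c" by simp
    show "w \<in> ?W"
    proof (rule ccontr)
      assume w: "w \<notin> ?W"
      have "take l w \<notin> ?U \<or> drop l w \<notin> ?V" for l
        using w image_eqI[of w "\<lambda>(u, v). u @ v" "(take l w, drop l w)" "?U \<times> ?V"] by auto
      then have z: "p (take l w) = 0\<^sub>m r k \<or> q (drop l w) = 0\<^sub>m k c" for l by blast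
      have "fp_mult p q w $$ (i, j) = 0" if ij: "i < r" "j < c" for i j
        unfolding fp_mult_index[OF p q ij]
      proof (intro sum.neutral ballI)
        fix l e assume "e \<in> {..<k}"
        then show "p (take l w) $$ (i, e) * q (drop l w) $$ (e, j) = 0"
          using z[of l] ij by auto
      qed
      then have "fp_mult p q w = 0\<^sub>m r c"
        using fp_mult_fpolys[OF p q] by (intro eq_matI) auto
      then show False using ne by simp
    qed
  qed
  have "fp_eval n (fp_mult p q) X Y $$ (s, t) = (\<Sum>w\<in>?W. fp_mult p q w $$ (S, T) * ?w w $$ (a, b))"
    unfolding S_def T_def a_def b_def
    by (rule fp_eval_index[OF fp_mult_fpolys[OF p q] X Y _ sub st]) (use fin in simp)
  also have "\<dots> = (\<Sum>w\<in>?W. \<Sum>l\<le>length w. F (take l w) (drop l w))"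
    by (intro sum.cong refl) (simp add: fp_mult_index[OF p q div(1,2)] F_def sum_distrib_right)
  also have "\<dots> = (\<Sum>u\<in>?U. \<Sum>v\<in>?V. F u v)" by (rule sum_splittings[OF fin F0])
  also have "\<dots> = (\<Sum>u\<in>?U. \<Sum>v\<in>?V. \<Sum>e<k. \<Sum>c<n. (p u $$ (S, e) * ?w u $$ (a, c)) * (q v $$ (e, T) * ?w v $$ (c, b)))"
  proof (intro sum.cong refl)
    fix u v assume "u \<in> ?U" "v \<in> ?V"
    then have uv: "u \<in> words \<mu>" "v \<in> words \<mu>" using fpolys_words[OF p] fpolys_words[OF q] by auto
    have "?w (u @ v) $$ (a, b) = (\<Sum>c<n. ?w u $$ (a, c) * ?w v $$ (c, b))"
      unfolding word_eval_append[OF uv]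
      by (rule mult_index_sum[OF word_eval_carrier_words[OF uv(1)] word_eval_carrier_words[OF uv(2)] div(3,4)])
    then show "F u v = (\<Sum>e<k. \<Sum>c<n. (p u $$ (S, e) * ?w u $$ (a, c)) * (q v $$ (e, T) * ?w v $$ (c, b)))"
      by (simp add: F_def sum_product mult_ac)
  qed
  also have "\<dots> = (\<Sum>e<k. \<Sum>c<n. \<Sum>u\<in>?U. \<Sum>v\<in>?V. (p u $$ (S, e) * ?w u $$ (a, c)) * (q v $$ (e, T) * ?w v $$ (c, b)))"
  proof -
    have "(\<Sum>u\<in>?U. \<Sum>v\<in>?V. \<Sum>e<k. \<Sum>c<n. H u v e c) = (\<Sum>e<k. \<Sum>c<n. \<Sum>u\<in>?U. \<Sum>v\<in>?V. H u v e c)"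
      for H :: "_ \<Rightarrow> _ \<Rightarrow> _ \<Rightarrow> _ \<Rightarrow> complex"
    proof -
      have "(\<Sum>u\<in>?U. \<Sum>v\<in>?V. \<Sum>e<k. \<Sum>c<n. H u v e c) = (\<Sum>u\<in>?U. \<Sum>e<k. \<Sum>v\<in>?V. \<Sum>c<n. H u v e c)"
        by (rule sum.cong[OF refl]) (rule sum.swap)
      also have "\<dots> = (\<Sum>e<k. \<Sum>u\<in>?U. \<Sum>v\<in>?V. \<Sum>c<n. H u v e c)" by (rule sum.swap)
      also have "\<dots> = (\<Sum>e<k. \<Sum>u\<in>?U. \<Sum>c<n. \<Sum>v\<in>?V. H u v e c)"
        by (rule sum.cong[OF refl])+ (rule sum.swap)
      also have "\<dots> = (\<Sum>e<k. \<Sum>c<n. \<Sum>u\<in>?U. \<Sum>v\<in>?V. H u v e c)"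
        by (rule sum.cong[OF refl]) (rule sum.swap)
      finally show ?thesis .
    qed
    then show ?thesis .
  qed
  also have "\<dots> = (\<Sum>e<k. \<Sum>c<n. (\<Sum>u\<in>?U. p u $$ (S, e) * ?w u $$ (a, c)) * (\<Sum>v\<in>?V. q v $$ (e, T) * ?w v $$ (c, b)))"
    by (simp add: sum_product)
  also have "\<dots> = (\<Sum>x<k * n. (\<Sum>u\<in>?U. p u $$ (S, x div n) * ?w u $$ (a, x mod n)) *
      (\<Sum>v\<in>?V. q v $$ (x div n, T) * ?w v $$ (x mod n, b)))"
    by (rule sum_div_mod[symmetric])
  also have "\<dots> = (\<Sum>x<k * n. fp_eval n p X Y $$ (s, x) * fp_eval n q X Y $$ (x, t))"
    using st by (intro sum.cong refl)
      (simp add: fp_eval_index[OF p X Y fin(1)] fp_eval_index[OF q X Y fin(2)] S_def T_def a_def b_def)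
  also have "\<dots> = (fp_eval n p X Y * fp_eval n q X Y) $$ (s, t)"
    by (rule mult_index_sum[OF cp cq st, symmetric])
  finally show "fp_eval n (fp_mult p q) X Y $$ (s, t) = (fp_eval n p X Y * fp_eval n q X Y) $$ (s, t)" .
qed (use fp_eval_carrier[OF p, of n X Y] fp_eval_carrier[OF q, of n X Y]
    fp_eval_carrier[OF fp_mult_fpolys[OF p q], of n X Y] in auto)

lemma fp_eval_one: "fp_eval n (fp_one N) X Y = 1\<^sub>m (N * n)"
proof (rule eq_matI)
  fix s t assume "s < dim_row (1\<^sub>m (N * n) :: complex mat)" "t < dim_col (1\<^sub>m (N * n) :: complex mat)"
  then have st: "s < N * n" "t < N * n" by auto
  have n: "0 < n" using st by (cases n) auto
  have div: "s div n < N" "t div n < N" using st by (auto simp: less_mult_imp_div_less)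
  have eq: "s = t \<longleftrightarrow> s div n = t div n \<and> s mod n = t mod n" by (metis div_mod_decomp)
  have "fp_eval n (fp_one N) X Y $$ (s, t) = (\<Sum>w\<in>{[]}.
      fp_one N w $$ (s div n, t div n) * word_eval n X Y w $$ (s mod n, t mod n))"
    by (rule fp_eval_index[OF fp_one_fpolys X Y _ _ st]) (auto simp: fp_one_def)
  then show "fp_eval n (fp_one N) X Y $$ (s, t) = 1\<^sub>m (N * n) $$ (s, t)"
    using st n div eq by (auto simp: fp_one_def word_eval_def)
qed (use fp_eval_carrier[OF fp_one_fpolys[of N \<mu>], of n X Y] in auto)

text \<open>Coefficients are the left Kronecker factor, so the blocks stay contiguous and no
  permutation of rows or columns enters.\<close>

lemma fp_eval_block:
  assumes A: "A \<in> fpolys \<mu> a b" and B: "B \<in> fpolys \<mu> a c"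
    and C: "C \<in> fpolys \<mu> e b" and D: "D \<in> fpolys \<mu> e c"
  shows "fp_eval n (fp_block A B C D) X Y =
    four_block_mat (fp_eval n A X Y) (fp_eval n B X Y) (fp_eval n C X Y) (fp_eval n D X Y)"
proof (rule eq_matI)
  note cs = fp_eval_carrier[OF A, of n X Y] fp_eval_carrier[OF D, of n X Y]
  note M = fp_block_fpolys[OF A B C D]
  fix s t assume "s < dim_row (four_block_mat (fp_eval n A X Y) (fp_eval n B X Y) (fp_eval n C X Y) (fp_eval n D X Y))"
    "t < dim_col (four_block_mat (fp_eval n A X Y) (fp_eval n B X Y) (fp_eval n C X Y) (fp_eval n D X Y))"
  then have st: "s < (a + e) * n" "t < (b + c) * n" using cs by (auto simp: distrib_right)
  have n: "0 < n" using st by (cases n) auto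
  have div: "s div n < a + e" "t div n < b + c" using st by (auto simp: less_mult_imp_div_less)
  let ?W = "{w. A w \<noteq> 0\<^sub>m a b} \<union> {w. B w \<noteq> 0\<^sub>m a c} \<union> {w. C w \<noteq> 0\<^sub>m e b} \<union> {w. D w \<noteq> 0\<^sub>m e c} \<union>
    {w. fp_block A B C D w \<noteq> 0\<^sub>m (a + e) (b + c)}"
  have fin: "finite ?W" using A B C D M by (simp add: fpolys_finite)
  have shift: "(x - k * n) div n = x div n - k" "(x - k * n) mod n = x mod n" "x - k * n < l * n"
    "k \<le> x div n"
    if "\<not> x < k * n" "x < (k + l) * n" for x k l
  proof -
    have "x = (x - k * n) + k * n" using that by simp
    then have "x div n = (x - k * n) div n + k" "x mod n = (x - k * n) mod n"
      using n by (metis div_mult_self3 add.commute bot_nat_0.not_eq_extremum, metis mod_mult_self1)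
    then show "(x - k * n) div n = x div n - k" "(x - k * n) mod n = x mod n" "k \<le> x div n" by simp_all
    show "x - k * n < l * n" using that by (simp add: distrib_right)
  qed
  have small: "x < k * n \<longleftrightarrow> x div n < k" for x k using n by (simp add: div_less_iff_less_mult)
  have idx: "fp_block A B C D w $$ (s div n, t div n) =
      (if s div n < a then if t div n < b then A w $$ (s div n, t div n) else B w $$ (s div n, t div n - b)
       else if t div n < b then C w $$ (s div n - a, t div n) else D w $$ (s div n - a, t div n - b))" for w
    unfolding fp_block_def using A D div by simp
  have "fp_eval n (fp_block A B C D) X Y $$ (s, t) =
      (\<Sum>w\<in>?W. fp_block A B C D w $$ (s div n, t div n) * word_eval n X Y w $$ (s mod n, t mod n))"
    by (rule fp_eval_index[OF M X Y fin _ st]) auto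
  also have "\<dots> = four_block_mat (fp_eval n A X Y) (fp_eval n B X Y) (fp_eval n C X Y) (fp_eval n D X Y) $$ (s, t)"
  proof -
    have "four_block_mat (fp_eval n A X Y) (fp_eval n B X Y) (fp_eval n C X Y) (fp_eval n D X Y) $$ (s, t) =
        (if s < a * n then if t < b * n then fp_eval n A X Y $$ (s, t) else fp_eval n B X Y $$ (s, t - b * n)
         else if t < b * n then fp_eval n C X Y $$ (s - a * n, t) else fp_eval n D X Y $$ (s - a * n, t - b * n))"
      using cs st by (simp add: distrib_right)
    moreover have "fp_eval n A X Y $$ (s, t) = (\<Sum>w\<in>?W. A w $$ (s div n, t div n) * word_eval n X Y w $$ (s mod n, t mod n))"
      if "s < a * n" "t < b * n"
      by (rule fp_eval_index[OF A X Y fin _ that]) auto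
    moreover have "fp_eval n B X Y $$ (s, t - b * n) =
        (\<Sum>w\<in>?W. B w $$ (s div n, t div n - b) * word_eval n X Y w $$ (s mod n, t mod n))"
      if "s < a * n" "\<not> t < b * n"
      using fp_eval_index[OF B X Y fin _ that(1) shift(3)[OF that(2) st(2)]]
      unfolding shift(1,2)[OF that(2) st(2)] by auto
    moreover have "fp_eval n C X Y $$ (s - a * n, t) =
        (\<Sum>w\<in>?W. C w $$ (s div n - a, t div n) * word_eval n X Y w $$ (s mod n, t mod n))"
      if "\<not> s < a * n" "t < b * n"
      using fp_eval_index[OF C X Y fin _ shift(3)[OF that(1) st(1)] that(2)]
      unfolding shift(1,2)[OF that(1) st(1)] by auto
    moreover have "fp_eval n D X Y $$ (s - a * n, t - b * n) =
        (\<Sum>w\<in>?W. D w $$ (s div n - a, t div n - b) * word_eval n X Y w $$ (s mod n, t mod n))"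
      if "\<not> s < a * n" "\<not> t < b * n"
      using fp_eval_index[OF D X Y fin _ shift(3)[OF that(1) st(1)] shift(3)[OF that(2) st(2)]]
      unfolding shift(1,2)[OF that(1) st(1)] shift(1,2)[OF that(2) st(2)] by auto
    ultimately show ?thesis unfolding idx small by presburger
  qed
  finally show "fp_eval n (fp_block A B C D) X Y $$ (s, t) =
    four_block_mat (fp_eval n A X Y) (fp_eval n B X Y) (fp_eval n C X Y) (fp_eval n D X Y) $$ (s, t)" .
qed (use fp_eval_carrier[OF A, of n X Y] fp_eval_carrier[OF D, of n X Y]
    fp_eval_carrier[OF fp_block_fpolys[OF A B C D], of n X Y] in \<open>auto simp: distrib_right\<close>)

lemma fp_eval_hermitian:
  assumes "p \<in> fpolys \<mu> d d" "fp_hermitian p"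
  shows "fp_eval n p X Y \<in> hermitian_mats (d * n)"
  using fp_eval_star[OF assms(1)] assms fp_eval_carrier[OF assms(1)]
  by (simp add: hermitian_mats_def fp_hermitian_def)

end

subsection \<open>Pencils\<close>

lemma xy_pencil_of_outside:
  assumes "w \<notin> pencil_words \<mu>"
  shows "xy_pencil_of \<mu> r c A0 A B C D w = 0\<^sub>m r c"
proof (cases "w \<in> words \<mu>")
  case True
  then obtain l u where w: "w = l # u" using assms by (cases w) (auto simp: pencil_words_def)
  then obtain k u' where u: "u = k # u'" using assms True by (cases u) (auto simp: pencil_words_def)
  show ?thesis
  proof (cases u')
    case Nil
    then have "is_x l = is_x k" using assms True w u by (auto simp: pencil_words_def)
    then show ?thesis using Nil w u by (cases l; cases k) (simp_all add: xy_pencil_of_def)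
  next
    case (Cons h t)
    then show ?thesis using w u by (cases l; cases k) (simp_all add: xy_pencil_of_def)
  qed
qed (simp add: xy_pencil_of_def)

text \<open>Trades the coefficient tuples for a condition on the support; up to sign the tuples are
  read off from the coefficients.\<close>

lemma xy_pencil_iff:
  "xy_pencil \<mu> r c L \<longleftrightarrow>
    (\<forall>w. L w \<in> carrier_mat r c) \<and> (\<forall>w. w \<notin> pencil_words \<mu> \<longrightarrow> L w = 0\<^sub>m r c)"
proof
  assume "xy_pencil \<mu> r c L"
  then obtain A0 A B C D where *: "A0 \<in> carrier_mat r c \<and>
      (\<forall>j<\<mu>. A j \<in> carrier_mat r c \<and> B j \<in> carrier_mat r c) \<and>
      (\<forall>i<\<mu>. \<forall>j<\<mu>. C i j \<in> carrier_mat r c \<and> D i j \<in> carrier_mat r c) \<and>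
      L = xy_pencil_of \<mu> r c A0 A B C D"
    unfolding xy_pencil_def by (elim exE) (rule that)
  then have c: "A0 \<in> carrier_mat r c"
      "\<And>j. j < \<mu> \<Longrightarrow> A j \<in> carrier_mat r c" "\<And>j. j < \<mu> \<Longrightarrow> B j \<in> carrier_mat r c"
      "\<And>i j. i < \<mu> \<Longrightarrow> j < \<mu> \<Longrightarrow> C i j \<in> carrier_mat r c"
      "\<And>i j. i < \<mu> \<Longrightarrow> j < \<mu> \<Longrightarrow> D i j \<in> carrier_mat r c"
    and L: "L = xy_pencil_of \<mu> r c A0 A B C D"
    by simp_all
  have zero: "L w = 0\<^sub>m r c" if "w \<notin> pencil_words \<mu>" for w
    unfolding L by (rule xy_pencil_of_outside[OF that])
  moreover have "L w \<in> carrier_mat r c" for w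
  proof (cases "w \<in> pencil_words \<mu>")
    case True
    then have w: "w \<in> words \<mu>" by (simp add: pencil_words_def)
    from True consider "w = []" | l where "w = [l]" | l k where "w = [l, k]" "is_x l \<noteq> is_x k"
      by (auto simp: pencil_words_def)
    then show ?thesis
    proof cases
      case 2
      then show ?thesis using w c by (cases l) (auto simp: L xy_pencil_of_def words_def)
    next
      case 3
      then show ?thesis using w c by (cases l; cases k) (auto simp: L xy_pencil_of_def words_def)
    qed (use c in \<open>auto simp: L xy_pencil_of_def words_def\<close>)
  qed (simp add: zero)
  ultimately show "(\<forall>w. L w \<in> carrier_mat r c) \<and> (\<forall>w. w \<notin> pencil_words \<mu> \<longrightarrow> L w = 0\<^sub>m r c)" by blast
next
  assume L: "(\<forall>w. L w \<in> carrier_mat r c) \<and> (\<forall>w. w \<notin> pencil_words \<mu> \<longrightarrow> L w = 0\<^sub>m r c)"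
  have "L = xy_pencil_of \<mu> r c (L []) (\<lambda>j. - L [VarX j]) (\<lambda>k. - L [VarY k])
      (\<lambda>i j. - L [VarX i, VarY j]) (\<lambda>i j. - L [VarY i, VarX j])"
  proof
    fix w
    have neg: "- (- L u) = L u" for u by (rule eq_matI) auto
    show "L w = xy_pencil_of \<mu> r c (L []) (\<lambda>j. - L [VarX j]) (\<lambda>k. - L [VarY k])
        (\<lambda>i j. - L [VarX i, VarY j]) (\<lambda>i j. - L [VarY i, VarX j]) w"
    proof (cases "w \<in> pencil_words \<mu>")
      case True
      then have "w \<in> words \<mu>" by (simp add: pencil_words_def)
      from True consider "w = []" | l where "w = [l]" | l k where "w = [l, k]" "is_x l \<noteq> is_x k"
        by (auto simp: pencil_words_def)
      then show ?thesis
      proof cases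
        case 2
        then show ?thesis using \<open>w \<in> words \<mu>\<close> neg by (cases l) (auto simp: xy_pencil_of_def)
      next
        case 3
        then show ?thesis using \<open>w \<in> words \<mu>\<close> neg by (cases l; cases k) (auto simp: xy_pencil_of_def)
      qed (auto simp: xy_pencil_of_def words_def)
    next
      case False
      then have "L w = 0\<^sub>m r c" using L by blast
      then show ?thesis using xy_pencil_of_outside[OF False] by simp
    qed
  qed
  then show "xy_pencil \<mu> r c L"
    unfolding xy_pencil_def using L by (intro exI conjI) auto
qed

lemma xy_pencil_fpolys: "xy_pencil \<mu> r c L \<Longrightarrow> L \<in> fpolys \<mu> r c"
  unfolding xy_pencil_iff
  by (rule fpolysI[OF _ finite_pencil_words]) (auto simp: pencil_words_def)

section \<open>Ampliations of an isometry and compression of pencils\<close>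

lemma kron_one_carrier: "V \<in> carrier_mat n m \<Longrightarrow> kron (1\<^sub>m d) V \<in> carrier_mat (d * n) (d * m)"
  by (simp add: kron_def)

lemma kron_one_index:
  assumes "V \<in> carrier_mat n m" "r < d * n" "s < d * m"
  shows "kron (1\<^sub>m d) V $$ (r, s) = (if r div n = s div m then V $$ (r mod n, s mod m) else 0)"
  using assms by (auto simp: kron_def less_mult_imp_div_less)

text \<open>Ampliations act blockwise, each \<open>n \<times> n\<close> block of \<open>T\<close>
  being compressed by \<open>V\<close>. The numbers \<open>r\<close> and \<open>c\<close> of blocks
  may differ, as for the rectangular pencil \<open>Lam\<close>.\<close>

lemma kron_one_sandwich_index:
  assumes V: "V \<in> carrier_mat n m" and T: "T \<in> carrier_mat (r * n) (c * n)"
    and st: "s < r * m" "t < c * m"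
  shows "(mat_adjoint (kron (1\<^sub>m r) V) * T * kron (1\<^sub>m c) V) $$ (s, t) =
    (\<Sum>a<n. \<Sum>b<n. cnj (V $$ (a, s mod m)) * T $$ (s div m * n + a, t div m * n + b) * V $$ (b, t mod m))"
proof -
  note K = kron_one_carrier[OF V]
  have m: "0 < m" using st by (cases m) auto
  have div: "s div m < r" "t div m < c" using st by (auto simp: less_mult_imp_div_less)
  have KT: "(mat_adjoint (kron (1\<^sub>m r) V) * T) $$ (s, y) =
      (\<Sum>a<n. cnj (V $$ (a, s mod m)) * T $$ (s div m * n + a, y))" if y: "y < c * n" for y
  proof -
    have "(mat_adjoint (kron (1\<^sub>m r) V) * T) $$ (s, y) =
        (\<Sum>x<r * n. mat_adjoint (kron (1\<^sub>m r) V) $$ (s, x) * T $$ (x, y))"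
      by (rule mult_index_sum[OF mat_adjoint_carrier[OF K] T st(1) y])
    also have "\<dots> = (\<Sum>x<r * n. (if x div n = s div m then cnj (V $$ (x mod n, s mod m)) else 0) *
        T $$ (x div n * n + x mod n, y))"
    proof (intro sum.cong refl)
      fix x assume "x \<in> {..<r * n}"
      then have x: "x < r * n" by simp
      then show "mat_adjoint (kron (1\<^sub>m r) V) $$ (s, x) * T $$ (x, y) =
          (if x div n = s div m then cnj (V $$ (x mod n, s mod m)) else 0) * T $$ (x div n * n + x mod n, y)"
        using K[of r] st kron_one_index[OF V x st(1)] by simp
    qed
    also have "\<dots> = (\<Sum>e<r. \<Sum>a<n. (if e = s div m then cnj (V $$ (a, s mod m)) else 0) * T $$ (e * n + a, y))"
      by (rule sum_div_mod)
    also have "\<dots> = (\<Sum>e<r. if e = s div m then \<Sum>a<n. cnj (V $$ (a, s mod m)) * T $$ (s div m * n + a, y) else 0)"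
      by (intro sum.cong refl) auto
    finally show ?thesis using div by simp
  qed
  have KTc: "mat_adjoint (kron (1\<^sub>m r) V) * T \<in> carrier_mat (r * m) (c * n)"
    using K[of r] T by auto
  have "(mat_adjoint (kron (1\<^sub>m r) V) * T * kron (1\<^sub>m c) V) $$ (s, t) =
      (\<Sum>y<c * n. (mat_adjoint (kron (1\<^sub>m r) V) * T) $$ (s, y) * kron (1\<^sub>m c) V $$ (y, t))"
    by (rule mult_index_sum[OF KTc K st])
  also have "\<dots> = (\<Sum>y<c * n. (\<Sum>a<n. cnj (V $$ (a, s mod m)) * T $$ (s div m * n + a, y div n * n + y mod n)) *
      (if y div n = t div m then V $$ (y mod n, t mod m) else 0))"
    by (intro sum.cong refl) (simp add: KT kron_one_index[OF V _ st(2)])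
  also have "\<dots> = (\<Sum>f<c. \<Sum>b<n. (\<Sum>a<n. cnj (V $$ (a, s mod m)) * T $$ (s div m * n + a, f * n + b)) *
      (if f = t div m then V $$ (b, t mod m) else 0))"
    by (rule sum_div_mod)
  also have "\<dots> = (\<Sum>f<c. if f = t div m then \<Sum>b<n. (\<Sum>a<n. cnj (V $$ (a, s mod m)) *
      T $$ (s div m * n + a, t div m * n + b)) * V $$ (b, t mod m) else 0)"
    by (intro sum.cong refl) auto
  also have "\<dots> = (\<Sum>b<n. \<Sum>a<n. cnj (V $$ (a, s mod m)) * T $$ (s div m * n + a, t div m * n + b) * V $$ (b, t mod m))"
    using div by (simp add: sum_distrib_right)
  also have "\<dots> = (\<Sum>a<n. \<Sum>b<n. cnj (V $$ (a, s mod m)) * T $$ (s div m * n + a, t div m * n + b) * V $$ (b, t mod m))"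
    by (rule sum.swap)
  finally show ?thesis .
qed

lemma div_mult_add_less: "x < r \<Longrightarrow> a < n \<Longrightarrow> x * n + a < r * (n :: nat)"
proof -
  assume "x < r" "a < n"
  then have "x * n + a < Suc x * n" by simp
  also have "\<dots> \<le> r * n" using \<open>x < r\<close> by (intro mult_right_mono) auto
  finally show ?thesis .
qed

lemma kron_one_isometry:
  assumes V: "V \<in> carrier_mat n m" and iso: "mat_adjoint V * V = 1\<^sub>m m"
  shows "mat_adjoint (kron (1\<^sub>m r) V) * kron (1\<^sub>m r) V = 1\<^sub>m (r * m)"
proof (rule eq_matI)
  note K = kron_one_carrier[OF V, of r]
  fix s t assume "s < dim_row (1\<^sub>m (r * m) :: complex mat)" "t < dim_col (1\<^sub>m (r * m) :: complex mat)"
  then have st: "s < r * m" "t < r * m" by auto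
  have m: "0 < m" using st by (cases m) auto
  have div: "s div m < r" "t div m < r" "s mod m < m" "t mod m < m"
    using st m by (auto simp: less_mult_imp_div_less)
  have eq: "s = t \<longleftrightarrow> s div m = t div m \<and> s mod m = t mod m" by (metis div_mod_decomp)
  have "(mat_adjoint (kron (1\<^sub>m r) V) * kron (1\<^sub>m r) V) $$ (s, t) =
      (mat_adjoint (kron (1\<^sub>m r) V) * 1\<^sub>m (r * n) * kron (1\<^sub>m r) V) $$ (s, t)"
    using K by (simp add: right_mult_one_mat[OF mat_adjoint_carrier])
  also have "\<dots> = (\<Sum>a<n. \<Sum>b<n. cnj (V $$ (a, s mod m)) *
      (1\<^sub>m (r * n) $$ (s div m * n + a, t div m * n + b)) * V $$ (b, t mod m))"
    by (rule kron_one_sandwich_index[OF V one_carrier_mat st])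
  also have "\<dots> = (\<Sum>a<n. \<Sum>b<n. if s div m = t div m \<and> a = b then cnj (V $$ (a, s mod m)) * V $$ (b, t mod m) else 0)"
  proof (intro sum.cong refl)
    fix a b assume "a \<in> {..<n}" "b \<in> {..<n}"
    then have ab: "a < n" "b < n" by auto
    have "s div m * n + a = t div m * n + b \<longleftrightarrow> s div m = t div m \<and> a = b"
    proof
      assume e: "s div m * n + a = t div m * n + b"
      have "(s div m * n + a) div n = s div m" "(t div m * n + b) div n = t div m"
        "(s div m * n + a) mod n = a" "(t div m * n + b) mod n = b" using ab by auto
      then show "s div m = t div m \<and> a = b" using e by metis
    qed auto
    then show "cnj (V $$ (a, s mod m)) * (1\<^sub>m (r * n) $$ (s div m * n + a, t div m * n + b)) * V $$ (b, t mod m) =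
        (if s div m = t div m \<and> a = b then cnj (V $$ (a, s mod m)) * V $$ (b, t mod m) else 0)"
      using div_mult_add_less[OF div(1) ab(1)] div_mult_add_less[OF div(2) ab(2)] by simp
  qed
  also have "\<dots> = (if s div m = t div m then \<Sum>a<n. cnj (V $$ (a, s mod m)) * V $$ (a, t mod m) else 0)"
    by simp
  also have "(\<Sum>a<n. cnj (V $$ (a, s mod m)) * V $$ (a, t mod m)) = (mat_adjoint V * V) $$ (s mod m, t mod m)"
    unfolding mult_index_sum[OF mat_adjoint_carrier[OF V] V div(3,4)]
    using V div by (intro sum.cong refl) simp
  finally show "(mat_adjoint (kron (1\<^sub>m r) V) * kron (1\<^sub>m r) V) $$ (s, t) = 1\<^sub>m (r * m) $$ (s, t)"
    unfolding iso using st eq div by simp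
qed (use kron_one_carrier[OF V, of r] in auto)

lemma mat_adjoint_compress:
  assumes V: "V \<in> carrier_mat n m" and T: "T \<in> carrier_mat n n"
  shows "mat_adjoint (compress V T) = compress V (mat_adjoint T)"
proof -
  have "mat_adjoint (compress V T) = mat_adjoint V * mat_adjoint (mat_adjoint V * T)"
    unfolding compress_def by (rule mat_adjoint_mult[OF _ V]) (use V T in auto)
  also have "mat_adjoint (mat_adjoint V * T) = mat_adjoint T * V"
    using mat_adjoint_mult[OF mat_adjoint_carrier[OF V] T] by simp
  also have "mat_adjoint V * (mat_adjoint T * V) = compress V (mat_adjoint T)"
    unfolding compress_def
    by (rule assoc_mult_mat[symmetric, OF mat_adjoint_carrier[OF V] mat_adjoint_carrier[OF T] V])
  finally show ?thesis .
qed

text \<open>Each word of a pencil commutes with the compression: the empty word as \<open>V\<close>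
  is an isometry, a letter by definition, \<open>x y\<close> by the condition on
  \<open>xy\<close>-pairs, and \<open>y x\<close> by the adjoint of that condition.\<close>

lemma xy_pencil_compress:
  assumes L: "xy_pencil \<mu> r c L" and pair: "xy_pair \<mu> n m X Y V"
  shows "fp_eval m L (\<lambda>j. compress V (X j)) (\<lambda>k. compress V (Y k)) =
    mat_adjoint (kron (1\<^sub>m r) V) * fp_eval n L X Y * kron (1\<^sub>m c) V"
proof -
  let ?X = "\<lambda>j. compress V (X j)" and ?Y = "\<lambda>k. compress V (Y k)"
  have n: "0 < n" "0 < m" and X: "X \<in> hermitian_tuples \<mu> n" and Y: "Y \<in> hermitian_tuples \<mu> n"
    and V: "V \<in> carrier_mat n m" and iso: "mat_adjoint V * V = 1\<^sub>m m"
    and xy: "\<And>i j. i < \<mu> \<Longrightarrow> j < \<mu> \<Longrightarrow> compress V (X i * Y j) = compress V (X i) * compress V (Y j)"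
    using pair by (auto simp: xy_pair_def)
  have Xc: "X j \<in> carrier_mat n n" "mat_adjoint (X j) = X j" if "j < \<mu>" for j
    using X that by (auto simp: hermitian_tuples_def hermitian_mats_def)
  have Yc: "Y j \<in> carrier_mat n n" "mat_adjoint (Y j) = Y j" if "j < \<mu>" for j
    using Y that by (auto simp: hermitian_tuples_def hermitian_mats_def)
  note adj = mat_adjoint_compress[OF V]
  have X': "?X \<in> hermitian_tuples \<mu> m" and Y': "?Y \<in> hermitian_tuples \<mu> m"
    using adj Xc Yc V by (auto simp: hermitian_tuples_def hermitian_mats_def)
  have yx: "compress V (Y j * X i) = compress V (Y j) * compress V (X i)" if "i < \<mu>" "j < \<mu>" for i j
  proof -
    have "compress V (Y j * X i) = compress V (mat_adjoint (X i * Y j))"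
      using mat_adjoint_mult[OF Xc(1)[OF that(1)] Yc(1)[OF that(2)]] Xc Yc that by simp
    also have "\<dots> = mat_adjoint (compress V (X i * Y j))"
      by (rule adj[symmetric]) (rule mult_carrier_mat[OF Xc(1)[OF that(1)] Yc(1)[OF that(2)]])
    also have "\<dots> = mat_adjoint (compress V (X i) * compress V (Y j))" using xy that by simp
    also have "\<dots> = mat_adjoint (compress V (Y j)) * mat_adjoint (compress V (X i))"
      by (rule mat_adjoint_mult[OF compress_carrier[OF V] compress_carrier[OF V]])
    finally show ?thesis using adj Xc Yc that by simp
  qed
  have letter: "letter_eval ?X ?Y l = compress V (letter_eval X Y l)" for l by (cases l) auto
  have letter_c: "letter_eval X Y l \<in> carrier_mat n n" if "letter_index l < \<mu>" for l
    using that Xc Yc by (cases l) auto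
  have word: "word_eval m ?X ?Y w = compress V (word_eval n X Y w)" if w: "w \<in> pencil_words \<mu>" for w
  proof -
    from w consider "w = []" | l where "w = [l]" | l k where "w = [l, k]" "is_x l \<noteq> is_x k"
      by (auto simp: pencil_words_def)
    then show ?thesis
    proof cases
      case 1
      then show ?thesis
        using V iso by (simp add: word_eval_def compress_def right_mult_one_mat[OF mat_adjoint_carrier])
    next
      case 2
      then have "letter_index l < \<mu>" using w by (auto simp: pencil_words_def words_def)
      then show ?thesis
        using 2 letter_c[of l] compress_carrier[OF V, of "letter_eval X Y l"]
        by (simp add: word_eval_def letter)
    next
      case 3
      then have l: "letter_index l < \<mu>" "letter_index k < \<mu>" using w by (auto simp: pencil_words_def words_def)
      then have "compress V (letter_eval X Y l * letter_eval X Y k) =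
          compress V (letter_eval X Y l) * compress V (letter_eval X Y k)"
        using 3 xy yx by (cases l; cases k) auto
      then show ?thesis
        using 3 l letter_c[of l] letter_c[of k] compress_carrier[OF V, of "letter_eval X Y k"]
        by (simp add: word_eval_def letter)
    qed
  qed
  have p: "L \<in> fpolys \<mu> r c" by (rule xy_pencil_fpolys[OF L])
  have sub: "{w. L w \<noteq> 0\<^sub>m r c} \<subseteq> pencil_words \<mu>" using L by (auto simp: xy_pencil_iff)
  note index = fp_eval_index[OF p _ _ finite_pencil_words sub]
  note K = kron_one_carrier[OF V]
  show ?thesis
  proof (rule eq_matI)
    fix s t assume "s < dim_row (mat_adjoint (kron (1\<^sub>m r) V) * fp_eval n L X Y * kron (1\<^sub>m c) V)"
      "t < dim_col (mat_adjoint (kron (1\<^sub>m r) V) * fp_eval n L X Y * kron (1\<^sub>m c) V)"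
    then have st: "s < r * m" "t < c * m" using K[of r] K[of c] by auto
    define S T a b where "S = s div m" and "T = t div m" and "a = s mod m" and "b = t mod m"
    have div: "S < r" "T < c" "a < m" "b < m"
      using st n by (auto simp: less_mult_imp_div_less S_def T_def a_def b_def)
    have inner: "fp_eval n L X Y $$ (S * n + a', T * n + b') =
        (\<Sum>w\<in>pencil_words \<mu>. L w $$ (S, T) * word_eval n X Y w $$ (a', b'))" if "a' < n" "b' < n" for a' b'
      unfolding index[OF X Y div_mult_add_less[OF div(1) that(1)] div_mult_add_less[OF div(2) that(2)]]
      using that by simp
    have "fp_eval m L ?X ?Y $$ (s, t) =
        (\<Sum>w\<in>pencil_words \<mu>. L w $$ (S, T) * word_eval m ?X ?Y w $$ (a, b))"
      unfolding index[OF X' Y' st] S_def T_def a_def b_def ..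
    also have "\<dots> = (\<Sum>w\<in>pencil_words \<mu>. \<Sum>a'<n. \<Sum>b'<n.
        cnj (V $$ (a', a)) * (L w $$ (S, T) * word_eval n X Y w $$ (a', b')) * V $$ (b', b))"
    proof (intro sum.cong refl)
      fix w assume w: "w \<in> pencil_words \<mu>"
      then have "word_eval n X Y w \<in> carrier_mat n n"
        by (intro word_eval_carrier_words[OF X Y]) (simp add: pencil_words_def)
      then show "L w $$ (S, T) * word_eval m ?X ?Y w $$ (a, b) = (\<Sum>a'<n. \<Sum>b'<n.
          cnj (V $$ (a', a)) * (L w $$ (S, T) * word_eval n X Y w $$ (a', b')) * V $$ (b', b))"
        by (simp add: word[OF w] compress_index[OF V _ div(3,4)] sum_distrib_left mult_ac)
    qed
    also have "\<dots> = (\<Sum>a'<n. \<Sum>w\<in>pencil_words \<mu>. \<Sum>b'<n.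
        cnj (V $$ (a', a)) * (L w $$ (S, T) * word_eval n X Y w $$ (a', b')) * V $$ (b', b))"
      by (rule sum.swap)
    also have "\<dots> = (\<Sum>a'<n. \<Sum>b'<n. \<Sum>w\<in>pencil_words \<mu>.
        cnj (V $$ (a', a)) * (L w $$ (S, T) * word_eval n X Y w $$ (a', b')) * V $$ (b', b))"
      by (rule sum.cong[OF refl]) (rule sum.swap)
    also have "\<dots> = (\<Sum>a'<n. \<Sum>b'<n. cnj (V $$ (a', a)) * fp_eval n L X Y $$ (S * n + a', T * n + b') * V $$ (b', b))"
      by (intro sum.cong refl) (simp add: inner sum_distrib_left sum_distrib_right)
    also have "\<dots> = (mat_adjoint (kron (1\<^sub>m r) V) * fp_eval n L X Y * kron (1\<^sub>m c) V) $$ (s, t)"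
      unfolding S_def T_def a_def b_def
      by (rule kron_one_sandwich_index[OF V fp_eval_carrier[OF p] st, symmetric])
    finally show "fp_eval m L ?X ?Y $$ (s, t) =
        (mat_adjoint (kron (1\<^sub>m r) V) * fp_eval n L X Y * kron (1\<^sub>m c) V) $$ (s, t)" .
  qed (use K[of r] K[of c] fp_eval_carrier[OF p, of m ?X ?Y] in auto)
qed

subsection \<open>Positivity\<close>

lemma adjoint_cscalar:
  fixes A :: "complex mat"
  assumes A: "A \<in> carrier_mat n m" and x: "x \<in> carrier_vec m" and y: "y \<in> carrier_vec n"
  shows "(A *\<^sub>v x) \<bullet>c y = x \<bullet>c (mat_adjoint A *\<^sub>v y)"
proof -
  have "(A *\<^sub>v x) \<bullet>c y = (\<Sum>i<n. (\<Sum>j<m. A $$ (i, j) * x $ j) * cnj (y $ i))"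
    using assms by (auto simp: scalar_prod_def lessThan_atLeast0 intro!: sum.cong)
  also have "\<dots> = (\<Sum>i<n. \<Sum>j<m. x $ j * (A $$ (i, j) * cnj (y $ i)))"
    by (simp add: sum_distrib_left sum_distrib_right mult_ac)
  also have "\<dots> = (\<Sum>j<m. \<Sum>i<n. x $ j * (A $$ (i, j) * cnj (y $ i)))" by (rule sum.swap)
  also have "\<dots> = x \<bullet>c (mat_adjoint A *\<^sub>v y)"
    using assms by (auto simp: scalar_prod_def lessThan_atLeast0 sum_distrib_left intro!: sum.cong)
  finally show ?thesis .
qed

lemma Re_cscalar_self: "0 \<le> Re (v \<bullet>c (v :: complex Matrix.vec))"
  by (simp add: scalar_prod_def sum_nonneg)

lemma psd_iff:
  assumes "T \<in> hermitian_mats n"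
  shows "psd T \<longleftrightarrow> (\<forall>v \<in> carrier_vec n. 0 \<le> Re ((T *\<^sub>v v) \<bullet>c v))"
  using assms hermitian_mats_carrier[OF assms] by (auto simp: psd_def)

lemma psd_adjoint_mult:
  fixes D :: "complex mat"
  assumes D: "D \<in> carrier_mat k m"
  shows "psd (mat_adjoint D * D)"
proof -
  have "mat_adjoint D * D \<in> hermitian_mats m"
    using mat_adjoint_mult[OF mat_adjoint_carrier[OF D] D] D by (auto simp: hermitian_mats_def)
  moreover have "0 \<le> Re (((mat_adjoint D * D) *\<^sub>v v) \<bullet>c v)" if v: "v \<in> carrier_vec m" for v
  proof -
    have Dv: "D *\<^sub>v v \<in> carrier_vec k" using D v by simp
    have "((mat_adjoint D * D) *\<^sub>v v) \<bullet>c v = (mat_adjoint D *\<^sub>v (D *\<^sub>v v)) \<bullet>c v"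
      using assoc_mult_mat_vec[OF mat_adjoint_carrier[OF D] D v] by simp
    also have "\<dots> = (D *\<^sub>v v) \<bullet>c (D *\<^sub>v v)"
      using adjoint_cscalar[OF mat_adjoint_carrier[OF D] Dv v] by simp
    finally show ?thesis using Re_cscalar_self by simp
  qed
  ultimately show ?thesis by (simp add: psd_iff)
qed

lemma mat_adjoint_minus:
  fixes A B :: "complex mat"
  assumes "A \<in> carrier_mat n m" "B \<in> carrier_mat n m"
  shows "mat_adjoint (A - B) = mat_adjoint A - mat_adjoint B"
  using assms by (intro eq_matI) auto

text \<open>\<open>1 - W W\<^sup>*\<close> is the projection onto the complement of the range of the isometry \<open>W\<close>.\<close>

lemma psd_projection_defect:
  fixes R W :: "complex mat"
  assumes R: "R \<in> carrier_mat k m" and W: "W \<in> carrier_mat k l" and iso: "mat_adjoint W * W = 1\<^sub>m l"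
  shows "psd (mat_adjoint R * R - mat_adjoint (mat_adjoint W * R) * (mat_adjoint W * R))"
proof -
  define S where "S = mat_adjoint W * R"
  have S: "S \<in> carrier_mat l m" unfolding S_def using R W by auto
  have WS: "W * S \<in> carrier_mat k m" using W S by auto
  note R' = mat_adjoint_carrier[OF R] and S' = mat_adjoint_carrier[OF S] and W' = mat_adjoint_carrier[OF W]
  have D: "R - W * S \<in> carrier_mat k m" by (rule minus_carrier_mat[OF WS])
  have "mat_adjoint (R - W * S) * (R - W * S) = (mat_adjoint R - mat_adjoint S * mat_adjoint W) * (R - W * S)"
    by (simp add: mat_adjoint_minus[OF R WS] mat_adjoint_mult[OF W S])
  also have "\<dots> = mat_adjoint R * (R - W * S) - mat_adjoint S * mat_adjoint W * (R - W * S)"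
    by (rule minus_mult_distrib_mat[OF R' mult_carrier_mat[OF S' W'] D])
  also have "mat_adjoint R * (R - W * S) = mat_adjoint R * R - mat_adjoint R * (W * S)"
    by (rule mult_minus_distrib_mat[OF R' R WS])
  also have "mat_adjoint R * (W * S) = mat_adjoint S * S"
    using assoc_mult_mat[OF R' W S] mat_adjoint_mult[OF W' R] by (simp add: S_def)
  also have "mat_adjoint S * mat_adjoint W * (R - W * S) = mat_adjoint S * (mat_adjoint W * (R - W * S))"
    by (rule assoc_mult_mat[OF S' W' D])
  also have "mat_adjoint W * (R - W * S) = S - mat_adjoint W * (W * S)"
    unfolding S_def[symmetric] mult_minus_distrib_mat[OF W' R WS] ..
  also have "mat_adjoint W * (W * S) = S"
    using assoc_mult_mat[OF W' W S] iso S by simp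
  also have "mat_adjoint S * (S - S) = 0\<^sub>m m m"
    using S by (simp add: minus_r_inv_mat[OF S] right_mult_zero_mat[OF S'])
  also have "mat_adjoint R * R - mat_adjoint S * S - 0\<^sub>m m m = mat_adjoint R * R - mat_adjoint S * S"
    using R S by (intro eq_matI) auto
  finally show ?thesis using psd_adjoint_mult[OF D] by (simp add: S_def)
qed

text \<open>Completing the square: at \<open>x\<close>, \<open>y\<close> the block form equals the
  squared norm of \<open>x + Q y\<close> plus the form of \<open>- L - Q^* Q\<close> at
  \<open>y\<close>. The choice \<open>x = - Q y\<close> makes the square vanish.\<close>

lemma psd_block_iff:
  fixes L Q :: "complex mat"
  assumes L: "L \<in> carrier_mat m m" and Q: "Q \<in> carrier_mat k m"
    and T: "0\<^sub>m m m - (L + mat_adjoint Q * Q) \<in> hermitian_mats m"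
    and M: "four_block_mat (1\<^sub>m k) Q (mat_adjoint Q) (- L) \<in> hermitian_mats (k + m)"
  shows "psd (0\<^sub>m m m - (L + mat_adjoint Q * Q)) \<longleftrightarrow>
    psd (four_block_mat (1\<^sub>m k) Q (mat_adjoint Q) (- L))"
proof -
  let ?T = "0\<^sub>m m m - (L + mat_adjoint Q * Q)"
  let ?M = "four_block_mat (1\<^sub>m k) Q (mat_adjoint Q) (- L)"
  note Q' = mat_adjoint_carrier[OF Q]
  have square: "(?M *\<^sub>v (x @\<^sub>v y)) \<bullet>c (x @\<^sub>v y) =
      (x + Q *\<^sub>v y) \<bullet>c (x + Q *\<^sub>v y) + (?T *\<^sub>v y) \<bullet>c y"
    if x: "x \<in> carrier_vec k" and y: "y \<in> carrier_vec m" for x y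
  proof -
    define z where "z = Q *\<^sub>v y"
    have z: "z \<in> carrier_vec k" using Q y by (simp add: z_def)
    have Ly: "L *\<^sub>v y \<in> carrier_vec m" and Qx: "mat_adjoint Q *\<^sub>v x \<in> carrier_vec m"
      and Qz: "mat_adjoint Q *\<^sub>v z \<in> carrier_vec m" using L Q' x y z by auto
    have cx: "conjugate x \<in> carrier_vec k" and cy: "conjugate y \<in> carrier_vec m"
      and cz: "conjugate z \<in> carrier_vec k" using x y z by auto
    have conj: "conjugate (x @\<^sub>v y) = conjugate x @\<^sub>v conjugate y"
      using x y by (intro eq_vecI) auto
    have "?M *\<^sub>v (x @\<^sub>v y) = (1\<^sub>m k *\<^sub>v x + Q *\<^sub>v y) @\<^sub>v (mat_adjoint Q *\<^sub>v x + (- L) *\<^sub>v y)"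
      by (rule four_block_mat_mult_vec[OF one_carrier_mat Q Q' _ x y]) (use L in auto)
    also have "\<dots> = (x + z) @\<^sub>v (mat_adjoint Q *\<^sub>v x - L *\<^sub>v y)"
      using x y L Qx by (simp add: z_def minus_add_uminus_vec[OF Qx Ly])
    finally have "(?M *\<^sub>v (x @\<^sub>v y)) \<bullet>c (x @\<^sub>v y) =
        (x + z) \<bullet> conjugate x + (mat_adjoint Q *\<^sub>v x - L *\<^sub>v y) \<bullet> conjugate y"
      by (simp only: conj scalar_prod_append[OF add_carrier_vec[OF x z] minus_carrier_vec[OF Qx Ly] cx cy])
    also have "\<dots> = x \<bullet>c x + z \<bullet>c x + (mat_adjoint Q *\<^sub>v x) \<bullet>c y - (L *\<^sub>v y) \<bullet>c y"
      using add_scalar_prod_distrib[OF x z cx] minus_scalar_prod_distrib[OF Qx Ly cy] by simp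
    also have "(mat_adjoint Q *\<^sub>v x) \<bullet>c y = x \<bullet>c z"
      using adjoint_cscalar[OF Q' x y] by (simp add: z_def)
    finally have lhs: "(?M *\<^sub>v (x @\<^sub>v y)) \<bullet>c (x @\<^sub>v y) =
        x \<bullet>c x + z \<bullet>c x + x \<bullet>c z - (L *\<^sub>v y) \<bullet>c y" .
    have QQ: "mat_adjoint Q * Q \<in> carrier_mat m m" using Q by auto
    have LQ: "L + mat_adjoint Q * Q \<in> carrier_mat m m" using L QQ by auto
    have "(L + mat_adjoint Q * Q) *\<^sub>v y = L *\<^sub>v y + mat_adjoint Q *\<^sub>v z"
      using add_mult_distrib_mat_vec[OF L QQ y] assoc_mult_mat_vec[OF Q' Q y] by (simp add: z_def)
    moreover have zero_mat_y: "0\<^sub>m m m *\<^sub>v y = 0\<^sub>v m" using y by (intro eq_vecI) auto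
    ultimately have "?T *\<^sub>v y = 0\<^sub>v m - (L *\<^sub>v y + mat_adjoint Q *\<^sub>v z)"
      using minus_mult_distrib_mat_vec[OF zero_carrier_mat LQ y] zero_mat_y by simp
    then have "(?T *\<^sub>v y) \<bullet>c y = - ((L *\<^sub>v y) \<bullet>c y + (mat_adjoint Q *\<^sub>v z) \<bullet>c y)"
      using minus_scalar_prod_distrib[OF zero_carrier_vec add_carrier_vec[OF Ly Qz] cy]
        add_scalar_prod_distrib[OF Ly Qz cy] y by simp
    moreover have "(mat_adjoint Q *\<^sub>v z) \<bullet>c y = z \<bullet>c z"
      using adjoint_cscalar[OF Q' z y] by (simp add: z_def)
    moreover have "(x + z) \<bullet>c (x + z) = x \<bullet>c x + x \<bullet>c z + (z \<bullet>c x + z \<bullet>c z)"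
      unfolding conjugate_add_vec[OF x z]
      using scalar_prod_add_distrib[OF add_carrier_vec[OF x z] cx cz] add_scalar_prod_distrib[OF x z cx]
        add_scalar_prod_distrib[OF x z cz] by simp
    ultimately show ?thesis unfolding lhs z_def[symmetric] by simp
  qed
  have "(\<forall>v\<in>carrier_vec (k + m). 0 \<le> Re ((?M *\<^sub>v v) \<bullet>c v)) \<longleftrightarrow>
      (\<forall>y\<in>carrier_vec m. 0 \<le> Re ((?T *\<^sub>v y) \<bullet>c y))"
    unfolding all_vec_append
  proof (intro iffI ballI)
    fix y :: "complex Matrix.vec"
    assume *: "\<forall>x\<in>carrier_vec k. \<forall>y\<in>carrier_vec m. 0 \<le> Re ((?M *\<^sub>v (x @\<^sub>v y)) \<bullet>c (x @\<^sub>v y))"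
      and y: "y \<in> carrier_vec m"
    have Qy: "Q *\<^sub>v y \<in> carrier_vec k" "- (Q *\<^sub>v y) \<in> carrier_vec k" using Q y by auto
    have "- (Q *\<^sub>v y) + Q *\<^sub>v y = 0\<^sub>v k" using Qy by (intro eq_vecI) auto
    then show "0 \<le> Re ((?T *\<^sub>v y) \<bullet>c y)"
      using *[rule_format, OF Qy(2) y] unfolding square[OF Qy(2) y] by simp
  next
    fix x y :: "complex Matrix.vec"
    assume *: "\<forall>y\<in>carrier_vec m. 0 \<le> Re ((?T *\<^sub>v y) \<bullet>c y)"
      and x: "x \<in> carrier_vec k" and y: "y \<in> carrier_vec m"
    show "0 \<le> Re ((?M *\<^sub>v (x @\<^sub>v y)) \<bullet>c (x @\<^sub>v y))"
      unfolding square[OF x y] using * y Re_cscalar_self[of "x + Q *\<^sub>v y"] by simp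
  qed
  then show ?thesis unfolding psd_iff[OF T] psd_iff[OF M] by blast
qed

text \<open>The pencil \<open>lam\<close> commutes with the compression and cancels. With
  \<open>R = Q * W\<close> there remains \<open>R^* R - R^* K K^* R\<close>, where \<open>K\<close>
  is the ampliation of \<open>V\<close> to the \<open>N\<close> rows of \<open>Lam\<close>; this is
  the defect of the projection \<open>K K^*\<close>.\<close>

lemma xy_convex_pencil_plus_square:
  assumes lam: "hermitian_xy_pencil \<mu> d lam" and Lam: "xy_pencil \<mu> N d Lam"
    and p_eq: "p = fp_add lam (fp_mult (fp_star Lam) Lam)"
  shows "xy_convex \<mu> d p"
  unfolding xy_convex_def
proof (intro allI impI)
  fix n m X Y V assume pair: "xy_pair \<mu> n m X Y V"
  let ?X = "\<lambda>j. compress V (X j)" and ?Y = "\<lambda>k. compress V (Y k)"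
  have X: "X \<in> hermitian_tuples \<mu> n" and Y: "Y \<in> hermitian_tuples \<mu> n"
    and V: "V \<in> carrier_mat n m" and iso: "mat_adjoint V * V = 1\<^sub>m m"
    using pair by (auto simp: xy_pair_def)
  have herm: "compress V T \<in> hermitian_mats m" if "T \<in> hermitian_mats n" for T
    using that mat_adjoint_compress[OF V, of T] V by (simp add: hermitian_mats_def)
  have X': "?X \<in> hermitian_tuples \<mu> m" and Y': "?Y \<in> hermitian_tuples \<mu> m"
    using herm X Y by (auto simp: hermitian_tuples_def)
  have lam_p: "xy_pencil \<mu> d d lam" using lam by (simp add: hermitian_xy_pencil_def)
  note f1 = xy_pencil_fpolys[OF lam_p] and f2 = xy_pencil_fpolys[OF Lam]
  note f3 = fp_mult_fpolys[OF fp_star_fpolys[OF f2] f2]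
  define W K where "W = kron (1\<^sub>m d) V" and "K = kron (1\<^sub>m N) V"
  define L Q where "L = fp_eval n lam X Y" and "Q = fp_eval n Lam X Y"
  have W: "W \<in> carrier_mat (d * n) (d * m)" and K: "K \<in> carrier_mat (N * n) (N * m)"
    unfolding W_def K_def by (rule kron_one_carrier[OF V])+
  have L: "L \<in> carrier_mat (d * n) (d * n)" and Q: "Q \<in> carrier_mat (N * n) (d * n)"
    unfolding L_def Q_def by (rule fp_eval_carrier[OF f1], rule fp_eval_carrier[OF f2])
  note W' = mat_adjoint_carrier[OF W] and K' = mat_adjoint_carrier[OF K] and Q' = mat_adjoint_carrier[OF Q]
  have R: "Q * W \<in> carrier_mat (N * n) (d * m)" using Q W by auto
  have big: "fp_eval n p X Y = L + mat_adjoint Q * Q"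
    unfolding p_eq L_def Q_def fp_eval_add[OF X Y f1 f3] fp_eval_mult[OF X Y fp_star_fpolys[OF f2] f2]
      fp_eval_star[OF X Y f2] ..
  have "mat_adjoint K * Q * W = mat_adjoint K * (Q * W)" by (rule assoc_mult_mat[OF K' Q W])
  then have small: "fp_eval m p ?X ?Y = mat_adjoint W * L * W +
      mat_adjoint (mat_adjoint K * (Q * W)) * (mat_adjoint K * (Q * W))"
    unfolding p_eq fp_eval_add[OF X' Y' f1 f3] fp_eval_mult[OF X' Y' fp_star_fpolys[OF f2] f2]
      fp_eval_star[OF X' Y' f2] xy_pencil_compress[OF lam_p pair] xy_pencil_compress[OF Lam pair]
    by (simp add: L_def Q_def W_def K_def)
  have QQ: "mat_adjoint Q * Q \<in> carrier_mat (d * n) (d * n)" using Q by auto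
  have "compress W (L + mat_adjoint Q * Q) = mat_adjoint W * L * W + mat_adjoint W * (mat_adjoint Q * Q) * W"
    unfolding compress_def mult_add_distrib_mat[OF W' L QQ]
    by (rule add_mult_distrib_mat[OF mult_carrier_mat[OF W' L] mult_carrier_mat[OF W' QQ] W])
  also have "mat_adjoint W * (mat_adjoint Q * Q) * W = mat_adjoint (Q * W) * (Q * W)"
    unfolding mat_adjoint_mult[OF Q W] assoc_mult_mat[OF W' Q' Q, symmetric]
    by (rule assoc_mult_mat[OF mult_carrier_mat[OF W' Q'] Q W])
  finally have comp: "compress W (fp_eval n p X Y) = mat_adjoint W * L * W + mat_adjoint (Q * W) * (Q * W)"
    unfolding big .
  have "compress W (fp_eval n p X Y) - fp_eval m p ?X ?Y = mat_adjoint (Q * W) * (Q * W) -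
      mat_adjoint (mat_adjoint K * (Q * W)) * (mat_adjoint K * (Q * W))"
    unfolding comp small using W L K R by (intro eq_matI) auto
  then show "loewner_le (fp_eval m p ?X ?Y) (compress (kron (1\<^sub>m d) V) (fp_eval n p X Y))"
    unfolding loewner_le_def W_def[symmetric]
    using psd_projection_defect[OF R K] kron_one_isometry[OF V iso, of N] by (simp add: K_def)
qed

subsection \<open>Decomposition into pencils\<close>

lemma fp_star_star: "fp_star (fp_star p) = p"
  by (simp add: fp_star_def)

lemma fp_star_mult:
  assumes p: "p \<in> fpolys \<mu> r k" and q: "q \<in> fpolys \<mu> k c"
  shows "fp_star (fp_mult p q) = fp_mult (fp_star q) (fp_star p)"
proof (rule fpolys_eqI)
  note p' = fp_star_fpolys[OF p] and q' = fp_star_fpolys[OF q] and pq = fp_mult_fpolys[OF p q]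
  show "fp_star (fp_mult p q) \<in> fpolys \<mu> c r" by (rule fp_star_fpolys[OF pq])
  show "fp_mult (fp_star q) (fp_star p) \<in> fpolys \<mu> c r" by (rule fp_mult_fpolys[OF q' p'])
  fix w i j assume ij: "i < c" "j < r"
  have "fp_star (fp_mult p q) w $$ (i, j) = (\<Sum>l\<le>length w. \<Sum>e<k.
      cnj (p (take l (rev w)) $$ (j, e)) * cnj (q (drop l (rev w)) $$ (e, i)))"
    by (simp add: fp_star_index[OF pq ij] fp_mult_index[OF p q ij(2,1)])
  also have "\<dots> = (\<Sum>l\<le>length w. \<Sum>e<k.
      cnj (p (rev (drop l w)) $$ (j, e)) * cnj (q (rev (take l w)) $$ (e, i)))"
    by (rule sum.reindex_bij_witness[of _ "\<lambda>l. length w - l" "\<lambda>l. length w - l"])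
      (simp_all add: take_rev drop_rev)
  also have "\<dots> = fp_mult (fp_star q) (fp_star p) w $$ (i, j)"
    unfolding fp_mult_index[OF q' p' ij] using ij
    by (intro sum.cong refl) (simp add: fp_star_index[OF p] fp_star_index[OF q])
  finally show "fp_star (fp_mult p q) w $$ (i, j) = fp_mult (fp_star q) (fp_star p) w $$ (i, j)" .
qed

lemma fp_star_minus:
  assumes p: "p \<in> fpolys \<mu> r c" and q: "q \<in> fpolys \<mu> r c"
  shows "fp_star (fp_minus p q) = fp_minus (fp_star p) (fp_star q)"
  unfolding fp_star_def fp_minus_def
  by (rule ext) (rule mat_adjoint_minus[OF fpolys_carrier[OF p] fpolys_carrier[OF q]])

lemma fp_mult_one_right:
  assumes p: "p \<in> fpolys \<mu> r k"
  shows "fp_mult p (fp_one k) = p"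
proof (rule fpolys_eqI)
  note one = fp_one_fpolys[of k \<mu>]
  show "fp_mult p (fp_one k) \<in> fpolys \<mu> r k" by (rule fp_mult_fpolys[OF p one])
  show "p \<in> fpolys \<mu> r k" by (rule p)
  fix w i j assume ij: "i < r" "j < k"
  have "fp_mult p (fp_one k) w $$ (i, j) =
      (\<Sum>l\<le>length w. \<Sum>e<k. p (take l w) $$ (i, e) * fp_one k (drop l w) $$ (e, j))"
    by (rule fp_mult_index[OF p one ij])
  also have "\<dots> = (\<Sum>l\<le>length w. if l = length w then p w $$ (i, j) else 0)"
  proof (intro sum.cong refl)
    fix l assume l: "l \<in> {..length w}"
    show "(\<Sum>e<k. p (take l w) $$ (i, e) * fp_one k (drop l w) $$ (e, j)) =
        (if l = length w then p w $$ (i, j) else 0)"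
    proof (cases "l = length w")
      case True
      have "(\<Sum>e<k. p (take l w) $$ (i, e) * fp_one k (drop l w) $$ (e, j)) =
          (\<Sum>e<k. if e = j then p w $$ (i, j) else 0)"
        using True ij by (intro sum.cong refl) (auto simp: fp_one_def)
      then show ?thesis using True ij by simp
    next
      case False
      then have "drop l w \<noteq> []" using l by simp
      then show ?thesis using False ij by (simp add: fp_one_def)
    qed
  qed
  finally show "fp_mult p (fp_one k) w $$ (i, j) = p w $$ (i, j)" by simp
qed

text \<open>The rows of the Gram factor \<open>B\<close> become the rows of \<open>Lam\<close>,
  whose square then agrees with \<open>p\<close> off the pencil words; \<open>lam\<close> is the
  remainder.\<close>

lemma xy_convex_decomposition:
  assumes p: "p \<in> fpolys \<mu> d d" and herm: "fp_hermitian p" and conv: "xy_convex \<mu> d p"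
  obtains N lam Lam where "0 < N" "hermitian_xy_pencil \<mu> d lam" "xy_pencil \<mu> N d Lam"
    "p = fp_add lam (fp_mult (fp_star Lam) Lam)"
proof -
  let ?P = "pencil_words \<mu> - {[]}"
  define A where "A = ?P \<times> {..<d}"
  obtain B where B: "\<And>w i j. w \<notin> pencil_words \<mu> \<Longrightarrow> i < d \<Longrightarrow> j < d \<Longrightarrow>
    p w $$ (i, j) = (\<Sum>l\<in>{l. l \<le> length w \<and> rev (take l w) \<in> ?P \<and> drop l w \<in> ?P}.
      \<Sum>c\<in>A. cnj (B c (rev (take l w), i)) * B c (drop l w, j))"
    using xy_convex_gram[OF p herm conv, folded A_def] by blast
  have finA: "finite A" unfolding A_def using finite_pencil_words by simp
  define k where "k = card A"
  obtain h where h: "bij_betw h {..<k} A"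
    using ex_bij_betw_nat_finite[OF finA] by (auto simp: k_def lessThan_atLeast0)
  \<comment> \<open>An additional zero row keeps \<open>N\<close> positive when the Gram index set
    is empty.\<close>
  define N where "N = Suc k"
  define Lam where "Lam w = (if w \<in> ?P then Matrix.mat N d (\<lambda>(r, j). if r < k then B (h r) (w, j) else 0)
    else 0\<^sub>m N d)" for w
  have Lam_idx: "e < Suc k \<Longrightarrow> i < d \<Longrightarrow> Lam u $$ (e, i) = (if e < k then B (h e) (u, i) else 0)"
    if "u \<in> ?P" for u e i
    using that by (simp add: Lam_def N_def)
  have Lam: "xy_pencil \<mu> N d Lam" by (auto simp: xy_pencil_iff Lam_def)
  note fL = xy_pencil_fpolys[OF Lam] and fL' = fp_star_fpolys[OF xy_pencil_fpolys[OF Lam]]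
  define q where "q = fp_mult (fp_star Lam) Lam"
  have q: "q \<in> fpolys \<mu> d d" unfolding q_def by (rule fp_mult_fpolys[OF fL' fL])
  have q_p: "q w = p w" if w: "w \<notin> pencil_words \<mu>" for w
  proof (rule eq_matI)
    fix i j assume "i < dim_row (p w)" "j < dim_col (p w)"
    then have ij: "i < d" "j < d" using p by auto
    let ?K = "{l. l \<le> length w \<and> rev (take l w) \<in> ?P \<and> drop l w \<in> ?P}"
    have "q w $$ (i, j) = (\<Sum>l\<le>length w. \<Sum>e<N. cnj (Lam (rev (take l w)) $$ (e, i)) * Lam (drop l w) $$ (e, j))"
      unfolding q_def fp_mult_index[OF fL' fL ij] using ij
      by (intro sum.cong refl) (simp add: fp_star_index[OF fL])
    \<comment> \<open>\<open>Lam\<close> vanishes at the empty word and off the pencil words, so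
      only the cuts into two Gram indices survive.\<close>
    also have "\<dots> = (\<Sum>l\<in>?K. \<Sum>e<N. cnj (Lam (rev (take l w)) $$ (e, i)) * Lam (drop l w) $$ (e, j))"
      using ij by (intro sum.mono_neutral_right) (auto simp: Lam_def)
    also have "\<dots> = (\<Sum>l\<in>?K. \<Sum>e<k. cnj (B (h e) (rev (take l w), i)) * B (h e) (drop l w, j))"
    proof (rule sum.cong[OF refl])
      fix l assume "l \<in> ?K"
      then have l: "rev (take l w) \<in> ?P" "drop l w \<in> ?P" by blast+
      show "(\<Sum>e<N. cnj (Lam (rev (take l w)) $$ (e, i)) * Lam (drop l w) $$ (e, j)) =
          (\<Sum>e<k. cnj (B (h e) (rev (take l w), i)) * B (h e) (drop l w, j))"
        unfolding N_def sum.lessThan_Suc by (simp add: Lam_idx[OF l(1) _ ij(1)] Lam_idx[OF l(2) _ ij(2)])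
    qed
    also have "\<dots> = (\<Sum>l\<in>?K. \<Sum>c\<in>A. cnj (B c (rev (take l w), i)) * B c (drop l w, j))"
      by (rule sum.cong[OF refl]) (rule sum.reindex_bij_betw[OF h])
    also have "\<dots> = p w $$ (i, j)" by (rule B[OF w ij, symmetric])
    finally show "q w $$ (i, j) = p w $$ (i, j)" .
  qed (use p q in auto)
  define lam where "lam = fp_minus p q"
  have lam_f: "lam \<in> fpolys \<mu> d d" unfolding lam_def by (rule fp_minus_fpolys[OF p q])
  have "lam w = 0\<^sub>m d d" if "w \<notin> pencil_words \<mu>" for w
    using q_p[OF that] fpolys_carrier[OF p, of w] by (simp add: lam_def fp_minus_def)
  then have "xy_pencil \<mu> d d lam" using fpolys_carrier[OF lam_f] by (simp add: xy_pencil_iff)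
  moreover have "fp_hermitian lam"
  proof -
    have "fp_star q = q" unfolding q_def by (simp add: fp_star_mult[OF fL' fL] fp_star_star)
    then show ?thesis using herm by (simp add: fp_hermitian_def lam_def fp_star_minus[OF p q])
  qed
  ultimately have "hermitian_xy_pencil \<mu> d lam" by (simp add: hermitian_xy_pencil_def)
  moreover have "p = fp_add lam (fp_mult (fp_star Lam) Lam)"
    unfolding q_def[symmetric]
  proof (rule fpolys_eqI[OF p fp_add_fpolys[OF lam_f q]])
    show "p w $$ (i, j) = fp_add lam q w $$ (i, j)" if "i < d" "j < d" for w i j
      using that p q by (simp add: fp_add_def lam_def fp_minus_def)
  qed
  ultimately show thesis using that[of N lam Lam] Lam by (simp add: N_def)
qed

theorem theorem1p1:
  fixes \<mu> d :: nat and p :: fpoly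
  assumes p: "p \<in> fpolys \<mu> d d" and herm: "fp_hermitian p"
  shows
    "(xy_convex \<mu> d p \<longrightarrow>
       (\<exists>N lam Lam. 0 < N \<and> hermitian_xy_pencil \<mu> d lam \<and> xy_pencil \<mu> N d Lam \<and>
          p = fp_add lam (fp_mult (fp_star Lam) Lam) \<and>
          (let M = fp_block (fp_one N) Lam (fp_star Lam) (fp_uminus lam) in
             hermitian_xy_pencil \<mu> (N + d) M \<and>
             fp_uminus p = fp_minus (fp_uminus lam) (fp_mult (fp_star Lam) Lam) \<and>
             fp_schur_complement \<mu> N d M (fp_uminus p) \<and>
             (\<forall>n>0. \<forall>X \<in> hermitian_tuples \<mu> n. \<forall>Y \<in> hermitian_tuples \<mu> n.
                loewner_le (fp_eval n p X Y) (0\<^sub>m (d * n) (d * n)) \<longleftrightarrow>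
                psd (fp_eval n M X Y))))) \<and>
     (\<forall>N lam Lam. 0 < N \<and> hermitian_xy_pencil \<mu> d lam \<and> xy_pencil \<mu> N d Lam \<and>
          p = fp_add lam (fp_mult (fp_star Lam) Lam) \<longrightarrow>
        xy_convex \<mu> d p)"
proof (intro conjI impI)
  show "\<forall>N lam Lam. 0 < N \<and> hermitian_xy_pencil \<mu> d lam \<and> xy_pencil \<mu> N d Lam \<and>
      p = fp_add lam (fp_mult (fp_star Lam) Lam) \<longrightarrow> xy_convex \<mu> d p"
    using xy_convex_pencil_plus_square by blast
next
  assume "xy_convex \<mu> d p"
  then obtain N lam Lam where N: "0 < N" and lam: "hermitian_xy_pencil \<mu> d lam"
    and Lam: "xy_pencil \<mu> N d Lam" and p_eq: "p = fp_add lam (fp_mult (fp_star Lam) Lam)"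
    using xy_convex_decomposition[OF p herm] by blast
  define M where "M = fp_block (fp_one N) Lam (fp_star Lam) (fp_uminus lam)"
  have lam_p: "xy_pencil \<mu> d d lam" and lam_h: "fp_star lam = lam"
    using lam by (auto simp: hermitian_xy_pencil_def fp_hermitian_def)
  note f_one = fp_one_fpolys[of N \<mu>]
  note f_lam = xy_pencil_fpolys[OF lam_p] and f_Lam = xy_pencil_fpolys[OF Lam]
  note f_star = fp_star_fpolys[OF f_Lam] and f_neg = fp_uminus_fpolys[OF f_lam]
  note f_sq = fp_mult_fpolys[OF f_star f_Lam]
  have f_M: "M \<in> fpolys \<mu> (N + d) (N + d)"
    unfolding M_def by (rule fp_block_fpolys[OF f_one f_Lam f_star f_neg])
  have "M w = 0\<^sub>m (N + d) (N + d)" if w: "w \<notin> pencil_words \<mu>" for w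
  proof -
    have "w \<noteq> []" using w by (auto simp: pencil_words_def words_def)
    moreover have "rev w \<notin> pencil_words \<mu>" using rev_pencil_words[of "rev w"] w by auto
    ultimately have "fp_one N w = 0\<^sub>m N N" "Lam w = 0\<^sub>m N d" "Lam (rev w) = 0\<^sub>m N d" "lam w = 0\<^sub>m d d"
      using Lam lam_p w by (auto simp: fp_one_def xy_pencil_iff)
    then show ?thesis
      by (auto simp: M_def fp_block_def fp_star_def fp_uminus_def intro!: eq_matI)
  qed
  then have M_pencil: "xy_pencil \<mu> (N + d) (N + d) M"
    using fpolys_carrier[OF f_M] by (simp add: xy_pencil_iff)
  have M_herm: "fp_hermitian M"
    unfolding fp_hermitian_def
  proof (rule fpolys_eqI[OF fp_star_fpolys[OF f_M] f_M])
    fix w i j assume ij: "i < N + d" "j < N + d"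
    have lam_ij: "cnj (lam (rev w) $$ (j, i)) = lam w $$ (i, j)" if "i < d" "j < d" for i j
      using fp_star_index[OF f_lam that, of w] lam_h by simp
    show "fp_star M w $$ (i, j) = M w $$ (i, j)"
      unfolding fp_star_index[OF f_M ij]
      using ij fpolys_dim[OF f_Lam] fpolys_dim[OF f_lam] lam_ij[of "i - N" "j - N"]
      by (auto simp: M_def fp_block_def fp_one_def fp_star_def fp_uminus_def)
  qed
  have neg: "fp_uminus p = fp_minus (fp_uminus lam) (fp_mult (fp_star Lam) Lam)"
  proof (rule fpolys_eqI[OF fp_uminus_fpolys[OF p] fp_minus_fpolys[OF f_neg f_sq]])
    show "fp_uminus p w $$ (i, j) = fp_minus (fp_uminus lam) (fp_mult (fp_star Lam) Lam) w $$ (i, j)"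
      if "i < d" "j < d" for w i j
      using that f_lam f_sq unfolding p_eq by (simp add: fp_add_def fp_minus_def fp_uminus_def)
  qed
  \<comment> \<open>The upper left block is the unit, hence its own inverse.\<close>
  have schur: "fp_schur_complement \<mu> N d M (fp_uminus p)"
    unfolding fp_schur_complement_def
  proof (intro bexI conjI)
    show "M = fp_block (fp_one N) Lam (fp_star Lam) (fp_uminus lam)" by (rule M_def)
    show "fp_mult (fp_one N) (fp_one N) = fp_one N" by (rule fp_mult_one_right[OF f_one])
    show "fp_mult (fp_one N) (fp_one N) = fp_one N" by (rule fp_mult_one_right[OF f_one])
    show "fp_uminus p = fp_minus (fp_uminus lam) (fp_mult (fp_mult (fp_star Lam) (fp_one N)) Lam)"
      unfolding fp_mult_one_right[OF f_star] by (rule neg)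
  qed (rule f_one f_Lam f_star f_neg)+
  \<comment> \<open>Evaluation respects sums, products, adjoints and blocks, so the equivalence is
    the completed square for the evaluated matrices.\<close>
  have feasible: "loewner_le (fp_eval n p X Y) (0\<^sub>m (d * n) (d * n)) \<longleftrightarrow> psd (fp_eval n M X Y)"
    if X: "X \<in> hermitian_tuples \<mu> n" and Y: "Y \<in> hermitian_tuples \<mu> n" for n X Y
  proof -
    let ?L = "fp_eval n lam X Y" and ?Q = "fp_eval n Lam X Y"
    have P: "fp_eval n p X Y = ?L + mat_adjoint ?Q * ?Q"
      unfolding p_eq fp_eval_add[OF X Y f_lam f_sq] fp_eval_mult[OF X Y f_star f_Lam]
        fp_eval_star[OF X Y f_Lam] ..
    have M_eval: "fp_eval n M X Y = four_block_mat (1\<^sub>m (N * n)) ?Q (mat_adjoint ?Q) (- ?L)"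
      unfolding M_def fp_eval_block[OF X Y f_one f_Lam f_star f_neg] fp_eval_one[OF X Y]
        fp_eval_star[OF X Y f_Lam] fp_eval_uminus[OF X Y f_lam] ..
    have "0\<^sub>m (d * n) (d * n) - fp_eval n p X Y \<in> hermitian_mats (d * n)"
    proof -
      have "fp_eval n p X Y \<in> hermitian_mats (d * n)" by (rule fp_eval_hermitian[OF X Y p herm])
      then show ?thesis
        using mat_adjoint_minus[OF zero_carrier_mat fp_eval_carrier[OF p], of n X Y] fp_eval_carrier[OF p, of n X Y]
        by (auto simp: hermitian_mats_def intro!: minus_carrier_mat eq_matI)
    qed
    moreover have "fp_eval n M X Y \<in> hermitian_mats (N * n + d * n)"
      using fp_eval_hermitian[OF X Y f_M M_herm] by (simp add: distrib_right)
    ultimately show ?thesis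
      unfolding loewner_le_def P M_eval
      by (intro psd_block_iff fp_eval_carrier[OF f_lam] fp_eval_carrier[OF f_Lam])
  qed
  show "\<exists>N lam Lam. 0 < N \<and> hermitian_xy_pencil \<mu> d lam \<and> xy_pencil \<mu> N d Lam \<and>
      p = fp_add lam (fp_mult (fp_star Lam) Lam) \<and>
      (let M = fp_block (fp_one N) Lam (fp_star Lam) (fp_uminus lam) in
         hermitian_xy_pencil \<mu> (N + d) M \<and>
         fp_uminus p = fp_minus (fp_uminus lam) (fp_mult (fp_star Lam) Lam) \<and>
         fp_schur_complement \<mu> N d M (fp_uminus p) \<and>
         (\<forall>n>0. \<forall>X \<in> hermitian_tuples \<mu> n. \<forall>Y \<in> hermitian_tuples \<mu> n.
            loewner_le (fp_eval n p X Y) (0\<^sub>m (d * n) (d * n)) \<longleftrightarrow> psd (fp_eval n M X Y)))"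
    unfolding Let_def
    by (rule exI[of _ N], rule exI[of _ lam], rule exI[of _ Lam], fold M_def)
      (use N lam Lam p_eq M_pencil M_herm neg schur feasible in \<open>simp add: hermitian_xy_pencil_def\<close>)
qed

end
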